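(* Let $K$ be an algebraically closed field of characteristic $0$, and let $F:\mathbb{P}^2\dashrightarrow\mathbb{P}^2$ be a rational map over $K$ such that: (i) $F$ is a dominant rational map of degree $2$, i.e., $F^*\mathcal{O}_{\mathbb{P}^2}(1)=\mathcal{O}_{\mathbb{P}^2}(2)$; (ii) $F$ is in the $\operatorname{SL}_3$-unstable locus of $\operatorname{Rat}_2^2$. Then one of the following is true: (a) The map $F$ factors through a non-constant linear projection to $\mathbb{P}^1$, i.e., there are a rational map $\pi:\mathbb{P}^2\dashrightarrow\mathbb{P}^1$ satisfying $\pi^*\mathcal{O}_{\mathbb{P}^1}(1)=\mathcal{O}_{\mathbb{P}^2}(1)$ and a rational map $G:\mathbb{P}^1\to\mathbb{P}^1$ such that $\pi\circ F=G\circ\pi$. (b) The second iterate of $F$ satisfies $\deg(F^2)\le 2$, so in particular $F$ is not algebraically stable in the sense of dynamical systems.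
   Context: The degree of a rational map $\mathbb{P}^2\dashrightarrow\mathbb{P}^2$ is the common degree of its coordinate forms when these are written as homogeneous polynomials with no common factor, and $F^2=F\circ F$. A dominant rational map $F:\mathbb{P}^N\dashrightarrow\mathbb{P}^N$ is algebraically stable (in the sense of dynamics) if $\deg(F^n)=(\deg F)^n$ for all $n\ge 1$. A rational map $\pi:\mathbb{P}^2\dashrightarrow\mathbb{P}^1$ with $\pi^*\mathcal{O}_{\mathbb{P}^1}(1)=\mathcal{O}_{\mathbb{P}^2}(1)$ is one given by $\pi=[\lambda_1:\lambda_2]$ with $\lambda_1,\lambda_2$ linear forms in the coordinates of $\mathbb{P}^2$; being a non-constant linear projection means that $\lambda_1,\lambda_2$ are linearly independent. Parameter space and action: let $V$ be the $K$-vector space of triples $F=(F_1,F_2,F_3)$ of homogeneous polynomials of degree $2$ in three variables, and let $\mathbb{P}^M=\mathbb{P}(V)$ be the projective space of lines in $V$. A degree $2$ rational map $\mathbb{P}^2\dashrightarrow\mathbb{P}^2$ is identified with the point $[F_1:F_2:F_3]\in\mathbb{P}^M$ given by its coefficients, and $\operatorname{Rat}_2^2$ denotes the parameter space of such maps inside $\mathbb{P}^M$. The group $\operatorname{SL}_3$ acts linearly on $V$, hence on $\mathbb{P}^M$, by conjugation: $A\cdot F=A\circ F\circ A^{-1}$. Stability is in the sense of geometric invariant theory for this action of $\operatorname{SL}_3$, relative to $\mathcal{O}_{\mathbb{P}^M}(1)$ with the linearization given by the linear action on $V$. A point is semistable if some non-constant homogeneous $\operatorname{SL}_3$-invariant polynomial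 on $V$ does not vanish at it. A point is unstable if it is not semistable. *)

theory Defs
  imports
    "HOL-Library.Poly_Mapping"
    "HOL-Library.Numeral_Type"
    "HOL-Analysis.Determinants"
    "HOL-Computational_Algebra.Fundamental_Theorem_Algebra"
begin

section \<open>Polynomials and forms\<close>

text \<open>Polynomials over \<open>'k\<close> in variables indexed by \<open>'x\<close>: finitely supported functions from
  monomials (exponent vectors) to coefficients, with the convolution product.\<close>

type_synonym ('x, 'k) mpoly = "('x \<Rightarrow>\<^sub>0 nat) \<Rightarrow>\<^sub>0 'k"

definition Const :: "'k \<Rightarrow> ('x, 'k::zero) mpoly"
  where "Const c = Poly_Mapping.single 0 c"

definition Var :: "'x \<Rightarrow> ('x, 'k::zero_neq_one) mpoly"
  where "Var i = Poly_Mapping.single (Poly_Mapping.single i 1) 1"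

definition monom_deg :: "('x \<Rightarrow>\<^sub>0 nat) \<Rightarrow> nat"
  where "monom_deg m = (\<Sum>i\<in>Poly_Mapping.keys m. Poly_Mapping.lookup m i)"

definition homogeneous :: "nat \<Rightarrow> ('x, 'k::zero) mpoly \<Rightarrow> bool"
  where "homogeneous d p \<longleftrightarrow> (\<forall>m\<in>Poly_Mapping.keys p. monom_deg m = d)"

text \<open>The value of a polynomial at \<open>x\<close> in a ring \<open>'r\<close>, with coefficients mapped by \<open>c\<close>:
  evaluation at a point for \<open>c = (\<lambda>a. a)\<close>, substitution of polynomials for \<open>c = Const\<close>.\<close>

definition insertion ::
    "('k \<Rightarrow> 'r) \<Rightarrow> ('x \<Rightarrow> 'r) \<Rightarrow> ('x, 'k::zero) mpoly \<Rightarrow> 'r::comm_semiring_1"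
  where "insertion c x p = (\<Sum>m\<in>Poly_Mapping.keys p.
    c (Poly_Mapping.lookup p m) * (\<Prod>i\<in>Poly_Mapping.keys m. x i ^ Poly_Mapping.lookup m i))"

definition eval_tuple :: "('n::finite, 'k) mpoly ^ 'm::finite \<Rightarrow> 'k::comm_semiring_1 ^ 'n \<Rightarrow> 'k ^ 'm"
  where "eval_tuple F x = (\<chi> i. insertion (\<lambda>a. a) (\<lambda>j. x $ j) (F $ i))"

definition comp_tuple ::
    "('m::finite, 'k) mpoly ^ 'l::finite \<Rightarrow> ('n::finite, 'k::comm_semiring_1) mpoly ^ 'm
      \<Rightarrow> ('n, 'k) mpoly ^ 'l"  (infixl \<open>\<circ>\<^sub>t\<close> 55)
  where "G \<circ>\<^sub>t F = (\<chi> i. insertion Const (\<lambda>j. F $ j) (G $ i))"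


section \<open>Rational maps between projective spaces\<close>

text \<open>A tuple of forms of a common degree, not all zero, represents a rational map from the
  projective space with coordinates indexed by \<open>'n\<close> to that with coordinates indexed by \<open>'m\<close>.\<close>

definition ratmap_rep :: "nat \<Rightarrow> ('n::finite, 'k::zero) mpoly ^ 'm::finite \<Rightarrow> bool"
  where "ratmap_rep d F \<longleftrightarrow> F \<noteq> 0 \<and> (\<forall>i. homogeneous d (F $ i))"

text \<open>The representative without common factor is unique up to a nonzero scalar.\<close>

definition reduced_rep ::
    "nat \<Rightarrow> ('n::finite, 'k::comm_semiring_1) mpoly ^ 'm::finite \<Rightarrow> bool"
  where "reduced_rep d F \<longleftrightarrow> ratmap_rep d F \<and> (\<forall>p. (\<forall>i. p dvd F $ i) \<longrightarrow> p dvd 1)"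

text \<open>The condition that the tuples be nonzero matters for composites: a composite of rational
  maps is defined exactly if the composed tuple is nonzero.\<close>

definition same_ratmap ::
    "('n::finite, 'k::comm_semiring_1) mpoly ^ 'm::finite \<Rightarrow> ('n, 'k) mpoly ^ 'm \<Rightarrow> bool"
  where "same_ratmap F G \<longleftrightarrow> F \<noteq> 0 \<and> G \<noteq> 0 \<and> (\<forall>i j. F $ i * G $ j = F $ j * G $ i)"

definition ratmap_degree :: "('n::finite, 'k::comm_semiring_1) mpoly ^ 'm::finite \<Rightarrow> nat"
  where "ratmap_degree F = (THE d. \<exists>G. reduced_rep d G \<and> same_ratmap G F)"

text \<open>The image is Zariski dense: only the zero form vanishes on it.\<close>

definition dominant :: "('n::finite, 'k::comm_semiring_1) mpoly ^ 'm::finite \<Rightarrow> bool"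
  where "dominant F \<longleftrightarrow> (\<forall>e (H :: ('m, 'k) mpoly).
    homogeneous e H \<and>
    (\<forall>x. x \<noteq> 0 \<and> eval_tuple F x \<noteq> 0 \<longrightarrow> insertion (\<lambda>a. a) (\<lambda>i. eval_tuple F x $ i) H = 0)
    \<longrightarrow> H = 0)"

primrec iterate_tuple ::
    "nat \<Rightarrow> ('n::finite, 'k::comm_semiring_1) mpoly ^ 'n \<Rightarrow> ('n, 'k) mpoly ^ 'n"
  where
    "iterate_tuple 0 F = (\<chi> i. Var i)"
  | "iterate_tuple (Suc n) F = F \<circ>\<^sub>t iterate_tuple n F"

definition algebraically_stable :: "('n::finite, 'k::comm_semiring_1) mpoly ^ 'n \<Rightarrow> bool"
  where "algebraically_stable F \<longleftrightarrow>
    (\<forall>n\<ge>1. ratmap_degree (iterate_tuple n F) = ratmap_degree F ^ n)"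

definition linear_projection :: "('n::finite, 'k::comm_ring_1) mpoly ^ 2 \<Rightarrow> bool"
  where "linear_projection \<pi> \<longleftrightarrow> (\<forall>i. homogeneous 1 (\<pi> $ i)) \<and>
    (\<forall>a b. Const a * \<pi> $ 1 + Const b * \<pi> $ 2 = 0 \<longrightarrow> a = 0 \<and> b = 0)"

definition factors_through_linear_projection :: "('n::finite, 'k::comm_ring_1) mpoly ^ 'n \<Rightarrow> bool"
  where "factors_through_linear_projection F \<longleftrightarrow>
    (\<exists>(\<pi> :: ('n, 'k) mpoly ^ 2) (G :: (2, 'k) mpoly ^ 2) e.
      linear_projection \<pi> \<and> ratmap_rep e G \<and> same_ratmap (\<pi> \<circ>\<^sub>t F) (G \<circ>\<^sub>t \<pi>))"


section \<open>Stability for the conjugation action\<close>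

definition form_tuples :: "nat \<Rightarrow> (('n::finite, 'k::zero) mpoly ^ 'n) set"
  where "form_tuples d = {F. \<forall>i. homogeneous d (F $ i)}"

definition matrix_tuple :: "'k::comm_semiring_1 ^ 'n::finite ^ 'm::finite \<Rightarrow> ('n, 'k) mpoly ^ 'm"
  where "matrix_tuple A = (\<chi> i. \<Sum>j\<in>UNIV. Const (A $ i $ j) * Var j)"

definition conj_action ::
    "'k::comm_semiring_1 ^ 'n::finite ^ 'n \<Rightarrow> ('n, 'k) mpoly ^ 'n \<Rightarrow> ('n, 'k) mpoly ^ 'n"
  where "conj_action A F = matrix_tuple A \<circ>\<^sub>t F \<circ>\<^sub>t matrix_tuple (matrix_inv A)"

text \<open>A coordinate on \<open>form_tuples d\<close> is a pair \<open>(i, m)\<close> with \<open>m\<close> a monomial of degree \<open>d\<close>: its value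
  at \<open>F\<close> is the coefficient of \<open>m\<close> in the \<open>i\<close>-th form. A polynomial on \<open>form_tuples d\<close> is a
  polynomial in these variables only.\<close>

definition polynomials_on_form_tuples :: "nat \<Rightarrow> ('n::finite \<times> ('n \<Rightarrow>\<^sub>0 nat), 'k::zero) mpoly set"
  where "polynomials_on_form_tuples d =
    {P. \<forall>u\<in>Poly_Mapping.keys P. Poly_Mapping.keys u \<subseteq> {(i, m). monom_deg m = d}}"

definition eval_at_forms ::
    "('n::finite \<times> ('n \<Rightarrow>\<^sub>0 nat), 'k::comm_semiring_1) mpoly \<Rightarrow> ('n, 'k) mpoly ^ 'n \<Rightarrow> 'k"
  where "eval_at_forms P F = insertion (\<lambda>a. a) (\<lambda>(i, m). Poly_Mapping.lookup (F $ i) m) P"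

definition SL_invariant ::
    "nat \<Rightarrow> ('n::finite \<times> ('n \<Rightarrow>\<^sub>0 nat), 'k::comm_ring_1) mpoly \<Rightarrow> bool"
  where "SL_invariant d P \<longleftrightarrow> (\<forall>A :: 'k ^ 'n ^ 'n. det A = 1 \<longrightarrow>
    (\<forall>F\<in>form_tuples d. eval_at_forms P (conj_action A F) = eval_at_forms P F))"

definition semistable :: "nat \<Rightarrow> ('n::finite, 'k::comm_ring_1) mpoly ^ 'n \<Rightarrow> bool"
  where "semistable d F \<longleftrightarrow> (\<exists>(P :: ('n \<times> ('n \<Rightarrow>\<^sub>0 nat), 'k) mpoly) r.
    P \<in> polynomials_on_form_tuples d \<and> homogeneous r P \<and> r > 0 \<and> SL_invariant d P \<and>
    eval_at_forms P F \<noteq> 0)"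

definition unstable :: "nat \<Rightarrow> ('n::finite, 'k::comm_ring_1) mpoly ^ 'n \<Rightarrow> bool"
  where "unstable d F \<longleftrightarrow> \<not> semistable d F"

end

theory Submission
  imports Defs "Berlekamp_Zassenhaus.Unique_Factorization_Poly"
begin

text \<open>The argument is the Hilbert--Mumford criterion, proved with places instead of curves. Let
  \<open>Z\<close> be the generic \<open>3 \<times> 3\<close> matrix, with entries in the function field \<open>L\<close> of the space of
  matrices. If \<open>1\<close> were a polynomial without constant term in the coefficients of the generic
  conjugate \<open>Z \<cdot> F\<close>, suitably scaled by \<open>det Z\<close>, then averaging this relation by Cayley's
  \<open>\<Omega>\<close>-process would give an invariant that does not vanish at \<open>F\<close>. So for unstable \<open>F\<close> there is a
  \<open>K\<close>-valued place of \<open>L\<close> at which all these coefficients vanish. The elementary divisors of \<open>Z\<close>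
  with respect to the valuation ring of the place play the role of a one-parameter subgroup: in
  the coordinates of \<open>K\<^sup>3\<close> obtained by reduction, all coefficients of \<open>F\<close> with nonpositive weight
  vanish. According to the sign of the middle weight, either the first two coordinates of \<open>F\<close> do
  not involve the third variable, which gives the factorization, or \<open>F\<close> has the form
  \<open>[c x\<^sub>1\<^sup>2 : x\<^sub>1 l : x\<^sub>1 m + d x\<^sub>2\<^sup>2]\<close>; then \<open>x\<^sub>1\<^sup>2\<close> divides all coordinates of \<open>F \<circ> F\<close>. That the
  degree of a rational map is well defined rests on unique factorization.\<close>

section \<open>Polynomials\<close>

hide_const (open) Determinant.det Matrix.mat
hide_fact (open) Matrix.vec_eq_iff Matrix.mat_def
no_notation Matrix.vec_index (infixl \<open>$\<close> 100)

text \<open>The value group of the place may have any rank and need not be discrete, so no weight is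
  ever a number here. Values are compared by divisibility in the valuation ring, and "nonpositive
  weight" means that an explicit monomial in the elementary divisors has an inverse in that ring.
  The generic matrix does not have determinant 1, and its function field contains no cube root of
  the determinant by which it could be normalised. This is why products of three coefficients,
  multiplied by one determinant, take the place of single coefficients: they do not change when the
  matrix is rescaled, and the first elementary divisor cancels from all weights. The values of the
  place have to lie in \<open>K\<close> itself, because the new coordinates must be defined over
  \<open>K\<close>. Algebraic closedness enters there: a polynomial over \<open>K\<close> without
  roots is constant. Characteristic 0 is used for the constants in Cayley's identity and for the
  factor 2 between a quadratic form and its symmetric tensor.\<close>

lemma monom_deg_superset:
  assumes "finite S" "Poly_Mapping.keys m \<subseteq> S"
  shows "monom_deg m = (\<Sum>i\<in>S. Poly_Mapping.lookup m i)"
  unfolding monom_deg_def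
  by (rule sum.mono_neutral_left) (use assms in \<open>auto simp: in_keys_iff\<close>)

lemma monom_deg_0 [simp]: "monom_deg 0 = 0"
  by (simp add: monom_deg_def)

lemma monom_deg_single [simp]: "monom_deg (Poly_Mapping.single i n) = n"
  by (simp add: monom_deg_superset[of "{i}"] lookup_single)

lemma monom_deg_add: "monom_deg (a + b) = monom_deg a + monom_deg b"
proof -
  let ?S = "Poly_Mapping.keys a \<union> Poly_Mapping.keys b"
  have "monom_deg (a + b) = (\<Sum>i\<in>?S. Poly_Mapping.lookup (a + b) i)"
    by (rule monom_deg_superset) (auto simp: in_keys_iff lookup_add)
  then show ?thesis
    by (simp add: monom_deg_superset[of ?S] lookup_add sum.distrib)
qed

lemma poly_mapping_eq_sum_single:
  "(\<Sum>m\<in>Poly_Mapping.keys p. Poly_Mapping.single m (Poly_Mapping.lookup p m)) = p"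
  by (rule poly_mapping_eqI)
    (auto simp: lookup_sum lookup_single when_def in_keys_iff sum.delta' if_distrib cong: if_cong)

section \<open>Evaluation of monomials and substitution\<close>

definition mon_eval :: "('x \<Rightarrow> 'r::comm_semiring_1) \<Rightarrow> ('x \<Rightarrow>\<^sub>0 nat) \<Rightarrow> 'r"
  where "mon_eval x m = (\<Prod>i\<in>Poly_Mapping.keys m. x i ^ Poly_Mapping.lookup m i)"

lemma mon_eval_superset:
  assumes "finite S" "Poly_Mapping.keys m \<subseteq> S"
  shows "mon_eval x m = (\<Prod>i\<in>S. x i ^ Poly_Mapping.lookup m i)"
  unfolding mon_eval_def
  by (rule prod.mono_neutral_left) (use assms in \<open>auto simp: in_keys_iff\<close>)

lemma mon_eval_0 [simp]: "mon_eval x 0 = 1"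
  by (simp add: mon_eval_def)

lemma mon_eval_single [simp]: "mon_eval x (Poly_Mapping.single i n) = x i ^ n"
  by (simp add: mon_eval_superset[of "{i}"])

lemma mon_eval_add: "mon_eval x (a + b) = mon_eval x a * mon_eval x b"
proof -
  let ?S = "Poly_Mapping.keys a \<union> Poly_Mapping.keys b"
  have "mon_eval x (a + b) = (\<Prod>i\<in>?S. x i ^ Poly_Mapping.lookup (a + b) i)"
    by (rule mon_eval_superset) (auto simp: in_keys_iff lookup_add)
  then show ?thesis
    by (simp add: mon_eval_superset[of ?S] lookup_add power_add prod.distrib)
qed

lemma insertion_altdef:
  "insertion c x p = (\<Sum>m\<in>Poly_Mapping.keys p. c (Poly_Mapping.lookup p m) * mon_eval x m)"
  by (simp add: insertion_def mon_eval_def)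

lemma insertion_superset:
  assumes "finite S" "Poly_Mapping.keys p \<subseteq> S" "c 0 = 0"
  shows "insertion c x p = (\<Sum>m\<in>S. c (Poly_Mapping.lookup p m) * mon_eval x m)"
  unfolding insertion_altdef
  by (rule sum.mono_neutral_left) (use assms in \<open>auto simp: in_keys_iff\<close>)

lemma insertion_single: "c 0 = 0 \<Longrightarrow> insertion c x (Poly_Mapping.single m a) = c a * mon_eval x m"
  by (simp add: insertion_superset[of "{m}"])

lemma insertion_Const [simp]: "c 0 = 0 \<Longrightarrow> insertion c x (Const a) = c a"
  by (simp add: Const_def insertion_single)

lemma insertion_Var [simp]: "c 0 = 0 \<Longrightarrow> c 1 = 1 \<Longrightarrow> insertion c x (Var i) = x i"
  by (simp add: Var_def insertion_single)

lemma insertion_add: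
  assumes "c 0 = 0" "\<And>a b. c (a + b) = c a + c b"
  shows "insertion c x (p + q) = insertion c x p + insertion c x q"
proof -
  let ?S = "Poly_Mapping.keys p \<union> Poly_Mapping.keys q"
  have "insertion c x (p + q) = (\<Sum>m\<in>?S. c (Poly_Mapping.lookup (p + q) m) * mon_eval x m)"
    by (rule insertion_superset) (use assms in \<open>auto simp: in_keys_iff lookup_add\<close>)
  then show ?thesis
    using assms by (simp add: insertion_superset[of ?S] lookup_add distrib_right sum.distrib)
qed

lemma comm_semiring_hom_insertion:
  assumes "comm_semiring_hom c"
  shows "comm_semiring_hom (insertion c x)"
proof -
  interpret c: comm_semiring_hom c by fact
  note add = insertion_add[of c, OF c.hom_zero c.hom_add]
  have sum: "insertion c x (sum f A) = (\<Sum>a\<in>A. insertion c x (f a))" for f and A :: "'d set"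
    by (induction A rule: infinite_finite_induct) (simp_all add: add insertion_altdef[of _ _ 0])
  have mult: "insertion c x (p * q) = insertion c x p * insertion c x q" for p q
  proof -
    have "p * q = (\<Sum>m\<in>Poly_Mapping.keys p. \<Sum>n\<in>Poly_Mapping.keys q.
        Poly_Mapping.single (m + n) (Poly_Mapping.lookup p m * Poly_Mapping.lookup q n))"
      by (subst (1) poly_mapping_eq_sum_single[of p, symmetric],
          subst (1) poly_mapping_eq_sum_single[of q, symmetric])
        (simp add: sum_product mult_single)
    then have "insertion c x (p * q) = (\<Sum>m\<in>Poly_Mapping.keys p. \<Sum>n\<in>Poly_Mapping.keys q.
        c (Poly_Mapping.lookup p m * Poly_Mapping.lookup q n) * (mon_eval x m * mon_eval x n))"
      by (simp only: sum insertion_single c.hom_zero mon_eval_add)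
    also have "\<dots> = insertion c x p * insertion c x q"
      by (simp add: insertion_altdef sum_product c.hom_mult mult_ac)
    finally show ?thesis .
  qed
  have one: "insertion c x 1 = 1"
    using insertion_Const[of c x 1] by (simp add: Const_def)
  show ?thesis
    by unfold_locales (simp_all add: add mult one insertion_altdef[of _ _ 0])
qed

lemma comm_ring_hom_insertion:
  fixes c :: "'k::comm_ring_1 \<Rightarrow> 'r::comm_ring_1"
  assumes "comm_ring_hom c"
  shows "comm_ring_hom (insertion c x)"
proof -
  interpret c: comm_ring_hom c by fact
  interpret comm_semiring_hom "insertion c x"
    by (rule comm_semiring_hom_insertion) unfold_locales
  show ?thesis by unfold_locales
qed

lemma comm_ring_hom_id: "comm_ring_hom (\<lambda>a::'k::comm_ring_1. a)"
  by unfold_locales auto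

lemma Const_0 [simp]: "Const 0 = 0"
  by (simp add: Const_def)

lemma Const_1 [simp]: "Const 1 = 1"
  by (simp add: Const_def)

lemma Const_add: "Const (a + b) = Const a + Const b"
  by (simp add: Const_def single_add)

lemma Const_mult: "Const (a * b) = Const a * Const (b::'k::semiring_0)"
  by (simp add: Const_def mult_single)

lemma comm_ring_hom_Const: "comm_ring_hom (Const :: 'k::comm_ring_1 \<Rightarrow> ('x, 'k) mpoly)"
  by unfold_locales (simp_all add: Const_add Const_mult)

lemma Const_eq_0_iff [simp]: "Const c = 0 \<longleftrightarrow> c = 0"
  by (metis Const_def Const_0 lookup_single_eq)

lemma Var_power: "Var i ^ n = Poly_Mapping.single (Poly_Mapping.single i n)
    (1::'k::comm_semiring_1)"
  by (induction n) (simp_all add: Var_def mult_single flip: single_add)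

lemma mon_eval_Var: "mon_eval Var m = Poly_Mapping.single m (1::'k::comm_semiring_1)"
proof -
  have "(\<Prod>i\<in>S. Poly_Mapping.single (f i) (1::'k)) = Poly_Mapping.single (\<Sum>i\<in>S. f i) 1"
    for S :: "'a set" and f :: "'a \<Rightarrow> 'a \<Rightarrow>\<^sub>0 nat"
    by (induction S rule: infinite_finite_induct) (simp_all add: mult_single)
  then show ?thesis
    by (simp add: mon_eval_def Var_power poly_mapping_eq_sum_single)
qed

lemma single_eq_Const_mult: "Poly_Mapping.single m c = Const (c::'k::comm_semiring_1) * mon_eval
    Var m"
  by (simp add: mon_eval_Var Const_def mult_single)

text \<open>Constants and variables generate the polynomial ring. Identities between substitutions
  are reduced to generators this way.\<close>

lemma mpoly_induct [case_names Const Var add mult]: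
  fixes p :: "('x, 'k::comm_semiring_1) mpoly"
  assumes Const: "\<And>c. P (Const c)" and Var: "\<And>i. P (Var i)"
    and add: "\<And>p q. P p \<Longrightarrow> P q \<Longrightarrow> P (p + q)" and mult: "\<And>p q. P p \<Longrightarrow> P q \<Longrightarrow> P (p * q)"
  shows "P p"
proof -
  have one: "P 1" using Const[of 1] by simp
  have power: "P (Var i ^ n)" for i n
    by (induction n) (simp_all add: one Var mult)
  have prod: "P (\<Prod>i\<in>S. Var i ^ f i)" for S and f :: "'x \<Rightarrow> nat"
    by (induction S rule: infinite_finite_induct) (simp_all add: one power mult)
  have single: "P (Poly_Mapping.single m c)" for m c
    unfolding single_eq_Const_mult mon_eval_def by (intro mult Const prod)
  have "P (\<Sum>m\<in>S. Poly_Mapping.single m (f m))" for S f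
    using Const[of 0] by (induction S rule: infinite_finite_induct) (simp_all add: single add)
  from this[of "Poly_Mapping.lookup p" "Poly_Mapping.keys p"] show ?thesis
    by (simp only: poly_mapping_eq_sum_single)
qed

lemma homogeneous_0 [simp]: "homogeneous d 0"
  by (simp add: homogeneous_def)

lemma homogeneous_add: "homogeneous d p \<Longrightarrow> homogeneous d q \<Longrightarrow> homogeneous d (p + q)"
  unfolding homogeneous_def using keys_add[of p q] by blast

lemma homogeneous_sum: "(\<And>i. i \<in> A \<Longrightarrow> homogeneous d (f i)) \<Longrightarrow> homogeneous d (sum f A)"
  by (induction A rule: infinite_finite_induct) (auto intro: homogeneous_add)

lemma homogeneous_mult:
  "homogeneous d p \<Longrightarrow> homogeneous e q \<Longrightarrow> homogeneous (d + e) (p * q)"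
  unfolding homogeneous_def using keys_mult[of p q] by (fastforce simp: monom_deg_add)

lemma homogeneous_Const [simp]: "homogeneous 0 (Const c)"
  by (simp add: homogeneous_def Const_def)

lemma homogeneous_Var [simp]: "homogeneous 1 (Var i)"
  by (simp add: homogeneous_def Var_def)

lemma homogeneous_Const_mult: "homogeneous d p \<Longrightarrow> homogeneous d (Const c * p)"
  using homogeneous_mult[of 0 "Const c" d p] by simp

lemma homogeneous_1: "homogeneous 0 1"
  by (simp add: homogeneous_def)

lemma homogeneous_power: "homogeneous d p \<Longrightarrow> homogeneous (n * d) (p ^ n)"
  by (induction n) (auto simp: homogeneous_1 intro: homogeneous_mult)

section \<open>Places\<close>

text \<open>A pair \<open>(x, a)\<close> stands for an element \<open>x\<close> of a subring of \<open>'l\<close> together with its value \<open>a\<close>.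
  A subalgebra of \<open>'l \<times> 'k\<close> is the graph of a function exactly if it does not contain \<open>(0, 1)\<close>,
  and a maximal subalgebra with this property is the graph of a place.\<close>

locale subalgebra_pairs =
  fixes \<iota> :: "'k::field \<Rightarrow> 'l::field" and G :: "('l \<times> 'k) set"
  assumes hom: "comm_ring_hom \<iota>"
    and const_mem: "\<And>c. (\<iota> c, c) \<in> G"
    and add_mem: "\<And>x a y b. (x, a) \<in> G \<Longrightarrow> (y, b) \<in> G \<Longrightarrow> (x + y, a + b) \<in> G"
    and mult_mem: "\<And>x a y b. (x, a) \<in> G \<Longrightarrow> (y, b) \<in> G \<Longrightarrow> (x * y, a * b) \<in> G"
begin

sublocale \<iota>: comm_ring_hom \<iota>
  by (rule hom)

lemma zero_mem: "(0, 0) \<in> G"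
  using const_mem[of 0] by simp

lemma one_mem: "(1, 1) \<in> G"
  using const_mem[of 1] by simp

lemma uminus_mem: "(x, a) \<in> G \<Longrightarrow> (- x, - a) \<in> G"
  using mult_mem[OF const_mem[of "-1"], of x a] by (simp add: \<iota>.hom_uminus)

lemma diff_mem: "(x, a) \<in> G \<Longrightarrow> (y, b) \<in> G \<Longrightarrow> (x - y, a - b) \<in> G"
  using add_mem[OF _ uminus_mem, of x a y b] by simp

lemma sum_mem: "(\<And>i. i \<in> A \<Longrightarrow> (f i, g i) \<in> G) \<Longrightarrow> (sum f A, sum g A) \<in> G"
  by (induction A rule: infinite_finite_induct) (auto simp: zero_mem intro: add_mem)

lemma power_mem: "(x, a) \<in> G \<Longrightarrow> (x ^ n, a ^ n) \<in> G"
  by (induction n) (auto simp: one_mem intro: mult_mem)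

section \<open>Adjoining an element with a prescribed value\<close>

definition poly_pairs :: "('l poly \<times> 'k poly) set"
  where "poly_pairs = {(f, h). \<forall>i. (coeff f i, coeff h i) \<in> G}"

lemma poly_pairs_mult:
  "(f, h) \<in> poly_pairs \<Longrightarrow> (f', h') \<in> poly_pairs \<Longrightarrow> (f * f', h * h') \<in> poly_pairs"
  by (auto simp: poly_pairs_def coeff_mult intro!: sum_mem mult_mem)

lemma poly_pairs_add:
  "(f, h) \<in> poly_pairs \<Longrightarrow> (f', h') \<in> poly_pairs \<Longrightarrow> (f + f', h + h') \<in> poly_pairs"
  by (auto simp: poly_pairs_def intro!: add_mem)

lemma poly_pairs_pCons:
  "(x, a) \<in> G \<Longrightarrow> (f, h) \<in> poly_pairs \<Longrightarrow> (pCons x f, pCons a h) \<in> poly_pairs"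
  by (auto simp: poly_pairs_def coeff_pCons split: nat.splits)

lemma poly_pairs_0: "(0, 0) \<in> poly_pairs"
  by (auto simp: poly_pairs_def zero_mem)

lemma poly_pairs_map: "(map_poly \<iota> h, h) \<in> poly_pairs"
  by (auto simp: poly_pairs_def const_mem)

text \<open>The subalgebra generated by \<open>G\<close> and \<open>(x, c)\<close>: \<open>f\<close>
  and \<open>h\<close> are the two components of one polynomial with coefficients in
  \<open>G\<close>.\<close>

definition adjoin :: "'l \<Rightarrow> 'k \<Rightarrow> ('l \<times> 'k) set"
  where "adjoin x c = {(poly f x, poly h c) |f h. (f, h) \<in> poly_pairs}"

lemma subset_adjoin: "G \<subseteq> adjoin x c"
proof
  fix z assume "z \<in> G"
  moreover obtain y b where z: "z = (y, b)" by fastforce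
  ultimately have "([:y:], [:b:]) \<in> poly_pairs"
    by (simp add: poly_pairs_pCons poly_pairs_0)
  then show "z \<in> adjoin x c"
    unfolding adjoin_def z by force
qed

lemma mem_adjoin: "(x, c) \<in> adjoin x c"
proof -
  have "([:0, 1:], [:0, 1:]) \<in> poly_pairs"
    by (intro poly_pairs_pCons poly_pairs_0 zero_mem one_mem)
  then show ?thesis
    unfolding adjoin_def by force
qed

lemma subalgebra_pairs_adjoin: "subalgebra_pairs \<iota> (adjoin x c)"
proof unfold_locales
  show "(\<iota> a, a) \<in> adjoin x c" for a
    using const_mem subset_adjoin by blast
next
  fix y a z b assume "(y, a) \<in> adjoin x c" "(z, b) \<in> adjoin x c"
  then obtain f h f' h' where *: "(f, h) \<in> poly_pairs" "(f', h') \<in> poly_pairs"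
    "y = poly f x" "a = poly h c" "z = poly f' x" "b = poly h' c"
    by (auto simp: adjoin_def)
  show "(y + z, a + b) \<in> adjoin x c"
    using poly_pairs_add[OF *(1,2)] * unfolding adjoin_def by force
  show "(y * z, a * b) \<in> adjoin x c"
    using poly_pairs_mult[OF *(1,2)] * unfolding adjoin_def by force
qed

text \<open>The elements of value 0 generate the unit ideal once \<open>x\<close> is adjoined. The
  degree bound \<open>n\<close> is the quantity on which Chevalley's descent runs.\<close>

definition unit_eqn :: "'l \<Rightarrow> nat \<Rightarrow> bool"
  where "unit_eqn x n \<longleftrightarrow> (\<exists>m. (\<forall>i. (m i, 0) \<in> G) \<and> 1 + (\<Sum>i\<le>n. m i * x ^ i) = 0)"

lemma unit_eqn_mono:
  assumes "unit_eqn x n" "n \<le> k"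
  shows "unit_eqn x k"
proof -
  from assms obtain m where m: "\<forall>i. (m i, 0) \<in> G" "1 + (\<Sum>i\<le>n. m i * x ^ i) = 0"
    by (auto simp: unit_eqn_def)
  let ?m = "\<lambda>i. if i \<le> n then m i else 0"
  have "(\<Sum>i\<le>k. ?m i * x ^ i) = (\<Sum>i\<le>n. m i * x ^ i)"
    by (rule sum.mono_neutral_cong_right) (use assms in auto)
  with m have "1 + (\<Sum>i\<le>k. ?m i * x ^ i) = 0" by simp
  moreover have "\<forall>i. (?m i, 0) \<in> G" using m(1) zero_mem by simp
  ultimately show ?thesis unfolding unit_eqn_def by (intro exI[of _ ?m]) blast
qed

end

locale maximal_pairs = subalgebra_pairs \<iota> G
  for \<iota> :: "'k::alg_closed_field \<Rightarrow> 'l::field" and G +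
  assumes proper: "(0, 1) \<notin> G"
    and maximal: "\<And>H. subalgebra_pairs \<iota> H \<Longrightarrow> (0, 1) \<notin> H \<Longrightarrow> G \<subseteq> H \<Longrightarrow> H = G"
begin

lemma zero_memD: "(0, a) \<in> G \<Longrightarrow> a = 0"
  using mult_mem[OF const_mem[of "inverse a"], of 0 a] proper by (cases "a = 0") auto

lemma single_valued: "(x, a) \<in> G \<Longrightarrow> (x, b) \<in> G \<Longrightarrow> a = b"
  using zero_memD[of "a - b"] diff_mem[of x a x b] by simp

text \<open>The polynomials over the residue field that arise by reducing an equation of \<open>x\<close> form an
  ideal; by maximality this ideal has no zero, so it is the unit ideal.\<close>

lemma unit_eqn_of_not_mem:
  assumes x: "\<And>c. (x, c) \<notin> G"
  shows "\<exists>n. unit_eqn x n"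
proof -
  define J where "J = {h. \<exists>f. (f, h) \<in> poly_pairs \<and> poly f x = 0}"
  \<comment> \<open>Giving \<open>x\<close> the value \<open>c\<close> enlarges \<open>G\<close>, so
    by maximality the larger algebra contains \<open>(0, 1)\<close>. The pair of polynomials that
    produces \<open>(0, 1)\<close> supplies \<open>h\<close>.\<close>
  have no_zero: "\<exists>h\<in>J. poly h c = 1" for c
  proof -
    have "(0, 1) \<in> adjoin x c"
    proof (rule ccontr)
      assume "(0, 1) \<notin> adjoin x c"
      then have "adjoin x c = G"
        using maximal subalgebra_pairs_adjoin subset_adjoin by blast
      then show False using mem_adjoin x by blast
    qed
    then show ?thesis unfolding adjoin_def J_def by force
  qed
  have J_add: "h + h' \<in> J" if "h \<in> J" "h' \<in> J" for h h'
    using that poly_pairs_add unfolding J_def by fastforce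
  have J_mult: "q * h \<in> J" if "h \<in> J" for h q
    using that poly_pairs_mult[OF poly_pairs_map[of q]] unfolding J_def by fastforce
  \<comment> \<open>A generator of the ideal \<open>J\<close>. It has no root, because a root would
    be common to all of \<open>J\<close>; hence it is constant.\<close>
  obtain p where p: "p \<in> J" "p \<noteq> 0" and min: "\<And>h. h \<in> J \<Longrightarrow> h \<noteq> 0 \<Longrightarrow> degree p \<le> degree h"
  proof -
    obtain h where h: "h \<in> J" "poly h 0 = 1" using no_zero[of 0] by blast
    then have "h \<in> J \<and> h \<noteq> 0" by auto
    from ex_has_least_nat[of "\<lambda>h. h \<in> J \<and> h \<noteq> 0", OF this, of degree] that
    show ?thesis by blast
  qed
  have dvd: "p dvd h" if "h \<in> J" for h
  proof -
    have "h mod p = h + (- (h div p)) * p" by (simp add: minus_div_mult_eq_mod)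
    then have "h mod p \<in> J" using J_add[OF that J_mult[OF p(1)], of "- (h div p)"] by simp
    then have "h mod p = 0"
      using min[of "h mod p"] degree_mod_less[OF p(2), of h] by linarith
    then show ?thesis by (simp add: mod_eq_0_iff_dvd)
  qed
  have "degree p = 0"
  proof (rule ccontr)
    assume "degree p \<noteq> 0"
    then obtain c where "poly p c = 0" using alg_closed_imp_poly_has_root by blast
    moreover obtain h where h: "h \<in> J" "poly h c = 1" using no_zero by blast
    moreover obtain q where "h = p * q" using dvd[OF h(1)] by (rule dvdE)
    ultimately show False by simp
  qed
  then obtain a where a: "p = [:a:]" "a \<noteq> 0" using p(2) by (metis degree_eq_zeroE pCons_0_0)
  then have "[:inverse a:] * p = 1" by simp
  then have "1 \<in> J" using J_mult[OF p(1), of "[:inverse a:]"] by simp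
  then obtain f where f: "(f, 1) \<in> poly_pairs" "poly f x = 0" by (auto simp: J_def)
  define m where "m i = (if i = 0 then coeff f 0 - 1 else coeff f i)" for i
  have f_mem: "(coeff f i, coeff 1 i) \<in> G" for i
    using f(1) by (simp add: poly_pairs_def)
  have "(m i, 0) \<in> G" for i
    using diff_mem[OF f_mem[of 0] one_mem] f_mem[of i] by (auto simp: m_def)
  moreover have "1 + (\<Sum>i\<le>degree f. m i * x ^ i) = 0"
    using f(2) by (simp add: poly_altdef m_def sum.atMost_shift)
  ultimately have "unit_eqn x (degree f)" unfolding unit_eqn_def by blast
  then show ?thesis by blast
qed

text \<open>The nonunits are the elements of value 0. If \<open>inverse u\<close> had no value, its
  unit equation times \<open>u ^ n\<close> would be a monic equation for \<open>u\<close> whose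
  other coefficients have value 0, and taking values would give \<open>y ^ n = 0\<close>.\<close>

lemma inverse_mem:
  assumes "(u, y) \<in> G" "y \<noteq> 0"
  shows "(inverse u, inverse y) \<in> G"
proof -
  have u: "u \<noteq> 0" using assms zero_memD by blast
  show ?thesis
  proof (cases "\<exists>c. (inverse u, c) \<in> G")
    case True
    then obtain c where c: "(inverse u, c) \<in> G" by blast
    then have "(1, y * c) \<in> G" using mult_mem[OF assms(1) c] u by simp
    then have "y * c = 1" using one_mem single_valued by blast
    then show ?thesis using c by (metis inverse_unique)
  next
    case False
    then obtain n m where m: "\<And>i. (m i, 0) \<in> G" "1 + (\<Sum>i\<le>n. m i * inverse u ^ i) = 0"
      using unit_eqn_of_not_mem unfolding unit_eqn_def by blast
    have eq: "u ^ n * (m i * inverse u ^ i) = m i * u ^ (n - i)" if "i \<le> n" for i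
      using power_diff[OF u that] by (simp only: power_inverse divide_inverse mult_ac)
    have "u ^ n * (1 + (\<Sum>i\<le>n. m i * inverse u ^ i)) = u ^ n + (\<Sum>i\<le>n. m i * u ^ (n - i))"
      unfolding distrib_left sum_distrib_left mult_1_right
      by (intro arg_cong2[of _ _ _ _ "(+)"] refl sum.cong eq) simp
    moreover have "(u ^ n + (\<Sum>i\<le>n. m i * u ^ (n - i)), y ^ n + (\<Sum>i\<le>n. 0 * y ^ (n - i))) \<in> G"
      by (intro add_mem sum_mem mult_mem power_mem assms m)
    ultimately have "(0, y ^ n) \<in> G" using m(2) by simp
    then show ?thesis using zero_memD assms(2) by force
  qed
qed

text \<open>Chevalley's trick. Since \<open>1 + m' 0\<close> is a unit, the equation of
  \<open>inverse x\<close> expresses \<open>x ^ Suc n\<close> by lower powers with coefficients of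
  value 0; substituting this into the equation of \<open>x\<close> removes the top term.\<close>

lemma unit_eqn_reduce:
  assumes "x \<noteq> 0" "unit_eqn x (Suc n)" "unit_eqn (inverse x) (Suc n)"
  shows "unit_eqn x n"
proof -
  let ?n = "Suc n"
  obtain m where m: "\<And>i. (m i, 0) \<in> G" "1 + (\<Sum>i\<le>?n. m i * x ^ i) = 0"
    using assms(2) unfolding unit_eqn_def by blast
  obtain m' where m': "\<And>i. (m' i, 0) \<in> G" "1 + (\<Sum>i\<le>?n. m' i * inverse x ^ i) = 0"
    using assms(3) unfolding unit_eqn_def by blast
  let ?w = "1 + m' 0"
  define v where "v = inverse ?w"
  have w: "(?w, 1) \<in> G" using add_mem[OF one_mem m'(1)[of 0]] by simp
  then have v: "(v, 1) \<in> G" using inverse_mem[OF w] by (simp add: v_def)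
  have w0: "?w \<noteq> 0" using w proper by auto
  define S where "S = (\<Sum>i\<le>n. m' (?n - i) * x ^ i)"
  have eq: "x ^ ?n * (m' i * inverse x ^ i) = m' i * x ^ (?n - i)" if "i \<le> ?n" for i
    using power_diff[OF assms(1) that] by (simp only: power_inverse divide_inverse mult_ac)
  have "x ^ ?n * (1 + (\<Sum>i\<le>?n. m' i * inverse x ^ i)) = x ^ ?n + (\<Sum>i\<le>?n. m' i * x ^ (?n - i))"
    unfolding distrib_left sum_distrib_left mult_1_right
    by (intro arg_cong2[of _ _ _ _ "(+)"] refl sum.cong eq) simp
  also have "(\<Sum>i\<le>?n. m' i * x ^ (?n - i)) = (\<Sum>i\<le>?n. m' (?n - i) * x ^ i)"
    by (rule sum.reindex_bij_witness[of _ "\<lambda>i. ?n - i" "\<lambda>i. ?n - i"]) auto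
  also have "\<dots> = S + m' 0 * x ^ ?n"
    unfolding sum.atMost_Suc S_def by simp
  finally have "x ^ ?n + (S + m' 0 * x ^ ?n) = 0"
    unfolding m'(2) by simp
  then have "?w * x ^ ?n = - S"
    unfolding distrib_right eq_neg_iff_add_eq_0 by (simp only: mult_1_left add_ac)
  moreover have "v * ?w = 1"
    unfolding v_def using w0 by (rule left_inverse)
  ultimately have xn: "x ^ ?n = - (v * S)"
    by (metis mult.assoc mult_1_left mult_minus_right)
  have "(\<Sum>i\<le>n. (m i - m ?n * v * m' (?n - i)) * x ^ i) = (\<Sum>i\<le>n. m i * x ^ i) - m ?n * (v * S)"
    unfolding S_def left_diff_distrib sum_subtractf sum_distrib_left mult.assoc ..
  also have "\<dots> = (\<Sum>i\<le>?n. m i * x ^ i)"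
    unfolding sum.atMost_Suc xn by simp
  finally have "(\<Sum>i\<le>n. (m i - m ?n * v * m' (?n - i)) * x ^ i) = (\<Sum>i\<le>?n. m i * x ^ i)" .
  with m(2) have "1 + (\<Sum>i\<le>n. (m i - m ?n * v * m' (?n - i)) * x ^ i) = 0"
    by simp
  moreover have "(m i - m ?n * v * m' (?n - i), 0) \<in> G" for i
    using diff_mem[OF m(1) mult_mem[OF mult_mem[OF m(1) v] m'(1)], of i ?n "?n - i"] by simp
  ultimately show ?thesis unfolding unit_eqn_def by meson
qed

lemma not_unit_eqn_0: "\<not> unit_eqn x 0"
proof
  assume "unit_eqn x 0"
  then obtain m where "\<And>i. (m i, 0) \<in> G" "1 + (\<Sum>i\<le>0. m i * x ^ i) = 0"
    unfolding unit_eqn_def by blast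
  then show False using add_mem[OF one_mem, of "m 0" 0] proper by simp
qed

lemma not_both_unit_eqn: "x \<noteq> 0 \<Longrightarrow> unit_eqn x n \<Longrightarrow> unit_eqn (inverse x) n \<Longrightarrow> False"
proof (induction n)
  case (Suc n)
  have "unit_eqn x n" using Suc.prems by (rule unit_eqn_reduce)
  moreover have "unit_eqn (inverse x) n"
    by (rule unit_eqn_reduce) (use Suc.prems in simp_all)
  ultimately show ?case using Suc.IH Suc.prems(1) by blast
qed (use not_unit_eqn_0 in blast)

text \<open>The defining property of a valuation ring. If neither \<open>x\<close> nor
  \<open>inverse x\<close> had a value, both would satisfy unit equations, and the descent would
  bring these down to degree 0.\<close>

lemma mem_or_inverse_mem: "(\<exists>c. (x, c) \<in> G) \<or> (inverse x, 0) \<in> G"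
proof (rule ccontr)
  assume *: "\<not> ((\<exists>c. (x, c) \<in> G) \<or> (inverse x, 0) \<in> G)"
  then have x0: "x \<noteq> 0" using zero_mem by auto
  have "(inverse x, c) \<notin> G" for c
    using * inverse_mem[of "inverse x" c] by (cases "c = 0") auto
  then obtain n where "unit_eqn (inverse x) n" using unit_eqn_of_not_mem by blast
  moreover obtain k where "unit_eqn x k" using unit_eqn_of_not_mem[of x] * by blast
  ultimately have "unit_eqn x (max n k)" "unit_eqn (inverse x) (max n k)"
    using unit_eqn_mono by fastforce+
  then show False using not_both_unit_eqn[OF x0] by blast
qed

end

theorem maximal_pairs_exists:
  fixes \<iota> :: "'k::alg_closed_field \<Rightarrow> 'l::field"
  assumes "subalgebra_pairs \<iota> A" "(0, 1) \<notin> A"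
  obtains G where "A \<subseteq> G" "maximal_pairs \<iota> G"
proof -
  interpret A: subalgebra_pairs \<iota> A by fact
  define \<A> where "\<A> = {H. subalgebra_pairs \<iota> H \<and> (0, 1) \<notin> H \<and> A \<subseteq> H}"
  have "\<exists>M\<in>\<A>. \<forall>X\<in>\<A>. M \<subseteq> X \<longrightarrow> X = M"
  proof (rule subset_Zorn_nonempty)
    show "\<A> \<noteq> {}" using assms by (auto simp: \<A>_def)
    fix \<C> assume \<C>: "\<C> \<noteq> {}" "subset.chain \<A> \<C>"
    then have sub: "\<And>H. H \<in> \<C> \<Longrightarrow> subalgebra_pairs \<iota> H \<and> (0, 1) \<notin> H \<and> A \<subseteq> H"
      by (auto simp: \<A>_def subset.chain_def)
    have two: "\<exists>H\<in>\<C>. z \<in> H \<and> w \<in> H" if "z \<in> \<Union>\<C>" "w \<in> \<Union>\<C>" for z w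
      using that \<C>(2) unfolding subset_chain_def by blast
    have "subalgebra_pairs \<iota> (\<Union>\<C>)"
    proof unfold_locales
      fix c
      obtain H where "H \<in> \<C>" using \<C>(1) by blast
      then show "(\<iota> c, c) \<in> \<Union>\<C>" using sub[of H] A.const_mem[of c] by blast
    next
      fix x a y b assume "(x, a) \<in> \<Union>\<C>" "(y, b) \<in> \<Union>\<C>"
      then obtain H where H: "H \<in> \<C>" "(x, a) \<in> H" "(y, b) \<in> H" using two by blast
      then interpret H: subalgebra_pairs \<iota> H using sub by blast
      show "(x + y, a + b) \<in> \<Union>\<C>" "(x * y, a * b) \<in> \<Union>\<C>"
        using H H.add_mem H.mult_mem by blast+
    qed
    moreover have "(0, 1) \<notin> \<Union>\<C>" using sub by blast
    moreover have "A \<subseteq> \<Union>\<C>" using sub \<C>(1) by blast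
    ultimately show "\<Union>\<C> \<in> \<A>" by (simp add: \<A>_def)
  qed
  then obtain M where M: "M \<in> \<A>" "\<And>X. X \<in> \<A> \<Longrightarrow> M \<subseteq> X \<Longrightarrow> X = M" by blast
  interpret M: subalgebra_pairs \<iota> M using M(1) by (simp add: \<A>_def)
  have "maximal_pairs \<iota> M"
  proof unfold_locales
    show "(0, 1) \<notin> M" using M(1) by (simp add: \<A>_def)
  next
    fix H assume "subalgebra_pairs \<iota> H" "(0, 1) \<notin> H" "M \<subseteq> H"
    moreover from this have "H \<in> \<A>" using M(1) by (auto simp: \<A>_def)
    ultimately show "H = M" using M(2) by simp
  qed
  moreover have "A \<subseteq> M" using M(1) by (simp add: \<A>_def)
  ultimately show ?thesis by (intro that)
qed

section \<open>The averaging operator\<close>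

lemma mpoly_single_induct [case_names single add]:
  fixes p :: "('x, 'k::comm_monoid_add) mpoly"
  assumes single: "\<And>m c. P (Poly_Mapping.single m c)" and add: "\<And>p q. P p \<Longrightarrow> P q \<Longrightarrow> P (p + q)"
  shows "P p"
proof -
  have "P (\<Sum>m\<in>S. Poly_Mapping.single m (f m))" for S f
    using single[of 0 0] by (induction S rule: infinite_finite_induct) (simp_all add: single add)
  from this[of "Poly_Mapping.lookup p" "Poly_Mapping.keys p"] show ?thesis
    by (simp only: poly_mapping_eq_sum_single)
qed

section \<open>Formal partial derivatives\<close>

definition partial :: "'x \<Rightarrow> ('x, 'k::comm_ring_1) mpoly \<Rightarrow> ('x, 'k) mpoly"
  where "partial v p = (\<Sum>m\<in>Poly_Mapping.keys p. Poly_Mapping.single (m - Poly_Mapping.single v 1)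
    (of_nat (Poly_Mapping.lookup m v) * Poly_Mapping.lookup p m))"

lemma partial_superset:
  assumes "finite S" "Poly_Mapping.keys p \<subseteq> S"
  shows "partial v p = (\<Sum>m\<in>S. Poly_Mapping.single (m - Poly_Mapping.single v 1)
    (of_nat (Poly_Mapping.lookup m v) * Poly_Mapping.lookup p m))"
  unfolding partial_def
  by (rule sum.mono_neutral_left) (use assms in \<open>auto simp: in_keys_iff\<close>)

lemma partial_single: "partial v (Poly_Mapping.single m c) =
    Poly_Mapping.single (m - Poly_Mapping.single v 1) (of_nat (Poly_Mapping.lookup m v) * c)"
  by (simp add: partial_superset[of "{m}"])

lemma partial_add [simp]: "partial v (p + q) = partial v p + partial v q"
proof -
  let ?S = "Poly_Mapping.keys p \<union> Poly_Mapping.keys q"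
  have "Poly_Mapping.keys (p + q) \<subseteq> ?S" by (rule keys_add)
  then show ?thesis
    by (simp add: partial_superset[of ?S] lookup_add distrib_left single_add sum.distrib)
qed

lemma partial_mult [simp]: "partial v (p * q) = partial v p * q + p * partial v q"
proof (induction p rule: mpoly_single_induct)
  case (single m a)
  show ?case
  proof (induction q rule: mpoly_single_induct)
    case (single n b)
    let ?e = "Poly_Mapping.single v (1::nat)"
    \<comment> \<open>Subtraction of exponents is truncated, so it can be moved onto
      \<open>m\<close> only if \<open>v\<close> occurs in \<open>m\<close>. Otherwise the
      coefficient of the term is 0.\<close>
    have eq: "m + n - ?e = (m - ?e) + n" if "Poly_Mapping.lookup m v \<noteq> 0" for m n :: "'a \<Rightarrow>\<^sub>0 nat"
      using that by (intro poly_mapping_eqI) (auto simp: lookup_add lookup_minus lookup_single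
          when_def)
    have "Poly_Mapping.single (m + n - ?e) (of_nat (Poly_Mapping.lookup m v) * a * b) =
        Poly_Mapping.single ((m - ?e) + n) (of_nat (Poly_Mapping.lookup m v) * a * b)"
      using eq[of m n] by (cases "Poly_Mapping.lookup m v = 0") auto
    moreover have "Poly_Mapping.single (m + n - ?e) (of_nat (Poly_Mapping.lookup n v) * a * b) =
        Poly_Mapping.single (m + (n - ?e)) (of_nat (Poly_Mapping.lookup n v) * a * b)"
      using eq[of n m] by (cases "Poly_Mapping.lookup n v = 0") (auto simp: add.commute)
    ultimately show ?case
      by (simp add: partial_single mult_single lookup_add distrib_left distrib_right single_add
          mult.assoc
          mult.left_commute)
  qed (simp add: algebra_simps)
qed (simp add: algebra_simps)

lemma partial_Const [simp]: "partial v (Const c) = 0"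
  by (simp add: Const_def partial_single)

lemma partial_0 [simp]: "partial v 0 = 0"
  using partial_Const[of v 0] by simp

lemma partial_1 [simp]: "partial v 1 = 0"
  using partial_Const[of v 1] by simp

lemma partial_Var: "partial v (Var w) = (if v = w then 1 else 0)"
  by (auto simp: Var_def partial_single lookup_single when_def)

lemma partial_uminus [simp]: "partial v (- p) = - partial v p"
  using partial_add[of v p "- p"] by (simp add: eq_neg_iff_add_eq_0 add.commute)

lemma partial_diff [simp]: "partial v (p - q) = partial v p - partial v q"
  using partial_add[of v p "- q"] by simp

lemma partial_sum: "partial v (sum f A) = (\<Sum>a\<in>A. partial v (f a))"
  by (induction A rule: infinite_finite_induct) simp_all

lemma partial_of_nat [simp]: "partial v (of_nat n) = 0"
  by (induction n) simp_all

text \<open>The extra factor \<open>p\<close> avoids the exponent \<open>n - 1\<close> and with it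
  an exception at \<open>n = 0\<close>.\<close>

lemma partial_power: "p * partial v (p ^ n) = of_nat n * p ^ n * partial v p"
proof (induction n)
  case (Suc n)
  have "p * partial v (p ^ Suc n) = p * (p ^ n * partial v p) + p * (p * partial v (p ^ n))"
    by (simp add: algebra_simps)
  then show ?case unfolding Suc.IH by (simp add: algebra_simps)
qed simp

section \<open>The generic matrix and its right translations\<close>

fun idx3 :: "3 \<Rightarrow> nat"
  where "idx3 i = (if i = 1 then 0 else if i = 2 then 1 else 2)"

text \<open>Natural numbers name the nine entries: linearly ordered variables make the polynomials
  an integral domain, whose field of fractions is needed later.\<close>

definition zidx :: "3 \<Rightarrow> 3 \<Rightarrow> nat"
  where "zidx i j = 3 * idx3 i + idx3 j"

lemma zidx_inject [simp]: "zidx i j = zidx k l \<longleftrightarrow> i = k \<and> j = l"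
  using exhaust_3[of i] exhaust_3[of j] exhaust_3[of k] exhaust_3[of l]
  by (elim disjE) (simp_all add: zidx_def)

definition Zm :: "(nat, 'k::comm_ring_1) mpoly ^ 3 ^ 3"
  where "Zm = (\<chi> i j. Var (zidx i j))"

definition map_matrix :: "('a \<Rightarrow> 'b) \<Rightarrow> 'a ^ 'n::finite ^ 'm::finite \<Rightarrow> 'b ^ 'n ^ 'm"
  where "map_matrix f A = (\<chi> i j. f (A $ i $ j))"

lemma map_matrix_nth [simp]: "map_matrix f A $ i $ j = f (A $ i $ j)"
  by (simp add: map_matrix_def)

text \<open>The substitution \<open>Z \<mapsto> Z g\<close> for the generic matrix \<open>Z\<close>; variables that are not entries of \<open>Z\<close>
  are sent to \<open>0\<close>.\<close>

definition right_mult :: "'k::comm_ring_1 ^ 3 ^ 3 \<Rightarrow> (nat, 'k) mpoly \<Rightarrow> (nat, 'k) mpoly"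
  where "right_mult g = insertion Const (\<lambda>w. \<Sum>i\<in>UNIV. \<Sum>j\<in>UNIV.
    if w = zidx i j then \<Sum>l\<in>UNIV. Zm $ i $ l * Const (g $ l $ j) else 0)"

lemma comm_ring_hom_right_mult: "comm_ring_hom (right_mult g)"
  unfolding right_mult_def by (intro comm_ring_hom_insertion comm_ring_hom_Const)

interpretation right_mult: comm_ring_hom "right_mult g" for g
  by (rule comm_ring_hom_right_mult)

lemma right_mult_Const [simp]: "right_mult g (Const c) = Const c"
  by (simp add: right_mult_def)

lemma right_mult_Var: "right_mult g (Var w) = (\<Sum>i\<in>UNIV. \<Sum>j\<in>UNIV.
    if w = zidx i j then \<Sum>l\<in>UNIV. Zm $ i $ l * Const (g $ l $ j) else 0)"
  by (simp add: right_mult_def)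

lemma right_mult_Zm: "right_mult g (Zm $ i $ j) = (\<Sum>l\<in>UNIV. Zm $ i $ l * Const (g $ l $ j))"
  using exhaust_3[of i] exhaust_3[of j]
  by (elim disjE) (simp_all add: Zm_def right_mult_Var sum_3)

lemma Var_zidx: "Var (zidx i j) = Zm $ i $ j"
  by (simp add: Zm_def)

abbreviation D :: "3 \<Rightarrow> 3 \<Rightarrow> (nat, 'k::comm_ring_1) mpoly \<Rightarrow> (nat, 'k) mpoly"
  where "D i j \<equiv> partial (zidx i j)"

lemma D_Zm [simp]: "D i j (Zm $ k $ l) = (if i = k \<and> j = l then 1 else 0)"
  by (simp add: Zm_def partial_Var)

text \<open>Chain rule: row \<open>i\<close> of \<open>Z g\<close> depends only on row
  \<open>i\<close> of \<open>Z\<close>, so only derivatives in that row occur.\<close>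

lemma D_right_mult: "D i j (right_mult g H) = (\<Sum>l\<in>UNIV. Const (g $ j $ l) * right_mult g (D i l H))"
proof (induction H rule: mpoly_induct)
  case (Var w)
  show ?case
  proof (cases "\<exists>k l. w = zidx k l")
    case True
    then obtain k l where w: "w = zidx k l" by blast
    show ?thesis
      unfolding w Var_zidx right_mult_Zm D_Zm
      using exhaust_3[of j] exhaust_3[of l]
      by (elim disjE) (auto simp: sum_3 mult.commute)
  next
    case False
    then have "zidx k l \<noteq> w" "w \<noteq> zidx k l" for k l by blast+
    then show ?thesis by (simp add: right_mult_Var partial_Var)
  qed
next
  case (mult p q)
  then show ?case
    by (simp add: right_mult.hom_mult right_mult.hom_add sum_distrib_left sum_distrib_right
        sum.distrib
        algebra_simps)
qed (simp_all add: right_mult.hom_add sum.distrib algebra_simps)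

text \<open>The determinant of the matrix of operators \<open>D i j\<close>. In each product the
  factors are ordered by rows, which makes the expression an alternating sum of the kind treated by
  \<open>det_contraction\<close>.\<close>

definition \<Omega> :: "(nat, 'k::comm_ring_1) mpoly \<Rightarrow> (nat, 'k) mpoly"
  where "\<Omega> H = D 1 1 (D 2 2 (D 3 3 H)) + D 1 2 (D 2 3 (D 3 1 H)) + D 1 3 (D 2 1 (D 3 2 H))
    - D 1 1 (D 2 3 (D 3 2 H)) - D 1 2 (D 2 1 (D 3 3 H)) - D 1 3 (D 2 2 (D 3 1 H))"

text \<open>\<open>T j k l\<close> contracts the three slots of \<open>X\<close> with the rows
  \<open>j\<close>, \<open>k\<close>, \<open>l\<close> of \<open>G\<close>. Alternating over the
  rows gives the action of \<open>G\<close> on the third exterior power, which is multiplication by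
  its determinant.\<close>

lemma det_contraction:
  fixes G :: "'r::comm_ring_1 ^ 3 ^ 3" and X :: "3 \<Rightarrow> 3 \<Rightarrow> 3 \<Rightarrow> 'r"
  defines "T \<equiv> \<lambda>j k l. \<Sum>c\<in>UNIV. G $ l $ c * (\<Sum>b\<in>UNIV. G $ k $ b * (\<Sum>a\<in>UNIV. G $ j $ a * X a b c))"
  shows "T 1 2 3 + T 2 3 1 + T 3 1 2 - T 1 3 2 - T 2 1 3 - T 3 2 1 =
    det G * (X 1 2 3 + X 2 3 1 + X 3 1 2 - X 1 3 2 - X 2 1 3 - X 3 2 1)"
  unfolding T_def sum_3 det_3 by (simp only: algebra_simps)

lemma \<Omega>_right_mult: "\<Omega> (right_mult g H) = Const (det g) * right_mult g (\<Omega> H)"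
proof -
  let ?G = "map_matrix Const g" and ?X = "\<lambda>a b c. right_mult g (D 1 a (D 2 b (D 3 c H)))"
  let ?T = "\<lambda>j k l. \<Sum>c\<in>UNIV. ?G $ l $ c * (\<Sum>b\<in>UNIV. ?G $ k $ b * (\<Sum>a\<in>UNIV. ?G $ j $ a * ?X a b c))"
  have DDD: "D 1 j (D 2 k (D 3 l (right_mult g H))) = ?T j k l" for j k l
    by (simp add: D_right_mult partial_sum)
  have det: "det ?G = Const (det g)"
    by (simp add: det_3 Const_def single_diff mult_single single_add)
  have "\<Omega> (right_mult g H) = ?T 1 2 3 + ?T 2 3 1 + ?T 3 1 2 - ?T 1 3 2 - ?T 2 1 3 - ?T 3 2 1"
    unfolding \<Omega>_def DDD ..
  also have "\<dots> = det ?G * (?X 1 2 3 + ?X 2 3 1 + ?X 3 1 2 - ?X 1 3 2 - ?X 2 1 3 - ?X 3 2 1)"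
    by (rule det_contraction)
  also have "\<dots> = Const (det g) * right_mult g (\<Omega> H)"
    by (simp only: det \<Omega>_def right_mult.hom_add right_mult.hom_minus)
  finally show ?thesis .
qed

lemma \<Omega>_add: "\<Omega> (p + q) = \<Omega> p + \<Omega> q"
  by (simp add: \<Omega>_def)

lemma \<Omega>_Const_mult: "\<Omega> (Const c * p) = Const c * \<Omega> p"
  by (simp add: \<Omega>_def algebra_simps)

text \<open>To be read with \<open>q\<close> the \<open>n\<close>-th power of \<open>f\<close> and
  the suffixes \<open>y\<close>, \<open>z\<close> denoting derivatives. The assumptions are
  \<open>f * dq = n * q * df\<close> for two derivatives and a derivative of this identity.\<close>

lemma second_log_derivative:
  fixes f q n :: "'r::comm_ring_1"
  assumes "f * qy = n * q * fy" "f * qz = n * q * fz" "fy * qz + f * qyz = n * (qy * fz + q * fyz)"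
  shows "f\<^sup>2 * qyz = n * ((n - 1) * q * fy * fz + f * q * fyz)"
proof -
  have "f\<^sup>2 * qyz = f * (fy * qz + f * qyz) - fy * (f * qz)"
    by (simp add: algebra_simps power2_eq_square)
  also have "\<dots> = n * ((f * qy) * fz + f * q * fyz) - fy * (f * qz)"
    unfolding assms(3) by (simp add: algebra_simps)
  also have "\<dots> = n * ((n - 1) * q * fy * fz + f * q * fyz)"
    unfolding assms(1,2) by (simp add: algebra_simps)
  finally show ?thesis .
qed

text \<open>The factor \<open>f ^ 3\<close> keeps the exponent at \<open>N\<close> throughout, so
  small \<open>N\<close> are not exceptional.\<close>

lemma partial_partial_partial_power:
  fixes f :: "('x, 'k::comm_ring_1) mpoly" and N :: nat
  defines "n \<equiv> of_nat N" and "q \<equiv> f ^ N"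
  shows "f ^ 3 * partial x (partial y (partial z q)) =
    n * (n - 1) * (n - 2) * q * (partial x f * partial y f * partial z f)
    + n * (n - 1) * f * q * (partial x (partial y f) * partial z f + partial x (partial z f) *
        partial y f + partial y (partial z f) * partial x f)
    + n * f\<^sup>2 * q * partial x (partial y (partial z f))"
proof -
  have n [simp]: "partial v n = 0" for v
    by (simp add: n_def)
  have 1: "f * partial v q = n * q * partial v f" for v
    by (simp add: n_def q_def partial_power)
  have 2: "partial v f * partial w q + f * partial v (partial w q) = n * (partial v q * partial w
      f + q * partial v (partial w f))" for v w
    using arg_cong[OF 1[of w], of "partial v"] by (simp add: algebra_simps)
  have 3: "f\<^sup>2 * partial v (partial w q) = n * ((n - 1) * q * partial v f * partial w f + f * q *
      partial v (partial w f))" for v w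
    by (rule second_log_derivative[OF 1 1 2])
  have 4: "f * partial x (partial y (partial z q)) =
      n * (partial x (partial y q) * partial z f + partial y q * partial x (partial z f) + partial
          x q * partial y (partial z f)
        + q * partial x (partial y (partial z f)))
      - partial x (partial y f) * partial z q - partial y f * partial x (partial z q) - partial x
          f * partial y (partial z q)"
    using arg_cong[OF 2[of y z], of "partial x"] by (simp add: algebra_simps)
  have "f ^ 3 * partial x (partial y (partial z q)) = f\<^sup>2 * (f * partial x (partial y (partial z
      q)))"
    by (simp add: power3_eq_cube power2_eq_square mult.assoc)
  also have "\<dots> = n * ((f\<^sup>2 * partial x (partial y q)) * partial z f + f * (f * partial y q) *
      partial x (partial z f)
      + f * (f * partial x q) * partial y (partial z f) + f\<^sup>2 * q * partial x (partial y (partial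
          z f)))
      - f * partial x (partial y f) * (f * partial z q) - partial y f * (f\<^sup>2 * partial x (partial
          z q)) - partial x f * (f\<^sup>2 * partial y (partial z q))"
    unfolding 4 by (simp add: algebra_simps power2_eq_square)
  finally show ?thesis
    unfolding 1 3 by (simp add: algebra_simps power2_eq_square)
qed

abbreviation \<Delta> :: "(nat, 'k::comm_ring_1) mpoly"
  where "\<Delta> \<equiv> det Zm"

text \<open>Cayley's identity times \<open>\<Delta> ^ 3\<close>. Alternating over permutations turns
  the three kinds of terms of the third derivative into \<open>\<Delta> ^ 2\<close>,
  \<open>6 * \<Delta>\<close> and \<open>6\<close>, and
  \<open>(n - 1) * (n - 2) + 6 * (n - 1) + 6 = (n + 1) * (n + 2)\<close>.\<close>

lemma \<Omega>_det_power_aux: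
  fixes N :: nat
  defines "n \<equiv> of_nat N :: (nat, 'k::comm_ring_1) mpoly"
  shows "\<Delta> ^ 3 * \<Omega> (\<Delta> ^ N) = n * (n + 1) * (n + 2) * \<Delta> ^ (N + 2)"
proof -
  let ?f = "\<Delta> :: (nat, 'k) mpoly"
  define q where "q = ?f ^ N"
  define U where "U a b c = D 1 a ?f * D 2 b ?f * D 3 c ?f" for a b c
  define V where "V a b c = D 1 a (D 2 b ?f) * D 3 c ?f + D 1 a (D 3 c ?f) * D 2 b ?f
    + D 2 b (D 3 c ?f) * D 1 a ?f" for a b c
  define W where "W a b c = D 1 a (D 2 b (D 3 c ?f))" for a b c
  have U: "U 1 2 3 + U 2 3 1 + U 3 1 2 - U 1 3 2 - U 2 1 3 - U 3 2 1 = ?f\<^sup>2"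
    by (simp add: U_def det_3 power2_eq_square algebra_simps)
  have V: "V 1 2 3 + V 2 3 1 + V 3 1 2 - V 1 3 2 - V 2 1 3 - V 3 2 1 = 6 * ?f"
    by (simp add: V_def det_3 algebra_simps)
  have W: "W 1 2 3 + W 2 3 1 + W 3 1 2 - W 1 3 2 - W 2 1 3 - W 3 2 1 = 6"
    by (simp add: W_def det_3)
  have "?f ^ 3 * D 1 a (D 2 b (D 3 c q)) =
      n * (n - 1) * (n - 2) * q * U a b c + n * (n - 1) * ?f * q * V a b c + n * ?f\<^sup>2 * q * W a b
          c" for a b c
    unfolding U_def V_def W_def q_def n_def by (rule partial_partial_partial_power)
  then have "?f ^ 3 * \<Omega> q =
      n * (n - 1) * (n - 2) * q * (U 1 2 3 + U 2 3 1 + U 3 1 2 - U 1 3 2 - U 2 1 3 - U 3 2 1)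
      + n * (n - 1) * ?f * q * (V 1 2 3 + V 2 3 1 + V 3 1 2 - V 1 3 2 - V 2 1 3 - V 3 2 1)
      + n * ?f\<^sup>2 * q * (W 1 2 3 + W 2 3 1 + W 3 1 2 - W 1 3 2 - W 2 1 3 - W 3 2 1)"
    unfolding \<Omega>_def by (simp only: distrib_left right_diff_distrib) (simp only: add_ac
        diff_conv_add_uminus minus_add_distrib minus_minus)
  also have "\<dots> = n * (n + 1) * (n + 2) * (?f\<^sup>2 * q)"
    unfolding U V W by (simp add: algebra_simps power2_eq_square)
  finally show ?thesis
    by (simp add: q_def power_add power2_eq_square mult_ac)
qed

lemma det_Zm_nonzero: "\<Delta> \<noteq> (0 :: (nat, 'k::comm_ring_1) mpoly)"
proof
  assume *: "\<Delta> = (0 :: (nat, 'k) mpoly)"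
  let ?x = "\<lambda>w. if w = zidx 1 1 \<or> w = zidx 2 2 \<or> w = zidx 3 3 then 1 else 0 :: 'k"
  interpret comm_ring_hom "insertion (\<lambda>a. a) ?x"
    by (intro comm_ring_hom_insertion comm_ring_hom_id)
  have "insertion (\<lambda>a. a) ?x \<Delta> = 1"
    by (simp add: det_3 Zm_def hom_add hom_mult hom_minus)
  with * show False by simp
qed

lemma \<Omega>_det_power_Suc:
  "\<Omega> (\<Delta> ^ Suc m) = Const (of_nat ((m + 1) * (m + 2) * (m + 3))) * (\<Delta> ^ m :: (nat, 'k::field) mpoly)"
proof -
  have of_nat: "Const (of_nat k) = (of_nat k :: (nat, 'k) mpoly)" for k
    by (simp add: Const_def single_of_nat)
  have "\<Delta> ^ 3 * \<Omega> (\<Delta> ^ Suc m) = \<Delta> ^ 3 * (Const (of_nat ((m + 1) * (m + 2) * (m + 3))) * (\<Delta> ^ m ::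
      (nat, 'k) mpoly))"
    unfolding \<Omega>_det_power_aux of_nat by (simp add: algebra_simps power_add power3_eq_cube)
  then show ?thesis
    by (metis det_Zm_nonzero mult_left_cancel power_not_zero)
qed

section \<open>Constant terms and averages\<close>

lemma lookup_0_eq_insertion:
  fixes p :: "('x, 'k::comm_semiring_1) mpoly"
  shows "Poly_Mapping.lookup p 0 = insertion (\<lambda>a. a) (\<lambda>_. 0) p"
proof -
  have ev: "mon_eval (\<lambda>_. 0 :: 'k) m = (if m = 0 then 1 else 0)" for m :: "'x \<Rightarrow>\<^sub>0 nat"
  proof (cases "m = 0")
    case False
    then obtain i where "i \<in> Poly_Mapping.keys m"
      by (metis ex_in_conv keys_eq_empty)
    then have "\<exists>i\<in>Poly_Mapping.keys m. (0 :: 'k) ^ Poly_Mapping.lookup m i = 0"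
      by (intro bexI[of _ i]) (auto simp: in_keys_iff zero_power)
    then show ?thesis
      using False by (simp add: mon_eval_def prod_zero)
  qed simp
  show ?thesis
    unfolding insertion_altdef ev by (simp add: in_keys_iff if_distrib cong: if_cong)
qed

lemma lookup_0_Const_mult:
  "Poly_Mapping.lookup (Const c * p) 0 = c * Poly_Mapping.lookup (p :: ('x, 'k::comm_ring_1)
      mpoly) 0"
proof -
  interpret comm_ring_hom "insertion (\<lambda>a::'k. a) (\<lambda>_::'x. 0)"
    by (intro comm_ring_hom_insertion comm_ring_hom_id)
  show ?thesis by (simp add: lookup_0_eq_insertion hom_mult)
qed

text \<open>Up to a nonzero factor, this averages \<open>H / det Z ^ N\<close> over the special linear group.\<close>

definition reynolds :: "nat \<Rightarrow> (nat, 'k::comm_ring_1) mpoly \<Rightarrow> 'k"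
  where "reynolds N H = Poly_Mapping.lookup ((\<Omega> ^^ N) H) 0"

lemma reynolds_add: "reynolds N (p + q) = reynolds N p + reynolds N q"
proof -
  have "(\<Omega> ^^ N) (p + q) = (\<Omega> ^^ N) p + (\<Omega> ^^ N) q"
    by (induction N) (simp_all add: \<Omega>_add)
  then show ?thesis by (simp add: reynolds_def lookup_add)
qed

lemma reynolds_Const_mult: "reynolds N (Const c * p) = c * reynolds N p"
proof -
  have "(\<Omega> ^^ N) (Const c * p) = Const c * (\<Omega> ^^ N) p"
    by (induction N) (simp_all add: \<Omega>_Const_mult)
  then show ?thesis by (simp add: reynolds_def lookup_0_Const_mult)
qed

lemma reynolds_0 [simp]: "reynolds N 0 = 0"
  using reynolds_Const_mult[of N 0 0] by simp

lemma reynolds_sum: "reynolds N (sum f A) = (\<Sum>a\<in>A. reynolds N (f a))"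
  by (induction A rule: infinite_finite_induct) (simp_all add: reynolds_add)

lemma lookup_0_right_mult: "Poly_Mapping.lookup (right_mult g p) 0 = Poly_Mapping.lookup p 0"
proof -
  let ?e = "insertion (\<lambda>a. a) (\<lambda>_. 0) :: (nat, 'a) mpoly \<Rightarrow> 'a"
  interpret e: comm_ring_hom ?e
    by (intro comm_ring_hom_insertion comm_ring_hom_id)
  have Var: "?e (right_mult g (Var w)) = 0" for w
    unfolding right_mult_Var e.hom_sum
    by (intro sum.neutral ballI) (simp add: e.hom_sum e.hom_mult Zm_def)
  have "?e (right_mult g p) = ?e p"
    by (induction p rule: mpoly_induct)
      (simp_all add: Var right_mult.hom_add right_mult.hom_mult e.hom_add e.hom_mult)
  then show ?thesis by (simp add: lookup_0_eq_insertion)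
qed

text \<open>Each \<open>\<Omega>\<close> contributes one factor \<open>det g\<close>, and the
  substitution fixes the zero matrix, at which the result is evaluated. For \<open>det g = 1\<close>
  this is the invariance of the average.\<close>

lemma reynolds_right_mult: "reynolds N (right_mult g H) = det g ^ N * reynolds N H"
proof -
  have "(\<Omega> ^^ N) (right_mult g H) = Const (det g ^ N) * right_mult g ((\<Omega> ^^ N) H)"
    by (induction N) (simp_all add: \<Omega>_right_mult \<Omega>_Const_mult Const_mult mult_ac)
  then show ?thesis
    by (simp add: reynolds_def lookup_0_Const_mult lookup_0_right_mult)
qed

text \<open>By Cayley's identity the average is a product of positive integers, which is nonzero in
  characteristic 0.\<close>

lemma reynolds_det_power: "reynolds N (\<Delta> ^ N) \<noteq> (0 :: 'k::field_char_0)"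
proof -
  have "\<exists>c. c \<noteq> 0 \<and> (\<Omega> ^^ N) (\<Delta> ^ N) = Const (c :: 'k)"
  proof (induction N)
    case 0
    show ?case by (rule exI[of _ 1]) simp
  next
    case (Suc N)
    then obtain c where c: "c \<noteq> 0" "(\<Omega> ^^ N) (\<Delta> ^ N) = Const (c :: 'k)" by blast
    let ?d = "of_nat ((N + 1) * (N + 2) * (N + 3)) :: 'k"
    have lin: "(\<Omega> ^^ N) (Const a * p) = Const a * (\<Omega> ^^ N) p" for a :: 'k and p
      by (induction N) (simp_all add: \<Omega>_Const_mult)
    have "(\<Omega> ^^ Suc N) (\<Delta> ^ Suc N) = Const ?d * Const c"
      unfolding funpow_Suc_right comp_def \<Omega>_det_power_Suc lin c(2) ..
    moreover have "?d \<noteq> 0" unfolding of_nat_eq_0_iff by simp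
    ultimately show ?case
      using c(1) by (intro exI[of _ "?d * c"]) (simp add: Const_mult)
  qed
  then show ?thesis by (auto simp: reynolds_def Const_def)
qed

section \<open>Conjugation of quadratic maps\<close>

type_synonym 'r tensor = "3 \<Rightarrow> 3 \<Rightarrow> 3 \<Rightarrow> 'r"

text \<open>The tensor of the quadratic map \<open>a\<close> preceded by \<open>Y\<close> and
  followed by \<open>Z\<close>. The two matrices are independent, so that the inverse of
  \<open>Z\<close>, its adjugate or a multiple of these can be put for \<open>Y\<close>.\<close>

definition act :: "'r ^ 3 ^ 3 \<Rightarrow> 'r ^ 3 ^ 3 \<Rightarrow> 'r tensor \<Rightarrow> 'r::comm_ring_1 tensor"
  where "act Z Y a i j k =
    (\<Sum>p\<in>UNIV. Z $ i $ p * (\<Sum>q\<in>UNIV. Y $ q $ j * (\<Sum>r\<in>UNIV. Y $ r $ k * a p q r)))"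

lemma sum_matrix_mult:
  fixes A :: "'r::comm_ring_1 ^ 'n::finite ^ 'm::finite" and B :: "'r ^ 'l::finite ^ 'n"
  shows "(\<Sum>p\<in>UNIV. (A ** B) $ i $ p * f p) = (\<Sum>s\<in>UNIV. A $ i $ s * (\<Sum>p\<in>UNIV. B $ s $ p * f p))"
  unfolding matrix_matrix_mult_def
  by (simp add: sum_distrib_left sum_distrib_right mult.assoc) (rule sum.swap)

lemma sum_matrix_mult':
  fixes A :: "'r::comm_ring_1 ^ 'n::finite ^ 'm::finite" and B :: "'r ^ 'l::finite ^ 'n"
  shows "(\<Sum>p\<in>UNIV. (A ** B) $ p $ j * f p) = (\<Sum>s\<in>UNIV. B $ s $ j * (\<Sum>p\<in>UNIV. A $ p $ s * f p))"
  unfolding matrix_matrix_mult_def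
  by (simp add: sum_distrib_left sum_distrib_right mult_ac) (rule sum.swap)

lemma act_act: "act Z Y (act Z' Y' a) = act (Z ** Z') (Y' ** Y) a"
proof (intro ext)
  fix i j k
  have pull: "(\<Sum>r\<in>UNIV. Y $ r $ k * (\<Sum>p\<in>UNIV. c p * g r p)) = (\<Sum>p\<in>UNIV. c p * (\<Sum>r\<in>UNIV. Y $ r $ k
      * g r p))"
    for k and c :: "3 \<Rightarrow> 'a" and g
    by (simp add: sum_distrib_left mult.left_commute) (rule sum.swap)
  show "act Z Y (act Z' Y' a) i j k = act (Z ** Z') (Y' ** Y) a i j k"
    unfolding act_def sum_matrix_mult sum_matrix_mult' pull ..
qed

lemma act_scale: "act Z (map_matrix ((*) c) Y) a i j k = c\<^sup>2 * act Z Y a i j k"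
  by (simp add: act_def sum_distrib_left power2_eq_square mult_ac)

lemma act_hom:
  assumes "comm_ring_hom h"
  shows "h (act Z Y a i j k) = act (map_matrix h Z) (map_matrix h Y) (\<lambda>p q r. h (a p q r)) i j k"
proof -
  interpret comm_ring_hom h by fact
  show ?thesis by (simp add: act_def hom_sum hom_mult)
qed

lemma act_sym:
  assumes "\<And>i j k. a i j k = a i k j"
  shows "act Z Y a i j k = act Z Y a i k j"
proof -
  have "(\<Sum>q\<in>UNIV. Y $ q $ j * (\<Sum>r\<in>UNIV. Y $ r $ k * a p q r))
      = (\<Sum>q\<in>UNIV. Y $ q $ k * (\<Sum>r\<in>UNIV. Y $ r $ j * a p q r))" for p
    unfolding sum_distrib_left by (subst sum.swap) (simp only: mult.left_commute assms[of p])
  then show ?thesis by (simp add: act_def)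
qed

text \<open>The adjugate, as explicit polynomials in the entries: it makes sense over polynomial
  rings and commutes with ring homomorphisms and with reduction at a place.\<close>

definition adj3 :: "'r::comm_ring_1 ^ 3 ^ 3 \<Rightarrow> 'r ^ 3 ^ 3"
  where "adj3 A = vector
   [vector [A$2$2 * A$3$3 - A$2$3 * A$3$2, A$1$3 * A$3$2 - A$1$2 * A$3$3, A$1$2 * A$2$3 - A$1$3 *
       A$2$2],
    vector [A$2$3 * A$3$1 - A$2$1 * A$3$3, A$1$1 * A$3$3 - A$1$3 * A$3$1, A$1$3 * A$2$1 - A$1$1 *
        A$2$3],
    vector [A$2$1 * A$3$2 - A$2$2 * A$3$1, A$1$2 * A$3$1 - A$1$1 * A$3$2, A$1$1 * A$2$2 - A$1$2 *
        A$2$1]]"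

lemma mult_adj3: "A ** adj3 A = mat (det A)"
  by (simp add: vec_eq_iff forall_3 adj3_def matrix_matrix_mult_def sum_3 det_3 mat_def
      algebra_simps)

lemma adj3_mult: "adj3 A ** A = mat (det A)"
  by (simp add: vec_eq_iff forall_3 adj3_def matrix_matrix_mult_def sum_3 det_3 mat_def
      algebra_simps)

lemma adj3_matrix_mult: "adj3 (A ** B) = adj3 B ** adj3 A"
  by (simp add: vec_eq_iff forall_3 adj3_def matrix_matrix_mult_def sum_3 algebra_simps)

lemma adj3_hom:
  assumes "comm_ring_hom h"
  shows "map_matrix h (adj3 A) = adj3 (map_matrix h A)"
proof -
  interpret comm_ring_hom h by fact
  show ?thesis by (simp add: vec_eq_iff forall_3 adj3_def hom_mult hom_minus)
qed

lemma det_map_matrix: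
  fixes A :: "'r::comm_ring_1 ^ 3 ^ 3"
  assumes "comm_ring_hom h"
  shows "det (map_matrix h A) = h (det A)"
proof -
  interpret comm_ring_hom h by fact
  show ?thesis by (simp add: det_3 hom_mult hom_add hom_minus)
qed

lemma matrix_inv_eqI:
  fixes A B :: "'k::field ^ 'n::finite ^ 'n"
  assumes "A ** B = mat 1"
  shows "matrix_inv A = B"
proof -
  have "B ** A = mat 1" using assms matrix_left_right_inverse by blast
  then have "invertible A" using assms unfolding invertible_def by blast
  then have "matrix_inv A ** A = mat 1"
    unfolding invertible_def matrix_inv_def by (metis (mono_tags, lifting) someI_ex)
  then have "matrix_inv A ** (A ** B) = B" by (simp add: matrix_mul_assoc)
  then show ?thesis using assms by simp
qed

lemma matrix_inv_det_1: "det (A :: 'k::field ^ 3 ^ 3) = 1 \<Longrightarrow> matrix_inv A = adj3 A"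
  by (rule matrix_inv_eqI) (simp add: mult_adj3)

section \<open>Quadratic maps and their symmetric tensors\<close>

definition quad_map :: "'k::comm_ring_1 tensor \<Rightarrow> (3, 'k) mpoly ^ 3"
  where "quad_map a = (\<chi> i. \<Sum>j\<in>UNIV. \<Sum>k\<in>UNIV. Const (a i j k) * (Var j * Var k))"

abbreviation mon2 :: "'x \<Rightarrow> 'x \<Rightarrow> 'x \<Rightarrow>\<^sub>0 nat"
  where "mon2 j k \<equiv> Poly_Mapping.single j 1 + Poly_Mapping.single k 1"

text \<open>The coefficient of a mixed monomial is shared equally between its two orderings; the
  resulting tensor is symmetric and therefore determined by the map.\<close>

definition coeffs3 :: "(3, 'k::field) mpoly ^ 3 \<Rightarrow> 'k tensor"
  where "coeffs3 F i j k = Poly_Mapping.lookup (F $ i) (mon2 j k) * (if j = k then 1 else inverse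
      2)"

lemma coeffs3_sym: "coeffs3 F i j k = coeffs3 F i k j"
  by (auto simp: coeffs3_def add.commute)

lemma mon2_eq_iff: "mon2 j k = mon2 p q \<longleftrightarrow> j = p \<and> k = q \<or> j = q \<and> k = p"
proof
  assume eq: "mon2 j k = mon2 p q"
  have "Poly_Mapping.lookup (mon2 j k) x = Poly_Mapping.lookup (mon2 p q) x" for x
    by (simp only: eq)
  from this[of j] this[of k] this[of p] this[of q]
  show "j = p \<and> k = q \<or> j = q \<and> k = p"
    by (auto simp: lookup_add lookup_single when_def split: if_splits)
qed (auto simp: add.commute)

lemma lookup_quad_map: "Poly_Mapping.lookup (quad_map a $ i) m =
    (\<Sum>j\<in>UNIV. \<Sum>k\<in>UNIV. if mon2 j k = m then a i j k else 0)"
  by (simp add: quad_map_def lookup_sum Var_def Const_def mult_single lookup_single when_def)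

lemma monom_deg_0_iff: "monom_deg m = 0 \<longleftrightarrow> m = 0"
  by (auto simp: monom_deg_def in_keys_iff intro!: poly_mapping_eqI)

lemma monom_deg_SucE:
  assumes "monom_deg m = Suc d"
  obtains i m' where "m = Poly_Mapping.single i 1 + m'" "monom_deg m' = d"
proof -
  have "m \<noteq> 0" using assms by auto
  then obtain i where "i \<in> Poly_Mapping.keys m" by (metis ex_in_conv keys_eq_empty)
  then have *: "m = Poly_Mapping.single i 1 + (m - Poly_Mapping.single i 1)"
    by (intro poly_mapping_eqI) (auto simp: lookup_add lookup_minus lookup_single when_def
        in_keys_iff)
  then have "monom_deg m = 1 + monom_deg (m - Poly_Mapping.single i 1)"
    by (metis monom_deg_add monom_deg_single)
  with assms * that show ?thesis by simp
qed

lemma monom_deg_2E: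
  assumes "monom_deg m = 2"
  obtains p q where "m = mon2 p q"
proof -
  obtain i m' where m: "m = Poly_Mapping.single i 1 + m'" "monom_deg m' = Suc 0"
    using assms by (auto simp: numeral_2_eq_2 elim: monom_deg_SucE)
  obtain j m'' where "m' = Poly_Mapping.single j 1 + m''" "monom_deg m'' = 0"
    using m(2) by (rule monom_deg_SucE)
  with m(1) that show ?thesis by (simp add: monom_deg_0_iff)
qed

lemma quad_map_coeffs3:
  fixes F :: "(3, 'k::field_char_0) mpoly ^ 3"
  assumes "F \<in> form_tuples 2"
  shows "quad_map (coeffs3 F) = F"
proof -
  have "Poly_Mapping.lookup (quad_map (coeffs3 F) $ i) m = Poly_Mapping.lookup (F $ i) m" for i m
  proof (cases "monom_deg m = 2")
    case False
    then have "mon2 j k \<noteq> m" for j k :: 3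
      by (auto simp: monom_deg_add)
    moreover have "Poly_Mapping.lookup (F $ i) m = 0"
      using assms False unfolding form_tuples_def homogeneous_def
      by (metis (mono_tags, lifting) in_keys_iff mem_Collect_eq)
    ultimately show ?thesis by (simp add: lookup_quad_map)
  next
    case True
    then obtain p q where m: "m = mon2 p q" by (rule monom_deg_2E)
    show ?thesis
      unfolding m lookup_quad_map mon2_eq_iff
      using exhaust_3[of p] exhaust_3[of q]
      by (elim disjE) (simp_all add: sum_3 coeffs3_def add.commute)
  qed
  then show ?thesis
    by (intro vec_eq_iff[THEN iffD2] allI poly_mapping_eqI)
qed

lemma coeffs3_quad_map:
  assumes "\<And>i j k. a i j k = a i k j"
  shows "coeffs3 (quad_map a) = (a :: 'k::field_char_0 tensor)"
proof (intro ext)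
  fix i p q
  show "coeffs3 (quad_map a) i p q = a i p q"
    unfolding coeffs3_def lookup_quad_map mon2_eq_iff
    using exhaust_3[of p] exhaust_3[of q] assms[of i 2 1] assms[of i 3 1] assms[of i 3 2]
    by (elim disjE) (simp_all add: sum_3)
qed

lemma insertion_quad_map:
  assumes "comm_ring_hom c"
  shows "insertion c x (quad_map a $ i) = (\<Sum>j\<in>UNIV. \<Sum>k\<in>UNIV. c (a i j k) * (x j * x k))"
proof -
  interpret c: comm_ring_hom c by fact
  interpret comm_ring_hom "insertion c x" by (rule comm_ring_hom_insertion) fact
  show ?thesis by (simp add: quad_map_def hom_sum hom_mult)
qed

lemma insertion_matrix_tuple:
  assumes "comm_ring_hom c"
  shows "insertion c x (matrix_tuple A $ i) = (\<Sum>j\<in>UNIV. c (A $ i $ j) * x j)"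
proof -
  interpret c: comm_ring_hom c by fact
  interpret comm_ring_hom "insertion c x" by (rule comm_ring_hom_insertion) fact
  show ?thesis by (simp add: matrix_tuple_def hom_sum hom_mult)
qed

lemma conj_action_quad_map: "conj_action A (quad_map a) = quad_map (act A (matrix_inv A) a)"
proof -
  let ?B = "matrix_inv A"
  interpret C: comm_ring_hom "Const :: 'a \<Rightarrow> (3, 'a) mpoly" by (rule comm_ring_hom_Const)
  interpret ins: comm_ring_hom "insertion Const x :: (3, 'a) mpoly \<Rightarrow> (3, 'a) mpoly" for x
    by (intro comm_ring_hom_insertion comm_ring_hom_Const)
  have "conj_action A (quad_map a) $ i = quad_map (act A ?B a) $ i" for i
  proof -
    have BB: "matrix_tuple ?B $ q * matrix_tuple ?B $ r =
        (\<Sum>j\<in>UNIV. \<Sum>k\<in>UNIV. Const (?B $ q $ j) * Const (?B $ r $ k) * (Var j * Var k))" for q r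
      unfolding matrix_tuple_def vec_lambda_beta sum_product by (simp only: mult_ac)
    have "conj_action A (quad_map a) $ i = (\<Sum>p\<in>UNIV. Const (A $ i $ p) *
        (\<Sum>q\<in>UNIV. \<Sum>r\<in>UNIV. Const (a p q r) * (matrix_tuple ?B $ q * matrix_tuple ?B $ r)))"
      by (simp add: conj_action_def comp_tuple_def insertion_matrix_tuple comm_ring_hom_Const
          ins.hom_sum ins.hom_mult insertion_quad_map)
    also have "\<dots> = (\<Sum>p\<in>UNIV. \<Sum>q\<in>UNIV. \<Sum>r\<in>UNIV. \<Sum>j\<in>UNIV. \<Sum>k\<in>UNIV.
        Const (A $ i $ p * (?B $ q $ j * (?B $ r $ k * a p q r))) * (Var j * Var k))"
      unfolding BB by (simp add: sum_distrib_left Const_mult mult_ac)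
    also have "\<dots> = (\<Sum>j\<in>UNIV. \<Sum>k\<in>UNIV. \<Sum>p\<in>UNIV. \<Sum>q\<in>UNIV. \<Sum>r\<in>UNIV.
        Const (A $ i $ p * (?B $ q $ j * (?B $ r $ k * a p q r))) * (Var j * Var k))"
      by (simp only: sum.cartesian_product)
        (rule sum.reindex_bij_witness[of _ "\<lambda>(j, k, p, q, r). (p, q, r, j, k)" "\<lambda>(p, q, r, j, k).
            (j, k, p, q, r)"]; auto)
    also have "\<dots> = quad_map (act A ?B a) $ i"
      by (simp add: quad_map_def act_def C.hom_sum sum_distrib_left sum_distrib_right)
    finally show ?thesis .
  qed
  then show ?thesis by (simp add: vec_eq_iff)
qed

lemma coeffs3_conj_action:
  fixes F :: "(3, 'k::field_char_0) mpoly ^ 3"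
  assumes "F \<in> form_tuples 2"
  shows "coeffs3 (conj_action A F) = act A (matrix_inv A) (coeffs3 F)"
proof -
  have "conj_action A F = quad_map (act A (matrix_inv A) (coeffs3 F))"
    using conj_action_quad_map[of A "coeffs3 F"] quad_map_coeffs3[OF assms] by simp
  then show ?thesis
    using coeffs3_quad_map[OF act_sym[OF coeffs3_sym]] by simp
qed


definition generic_conj :: "'k::comm_ring_1 tensor \<Rightarrow> (nat, 'k) mpoly tensor"
  where "generic_conj a = act Zm (adj3 Zm) (\<lambda>i j k. Const (a i j k))"

text \<open>Conjugating by \<open>Z g\<close> means conjugating by \<open>g\<close> and then by
  \<open>Z\<close>. A right translation of \<open>Z\<close> is thus exchanged for a conjugation of
  the map, which turns averages over \<open>Z\<close> into invariants of the map.\<close>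

lemma right_mult_generic_conj: "right_mult g (generic_conj a i j k) = generic_conj (act g (adj3 g)
    a) i j k"
proof -
  let ?G = "map_matrix Const g"
  note hom = comm_ring_hom_right_mult[of g] comm_ring_hom_Const
  have Zm: "map_matrix (right_mult g) Zm = Zm ** ?G"
    by (simp add: vec_eq_iff matrix_matrix_mult_def right_mult_Zm)
  have "right_mult g (generic_conj a i j k) = act (Zm ** ?G) (adj3 (Zm ** ?G)) (\<lambda>i j k. Const (a i
      j k)) i j k"
    unfolding generic_conj_def by (simp add: act_hom[OF hom(1)] adj3_hom[OF hom(1)] Zm)
  also have "\<dots> = act Zm (adj3 Zm) (act ?G (adj3 ?G) (\<lambda>i j k. Const (a i j k))) i j k"
    by (simp add: adj3_matrix_mult act_act)
  also have "act ?G (adj3 ?G) (\<lambda>i j k. Const (a i j k)) = (\<lambda>i j k. Const (act g (adj3 g) a i j k))"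
    by (intro ext) (simp add: act_hom[OF hom(2)] adj3_hom[OF hom(2)])
  finally show ?thesis by (simp add: generic_conj_def)
qed

section \<open>Polynomial dependence on the coefficients of the map\<close>

lemma polynomials_on_form_tuples_add:
  "p \<in> polynomials_on_form_tuples d \<Longrightarrow> q \<in> polynomials_on_form_tuples d \<Longrightarrow>
    p + q \<in> polynomials_on_form_tuples d"
  using keys_add[of p q] unfolding polynomials_on_form_tuples_def by blast

lemma polynomials_on_form_tuples_mult:
  "p \<in> polynomials_on_form_tuples d \<Longrightarrow> q \<in> polynomials_on_form_tuples d \<Longrightarrow>
    p * q \<in> polynomials_on_form_tuples d"
  unfolding polynomials_on_form_tuples_def
proof (intro CollectI ballI)
  let ?V = "{(i, m). monom_deg m = d}"
  fix u assume p: "p \<in> {P. \<forall>u\<in>Poly_Mapping.keys P. Poly_Mapping.keys u \<subseteq> ?V}"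
    and q: "q \<in> {P. \<forall>u\<in>Poly_Mapping.keys P. Poly_Mapping.keys u \<subseteq> ?V}"
    and u: "u \<in> Poly_Mapping.keys (p * q)"
  obtain a b where "a \<in> Poly_Mapping.keys p" "b \<in> Poly_Mapping.keys q" "u = a + b"
    using keys_mult[of p q] u by blast
  with p q show "Poly_Mapping.keys u \<subseteq> ?V"
    using keys_add[of a b] by blast
qed

lemma polynomials_on_form_tuples_Const: "Const c \<in> polynomials_on_form_tuples d"
  by (auto simp: polynomials_on_form_tuples_def Const_def split: if_splits)

lemma polynomials_on_form_tuples_Var: "monom_deg m = d \<Longrightarrow> Var (i, m) \<in> polynomials_on_form_tuples d"
  by (auto simp: polynomials_on_form_tuples_def Var_def split: if_splits)

type_synonym ('x, 'k) family = "(3, 'k) mpoly ^ 3 \<Rightarrow> ('x, 'k) mpoly"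

definition form_coord :: "(3, 'k) mpoly ^ 3 \<Rightarrow> 3 \<times> (3 \<Rightarrow>\<^sub>0 nat) \<Rightarrow> 'k::comm_ring_1"
  where "form_coord F = (\<lambda>(i, m). Poly_Mapping.lookup (F $ i) m)"

text \<open>\<open>Q\<close> is a form in the coordinates of \<open>F\<close> whose coefficients are
  themselves polynomials. An invariant must be given as a polynomial and not just as a function of
  \<open>F\<close>, so this dependence has to be carried along.\<close>

definition poly_family :: "nat \<Rightarrow> ('x, 'k::comm_ring_1) family \<Rightarrow> bool"
  where "poly_family n f \<longleftrightarrow> (\<exists>Q. homogeneous n Q \<and> Q \<in> polynomials_on_form_tuples 2 \<and>
    (\<forall>F. f F = insertion (\<lambda>x. x) (\<lambda>v. Const (form_coord F v)) Q))"

lemma poly_family_mult: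
  fixes f g :: "('x, 'k::comm_ring_1) family"
  assumes "poly_family n f" "poly_family m g"
  shows "poly_family (n + m) (\<lambda>F. f F * g F)"
proof -
  interpret comm_ring_hom "insertion (\<lambda>p::('x, 'k) mpoly. p) y" for y :: "3 \<times> (3 \<Rightarrow>\<^sub>0 nat) \<Rightarrow> _"
    by (intro comm_ring_hom_insertion comm_ring_hom_id)
  obtain Q R where "homogeneous n Q" "Q \<in> polynomials_on_form_tuples 2" "homogeneous m R"
    "R \<in> polynomials_on_form_tuples 2"
    "\<And>F. f F = insertion (\<lambda>x. x) (\<lambda>v. Const (form_coord F v)) Q"
    "\<And>F. g F = insertion (\<lambda>x. x) (\<lambda>v. Const (form_coord F v)) R"
    using assms unfolding poly_family_def by blast
  then show ?thesis
    unfolding poly_family_def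
    by (intro exI[of _ "Q * R"]) (simp add: homogeneous_mult polynomials_on_form_tuples_mult
        hom_mult)
qed

lemma poly_family_add:
  fixes f g :: "('x, 'k::comm_ring_1) family"
  assumes "poly_family n f" "poly_family n g"
  shows "poly_family n (\<lambda>F. f F + g F)"
proof -
  interpret comm_ring_hom "insertion (\<lambda>p::('x, 'k) mpoly. p) y" for y :: "3 \<times> (3 \<Rightarrow>\<^sub>0 nat) \<Rightarrow> _"
    by (intro comm_ring_hom_insertion comm_ring_hom_id)
  obtain Q R where "homogeneous n Q" "Q \<in> polynomials_on_form_tuples 2" "homogeneous n R"
    "R \<in> polynomials_on_form_tuples 2"
    "\<And>F. f F = insertion (\<lambda>x. x) (\<lambda>v. Const (form_coord F v)) Q"
    "\<And>F. g F = insertion (\<lambda>x. x) (\<lambda>v. Const (form_coord F v)) R"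
    using assms unfolding poly_family_def by blast
  then show ?thesis
    unfolding poly_family_def
    by (intro exI[of _ "Q + R"]) (simp add: homogeneous_add polynomials_on_form_tuples_add hom_add)
qed

lemma poly_family_const: "poly_family 0 (\<lambda>F. h)"
  unfolding poly_family_def
  by (intro exI[of _ "Const h"]) (simp add: polynomials_on_form_tuples_Const)

lemma poly_family_scale: "poly_family n f \<Longrightarrow> poly_family n (\<lambda>F. h * f F)"
  using poly_family_mult[OF poly_family_const, of n f h] by simp

lemma poly_family_0: "poly_family n (\<lambda>F. 0)"
  unfolding poly_family_def
  by (intro exI[of _ 0]) (simp add: insertion_altdef polynomials_on_form_tuples_def)

lemma poly_family_sum:
  "(\<And>i. i \<in> A \<Longrightarrow> poly_family n (f i)) \<Longrightarrow> poly_family n (\<lambda>F. \<Sum>i\<in>A. f i F)"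
  by (induction A rule: infinite_finite_induct) (auto intro: poly_family_0 poly_family_add)

lemma poly_family_power: "poly_family n f \<Longrightarrow> poly_family (k * n) (\<lambda>F. f F ^ k)"
  by (induction k) (auto intro: poly_family_const poly_family_mult)

lemma poly_family_prod:
  "(\<And>i. i \<in> A \<Longrightarrow> poly_family (n i) (f i)) \<Longrightarrow> poly_family (\<Sum>i\<in>A. n i) (\<lambda>F. \<Prod>i\<in>A. f i F)"
  by (induction A rule: infinite_finite_induct) (auto intro: poly_family_const poly_family_mult)

lemma poly_family_mon_eval:
  assumes "\<And>t. poly_family n (y t)"
  shows "poly_family (n * monom_deg u) (\<lambda>F. mon_eval (\<lambda>t. y t F) u)"
proof -
  have "poly_family (\<Sum>t\<in>Poly_Mapping.keys u. Poly_Mapping.lookup u t * n) (\<lambda>F. mon_eval (\<lambda>t. y t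
      F) u)"
    unfolding mon_eval_def by (intro poly_family_prod poly_family_power assms)
  then show ?thesis
    by (simp add: monom_deg_def sum_distrib_left mult.commute)
qed

lemma poly_family_coord: "monom_deg m = 2 \<Longrightarrow> poly_family 1 (\<lambda>F. Const (Poly_Mapping.lookup (F $ i)
    m))"
  unfolding poly_family_def
  by (intro exI[of _ "Var (i, m)"])
    (use homogeneous_Var in \<open>simp add: polynomials_on_form_tuples_Var form_coord_def\<close>)

lemma poly_family_generic_conj: "poly_family 1 (\<lambda>F. generic_conj (coeffs3 F) i j k)"
proof -
  have "poly_family 1 (\<lambda>F. Const (coeffs3 F p q r))" for p q r
    unfolding coeffs3_def Const_mult mult.commute[of "Const (Poly_Mapping.lookup _ _)"]
    by (intro poly_family_scale poly_family_coord) (simp add: monom_deg_add)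
  then show ?thesis
    unfolding generic_conj_def act_def by (intro poly_family_sum poly_family_scale)
qed

text \<open>The average is linear over \<open>'k\<close>, and the coordinates of \<open>F\<close>
  enter as constants. It can therefore be applied to the coefficients of \<open>Q\<close>, once for
  all \<open>F\<close>.\<close>

lemma poly_family_reynolds:
  fixes f :: "(nat, 'k::comm_ring_1) family"
  assumes "poly_family n f"
  shows "\<exists>P. homogeneous n P \<and> P \<in> polynomials_on_form_tuples 2 \<and>
    (\<forall>F. eval_at_forms P F = reynolds N (f F))"
proof -
  obtain Q where Q: "homogeneous n Q" "Q \<in> polynomials_on_form_tuples 2"
    "\<And>F. f F = insertion (\<lambda>x. x) (\<lambda>v. Const (form_coord F v)) Q"
    using assms unfolding poly_family_def by blast
  let ?P = "Poly_Mapping.map (reynolds N) Q"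
  have lookup: "Poly_Mapping.lookup ?P u = reynolds N (Poly_Mapping.lookup Q u)" for u
    by (simp add: map.rep_eq when_def)
  then have keys: "Poly_Mapping.keys ?P \<subseteq> Poly_Mapping.keys Q"
    by (auto simp: in_keys_iff)
  have "mon_eval (\<lambda>v. Const (x v)) u = (Const (mon_eval x u) :: (nat, 'k) mpoly)"
    for x :: "3 \<times> (3 \<Rightarrow>\<^sub>0 nat) \<Rightarrow> 'k" and u
  proof -
    interpret C: comm_ring_hom "Const :: 'k \<Rightarrow> (nat, 'k) mpoly" by (rule comm_ring_hom_Const)
    show ?thesis by (simp add: mon_eval_def C.hom_prod C.hom_power)
  qed
  then have "reynolds N (f F) = (\<Sum>u\<in>Poly_Mapping.keys Q. reynolds N (Poly_Mapping.lookup Q u) *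
      mon_eval (form_coord F) u)" for F
    unfolding Q(3) insertion_altdef reynolds_sum
    by (simp add: reynolds_Const_mult mult.commute[of _ "Const _"] mult.commute[of "mon_eval _ _"])
  moreover have "eval_at_forms ?P F = (\<Sum>u\<in>Poly_Mapping.keys Q. reynolds N (Poly_Mapping.lookup Q
      u) * mon_eval (form_coord F) u)" for F
    unfolding eval_at_forms_def form_coord_def[symmetric]
    by (subst insertion_superset[OF finite_keys keys]) (simp_all add: lookup)
  ultimately have "\<forall>F. eval_at_forms ?P F = reynolds N (f F)" by simp
  moreover have "homogeneous n ?P"
    using Q(1) subsetD[OF keys] by (simp add: homogeneous_def)
  moreover have "?P \<in> polynomials_on_form_tuples 2"
    using Q(2) subsetD[OF keys] by (simp add: polynomials_on_form_tuples_def)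
  ultimately show ?thesis by (intro exI[of _ ?P] conjI)
qed

text \<open>Conjugation by \<open>Z\<close> is homogeneous of degree \<open>-1\<close> in \<open>Z\<close>, so \<open>det Z\<close> times a product of three
  coefficients has degree \<open>0\<close>. With the adjugate in place of the inverse of \<open>Z\<close> the coefficients
  are multiplied by \<open>det Z ^ 2\<close>, whence the denominators \<open>\<Delta> ^ 5\<close> below.\<close>

type_synonym idx = "3 \<times> 3 \<times> 3"

fun tcoord :: "'r tensor \<Rightarrow> idx \<Rightarrow> 'r"
  where "tcoord a (i, j, k) = a i j k"

fun triple :: "'r::comm_ring_1 tensor \<Rightarrow> idx \<times> idx \<times> idx \<Rightarrow> 'r"
  where "triple a (s, t, v) = tcoord a s * tcoord a t * tcoord a v"

lemma right_mult_triple: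
  "right_mult g (triple (generic_conj a) t) = triple (generic_conj (act g (adj3 g) a)) t"
  by (cases "(a, t)" rule: triple.cases)
    (auto simp: right_mult.hom_mult right_mult_generic_conj split: prod.splits)

lemma right_mult_mon_eval: "right_mult g (mon_eval y u) = mon_eval (\<lambda>t. right_mult g (y t)) u"
  by (simp add: mon_eval_def right_mult.hom_prod right_mult.hom_power)

lemma right_mult_det_Zm: "right_mult g \<Delta> = Const (det g) * \<Delta>"
proof -
  have "map_matrix (right_mult g) Zm = Zm ** map_matrix Const g"
    by (simp add: vec_eq_iff matrix_matrix_mult_def right_mult_Zm)
  then have "right_mult g \<Delta> = det (Zm ** map_matrix Const g)"
    by (metis det_map_matrix comm_ring_hom_right_mult)
  then show ?thesis
    by (simp add: det_mul det_map_matrix comm_ring_hom_Const mult.commute)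
qed

text \<open>As a function of \<open>F\<close> the average is a form of degree
  \<open>3 * monom_deg u\<close>, positive because \<open>u \<noteq> 0\<close>. Conjugating
  \<open>F\<close> by \<open>A\<close> amounts to translating \<open>Z\<close> by \<open>A\<close>,
  which for \<open>det A = 1\<close> changes neither \<open>\<Delta>\<close> nor the
  average.\<close>

lemma semistable_of_reynolds:
  fixes F :: "(3, 'k::field_char_0) mpoly ^ 3"
  assumes F: "F \<in> form_tuples 2" and u: "u \<noteq> 0"
    and nz: "reynolds N (\<Delta> ^ e * mon_eval (triple (generic_conj (coeffs3 F))) u) \<noteq> 0"
  shows "semistable 2 F"
proof -
  define f where "f F = \<Delta> ^ e * mon_eval (triple (generic_conj (coeffs3 F))) u" for F :: "(3, 'k)
      mpoly ^ 3"
  have "poly_family 3 (\<lambda>F :: (3, 'k) mpoly ^ 3. triple (generic_conj (coeffs3 F)) t)" for t ::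
      "idx \<times> idx \<times> idx"
  proof -
    have c: "poly_family 1 (\<lambda>F :: (3, 'k) mpoly ^ 3. tcoord (generic_conj (coeffs3 F)) s)" for s
      by (cases s) (use poly_family_generic_conj in simp)
    obtain s1 s2 s3 where "t = (s1, s2, s3)" by (rule prod_cases3)
    then show ?thesis
      using poly_family_mult[OF poly_family_mult[OF c[of s1] c[of s2]] c[of s3]]
      by (simp add: numeral_3_eq_3)
  qed
  then have "poly_family (3 * monom_deg u) f"
    unfolding f_def by (intro poly_family_scale poly_family_mon_eval)
  then obtain P where P: "homogeneous (3 * monom_deg u) P" "P \<in> polynomials_on_form_tuples 2"
    "\<And>F. eval_at_forms P F = reynolds N (f F)"
    using poly_family_reynolds by meson
  have "SL_invariant 2 P"
    unfolding SL_invariant_def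
  proof (intro allI impI ballI)
    fix A :: "'k ^ 3 ^ 3" and F :: "(3, 'k) mpoly ^ 3"
    assume A: "det A = 1" and F: "F \<in> form_tuples 2"
    have "f (conj_action A F) = right_mult A (f F)"
      by (simp add: f_def coeffs3_conj_action[OF F] matrix_inv_det_1[OF A] right_mult.hom_mult
          right_mult.hom_power right_mult_det_Zm A right_mult_mon_eval right_mult_triple)
    then show "eval_at_forms P (conj_action A F) = eval_at_forms P F"
      by (simp add: P(3) reynolds_right_mult A)
  qed
  moreover have "monom_deg u > 0" using u by (simp add: monom_deg_0_iff flip: neq0_conv)
  moreover have "eval_at_forms P F \<noteq> 0" using nz by (simp add: P(3) f_def)
  ultimately show ?thesis
    unfolding semistable_def using P(1,2) by (intro exI[of _ P] exI[of _ "3 * monom_deg u"]) auto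
qed

text \<open>The relation is cleared of denominators and averaged. By instability all monomials of
  positive degree average to 0, which leaves the constant term times the nonzero average of
  \<open>\<Delta> ^ N\<close>.\<close>

lemma unstable_no_relation:
  fixes F :: "(3, 'k::field_char_0) mpoly ^ 3" and P :: "(idx \<times> idx \<times> idx, 'k) mpoly"
  assumes F: "F \<in> form_tuples 2" and unstable: "unstable 2 F"
    and P: "insertion (\<lambda>c. to_fract (Const c))
      (\<lambda>t. to_fract (triple (generic_conj (coeffs3 F)) t) / to_fract \<Delta> ^ 5) P = 0"
  shows "Poly_Mapping.lookup P 0 = 0"
proof -
  let ?y = "triple (generic_conj (coeffs3 F))" and ?d = "to_fract (\<Delta> :: (nat, 'k) mpoly)"
  \<comment> \<open>Large enough to clear the denominators of every monomial of \<open>P\<close>.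
    The same \<open>N\<close> counts the applications of \<open>\<Omega>\<close>, to match the
    factor \<open>\<Delta> ^ N\<close> at the constant term.\<close>
  define N where "N = (\<Sum>u\<in>Poly_Mapping.keys P. 5 * monom_deg u)"
  have le: "5 * monom_deg u \<le> N" if "u \<in> Poly_Mapping.keys P" for u
    unfolding N_def by (rule member_le_sum) (use that in auto)
  have d: "?d \<noteq> 0" using det_Zm_nonzero by simp
  have mon: "mon_eval (\<lambda>t. to_fract (?y t) / ?d ^ 5) u = to_fract (mon_eval ?y u) / ?d ^ (5 *
      monom_deg u)" for u
    by (simp add: mon_eval_def monom_deg_def power_divide prod_dividef to_fract_hom.hom_prod
        to_fract_hom.hom_power
        power_sum sum_distrib_left power_mult)
  define H where "H u = \<Delta> ^ (N - 5 * monom_deg u) * mon_eval ?y u" for u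
  have scaled: "?d ^ N * (to_fract (Const c) * mon_eval (\<lambda>t. to_fract (?y t) / ?d ^ 5) u)
      = to_fract (Const c * H u)" if "u \<in> Poly_Mapping.keys P" for u c
    unfolding mon H_def to_fract_hom.hom_mult to_fract_hom.hom_power using le[OF that] d by (simp
        add: power_diff)
  have "to_fract (\<Sum>u\<in>Poly_Mapping.keys P. Const (Poly_Mapping.lookup P u) * H u) = ?d ^ N * 0"
    unfolding P[symmetric] insertion_altdef sum_distrib_left to_fract_hom.hom_sum
    by (intro sum.cong refl scaled[symmetric])
  then have "(\<Sum>u\<in>Poly_Mapping.keys P. Const (Poly_Mapping.lookup P u) * H u) = 0"
    unfolding mult_zero_right to_fract_hom.hom_0_iff .
  then have "0 = reynolds N (\<Sum>u\<in>Poly_Mapping.keys P. Const (Poly_Mapping.lookup P u) * H u)"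
    by simp
  also have "\<dots> = (\<Sum>u\<in>Poly_Mapping.keys P. Poly_Mapping.lookup P u * reynolds N (H u))"
    by (simp add: reynolds_sum reynolds_Const_mult)
  also have "\<dots> = (\<Sum>u\<in>Poly_Mapping.keys P. if u = 0 then Poly_Mapping.lookup P 0 * reynolds N (\<Delta> ^
      N) else 0)"
  proof (intro sum.cong refl)
    fix u
    have "reynolds N (H u) = 0" if "u \<noteq> 0"
      using semistable_of_reynolds[OF F that] unstable unfolding unstable_def H_def by blast
    then show "Poly_Mapping.lookup P u * reynolds N (H u) =
        (if u = 0 then Poly_Mapping.lookup P 0 * reynolds N (\<Delta> ^ N) else 0)"
      by (simp add: H_def)
  qed
  also have "\<dots> = Poly_Mapping.lookup P 0 * reynolds N (\<Delta> ^ N)"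
    by (simp add: in_keys_iff)
  finally show ?thesis
    using reynolds_det_power[of N, where 'k = 'k] by simp
qed

section \<open>Elementary divisors over the valuation ring\<close>

definition mat3 :: "'r \<Rightarrow> 'r \<Rightarrow> 'r \<Rightarrow> 'r \<Rightarrow> 'r \<Rightarrow> 'r \<Rightarrow> 'r \<Rightarrow> 'r \<Rightarrow> 'r \<Rightarrow> 'r::zero ^ 3 ^ 3"
  where "mat3 a b c d e f g h k = vector [vector [a, b, c], vector [d, e, f], vector [g, h, k]]"

lemma mat3_nth [simp]:
  "mat3 a b c d e f g h k $ 1 $ 1 = a" "mat3 a b c d e f g h k $ 1 $ 2 = b"
  "mat3 a b c d e f g h k $ 1 $ 3 = c"
  "mat3 a b c d e f g h k $ 2 $ 1 = d" "mat3 a b c d e f g h k $ 2 $ 2 = e"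
  "mat3 a b c d e f g h k $ 2 $ 3 = f"
  "mat3 a b c d e f g h k $ 3 $ 1 = g" "mat3 a b c d e f g h k $ 3 $ 2 = h"
  "mat3 a b c d e f g h k $ 3 $ 3 = k"
  by (simp_all add: mat3_def)

lemma matrix_mult_nth3:
  fixes A :: "'r::comm_ring_1 ^ 3 ^ 'm::finite" and B :: "'r ^ 'n::finite ^ 3"
  shows "(A ** B) $ i $ j = A $ i $ 1 * B $ 1 $ j + A $ i $ 2 * B $ 2 $ j + A $ i $ 3 * B $ 3 $ j"
  by (simp add: matrix_matrix_mult_def sum_3)

text \<open>The identity and the three transpositions. All are involutions, so one permutation
  matrix serves for rows and for columns.\<close>

definition is_swap :: "(3 \<Rightarrow> 3) \<Rightarrow> bool"
  where "is_swap \<tau> \<longleftrightarrow> \<tau> = (\<lambda>i. i) \<or> \<tau> = (\<lambda>i. if i = 1 then 2 else if i = 2 then 1 else 3)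
    \<or> \<tau> = (\<lambda>i. if i = 1 then 3 else if i = 3 then 1 else 2)
    \<or> \<tau> = (\<lambda>i. if i = 2 then 3 else if i = 3 then 2 else 1)"

lemma swap_1_to: "\<exists>\<tau>. \<tau> 1 = i \<and> is_swap \<tau>"
proof -
  consider "i = 1" | "i = 2" | "i = 3" using exhaust_3[of i] by blast
  then show ?thesis
  proof cases
    case 1
    then show ?thesis by (intro exI[of _ "\<lambda>i. i"]) (simp add: is_swap_def)
  next
    case 2
    then show ?thesis
      by (intro exI[of _ "\<lambda>i. if i = 1 then 2 else if i = 2 then 1 else 3"]) (simp add: is_swap_def)
  next
    case 3
    then show ?thesis
      by (intro exI[of _ "\<lambda>i. if i = 1 then 3 else if i = 3 then 1 else 2"]) (simp add: is_swap_def)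
  qed
qed

lemma swap_2_to:
  assumes "i \<noteq> 1"
  shows "\<exists>\<tau>. \<tau> 2 = i \<and> \<tau> 1 = 1 \<and> \<tau> 3 \<noteq> 1 \<and> is_swap \<tau>"
proof -
  consider "i = 2" | "i = 3" using exhaust_3[of i] assms by blast
  then show ?thesis
  proof cases
    case 1
    then show ?thesis by (intro exI[of _ "\<lambda>i. i"]) (simp add: is_swap_def)
  next
    case 2
    then show ?thesis
      by (intro exI[of _ "\<lambda>i. if i = 2 then 3 else if i = 3 then 2 else 1"]) (simp add: is_swap_def)
  qed
qed

lemma map_matrix_scale_mult: "(A ** map_matrix ((*) s) B) = map_matrix ((*) s) (A ** B)"
  and map_matrix_scale_mult': "(map_matrix ((*) s) A ** B) = map_matrix ((*) s) (A ** B)"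
  for A B :: "'r::comm_ring_1 ^ 3 ^ 3"
  by (simp_all add: vec_eq_iff matrix_mult_nth3 algebra_simps)

definition inv3 :: "'k::field ^ 3 ^ 3 \<Rightarrow> 'k ^ 3 ^ 3"
  where "inv3 A = map_matrix ((*) (inverse (det A))) (adj3 A)"

lemma inv3:
  assumes "det A \<noteq> 0"
  shows "A ** inv3 A = mat 1" "inv3 A ** A = mat 1"
  using assms
  by (simp_all add: inv3_def map_matrix_scale_mult map_matrix_scale_mult' mult_adj3 adj3_mult
      vec_eq_iff mat_def)

text \<open>Flattens the nested sums into one linear combination of coordinates, the form in which
  \<open>cube_zero_mem\<close> applies.\<close>

lemma act_eq_sum: "act Z Y a i j k =
    (\<Sum>s\<in>UNIV. (Z $ i $ fst s * (Y $ fst (snd s) $ j * Y $ snd (snd s) $ k)) * tcoord a s)"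
proof -
  have t: "tcoord a s = a (fst s) (fst (snd s)) (snd (snd s))" for s
    by (cases s) auto
  show ?thesis
    unfolding act_def t sum_distrib_left
    by (simp add: sum.cartesian_product case_prod_unfold mult.assoc)
qed

text \<open>The two shapes of a quadratic map all of whose coefficients have positive weight for some
  one-parameter subgroup with weights in decreasing order: the middle weight is nonnegative in the
  first shape and nonpositive in the second.\<close>

definition fibred_shape :: "'r::zero tensor \<Rightarrow> bool"
  where "fibred_shape a \<longleftrightarrow> (\<forall>j k. j = 3 \<or> k = 3 \<longrightarrow> a 1 j k = 0 \<and> a 2 j k = 0)"

definition degenerate_shape :: "'r::zero tensor \<Rightarrow> bool"
  where "degenerate_shape a \<longleftrightarrow> (\<forall>j k. (j \<noteq> 1 \<or> k \<noteq> 1 \<longrightarrow> a 1 j k = 0) \<and>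
    (j \<noteq> 1 \<and> k \<noteq> 1 \<longrightarrow> a 2 j k = 0) \<and> (j \<noteq> 1 \<and> k \<noteq> 1 \<and> (j = 3 \<or> k = 3) \<longrightarrow> a 3 j k = 0))"

context maximal_pairs
begin

section \<open>Divisibility in the valuation ring\<close>

definition integral_elt :: "'l \<Rightarrow> bool"
  where "integral_elt x \<longleftrightarrow> (\<exists>c. (x, c) \<in> G)"

lemma integral_add: "integral_elt x \<Longrightarrow> integral_elt y \<Longrightarrow> integral_elt (x + y)"
  unfolding integral_elt_def using add_mem by blast

lemma integral_mult: "integral_elt x \<Longrightarrow> integral_elt y \<Longrightarrow> integral_elt (x * y)"
  unfolding integral_elt_def using mult_mem by blast

lemma integral_uminus: "integral_elt x \<Longrightarrow> integral_elt (- x)"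
  unfolding integral_elt_def using uminus_mem by blast

lemma integral_power: "integral_elt x \<Longrightarrow> integral_elt (x ^ n)"
  unfolding integral_elt_def using power_mem by blast

lemma integral_0 [simp]: "integral_elt 0" and integral_1 [simp]: "integral_elt 1"
  unfolding integral_elt_def using zero_mem one_mem by blast+

text \<open>The order of values, expressed without a value group.\<close>

definition divs :: "'l \<Rightarrow> 'l \<Rightarrow> bool"
  where "divs x y \<longleftrightarrow> (\<exists>b. integral_elt b \<and> y = x * b)"

lemma divs_refl: "divs x x"
  unfolding divs_def by (intro exI[of _ 1]) simp

lemma divs_0 [simp]: "divs x 0"
  unfolding divs_def by (intro exI[of _ 0]) simp

lemma divs_trans: "divs x y \<Longrightarrow> divs y z \<Longrightarrow> divs x z"
  unfolding divs_def using integral_mult by (metis mult.assoc)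

lemma divs_add: "divs x y \<Longrightarrow> divs x z \<Longrightarrow> divs x (y + z)"
  unfolding divs_def using integral_add by (metis distrib_left)

lemma divs_mult: "divs x y \<Longrightarrow> integral_elt b \<Longrightarrow> divs x (y * b)"
  unfolding divs_def using integral_mult by (metis mult.assoc)

lemma divs_total: "divs x y \<or> divs y x"
proof (cases "x = 0 \<or> y = 0")
  case False
  have "integral_elt (y / x) \<or> integral_elt (inverse (y / x))"
    using mem_or_inverse_mem[of "y / x"] unfolding integral_elt_def by blast
  moreover have "y = x * (y / x)" "x = y * inverse (y / x)"
    using False by (simp_all add: field_simps)
  ultimately show ?thesis unfolding divs_def by blast
qed auto

lemma exists_divs_least:
  assumes "finite S" "S \<noteq> {}"
  shows "\<exists>s\<in>S. \<forall>t\<in>S. divs (f s) (f t)"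
  using assms
proof (induction S rule: finite_ne_induct)
  case (singleton x)
  then show ?case using divs_refl by blast
next
  case (insert x F)
  then obtain s where s: "s \<in> F" "\<And>t. t \<in> F \<Longrightarrow> divs (f s) (f t)" by blast
  show ?case
  proof (cases "divs (f s) (f x)")
    case True
    then show ?thesis using s by blast
  next
    case False
    then have "divs (f x) (f s)" using divs_total by blast
    then show ?thesis using s divs_trans divs_refl by blast
  qed
qed

section \<open>Matrices over the valuation ring and elementary divisors\<close>

definition mat_rel :: "'l ^ 3 ^ 3 \<Rightarrow> 'k ^ 3 ^ 3 \<Rightarrow> bool"
  where "mat_rel A A' \<longleftrightarrow> (\<forall>i j. (A $ i $ j, A' $ i $ j) \<in> G)"

lemma mat_rel_mult: "mat_rel A A' \<Longrightarrow> mat_rel B B' \<Longrightarrow> mat_rel (A ** B) (A' ** B')"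
  unfolding mat_rel_def matrix_matrix_mult_def by (auto intro!: sum_mem mult_mem)

lemma mat_rel_det: "mat_rel A A' \<Longrightarrow> (det A, det A') \<in> G"
  unfolding mat_rel_def det_3 by (intro add_mem diff_mem mult_mem) auto

text \<open>The group \<open>GL_3\<close> of the valuation ring: the determinant is a unit exactly
  if its residue is nonzero.\<close>

definition unimod :: "'l ^ 3 ^ 3 \<Rightarrow> bool"
  where "unimod A \<longleftrightarrow> (\<exists>A'. mat_rel A A' \<and> det A' \<noteq> 0)"

lemma unimod_mult: "unimod A \<Longrightarrow> unimod B \<Longrightarrow> unimod (A ** B)"
  unfolding unimod_def using mat_rel_mult by (metis det_mul mult_eq_0_iff)

lemma unimod_integral: "unimod A \<Longrightarrow> integral_elt (A $ i $ j)"
  unfolding unimod_def mat_rel_def integral_elt_def by blast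

lemma unimod_mat3:
  assumes "(a, a') \<in> G" "(b, b') \<in> G" "(c, c') \<in> G" "(d, d') \<in> G" "(e, e') \<in> G" "(f, f') \<in> G"
    "(g, g') \<in> G" "(h, h') \<in> G" "(k, k') \<in> G" "det (mat3 a' b' c' d' e' f' g' h' k') \<noteq> 0"
  shows "unimod (mat3 a b c d e f g h k)"
  unfolding unimod_def mat_rel_def
  by (intro exI[of _ "mat3 a' b' c' d' e' f' g' h' k'"]) (use assms in \<open>simp add: forall_3\<close>)

definition equiv_mat :: "'l ^ 3 ^ 3 \<Rightarrow> 'l ^ 3 ^ 3 \<Rightarrow> bool"
  where "equiv_mat Z W \<longleftrightarrow> (\<exists>Q P. unimod Q \<and> unimod P \<and> W = Q ** Z ** P)"

lemma equiv_mat_trans: "equiv_mat X Y \<Longrightarrow> equiv_mat Y Z \<Longrightarrow> equiv_mat X Z"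
  unfolding equiv_mat_def using unimod_mult by (metis matrix_mul_assoc)

lemma unimod_1: "unimod (mat 1)"
proof -
  have "mat 1 = mat3 1 0 0 0 1 0 0 0 (1::'l)"
    by (simp add: vec_eq_iff forall_3 mat_def)
  moreover have "unimod (mat3 1 0 0 0 1 0 0 0 1)"
    by (rule unimod_mat3) (auto simp: zero_mem one_mem det_3 intro: zero_mem one_mem)
  ultimately show ?thesis by simp
qed

lemma equiv_mat_left: "unimod Q \<Longrightarrow> equiv_mat Z (Q ** Z)"
  unfolding equiv_mat_def using unimod_1 by (metis matrix_mul_rid)

lemma equiv_mat_right: "unimod P \<Longrightarrow> equiv_mat Z (Z ** P)"
  unfolding equiv_mat_def using unimod_1 by (metis matrix_mul_lid)

text \<open>The new entries are integral combinations of the old ones. Hence the first pivot still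
  divides the second after the lower block has been transformed.\<close>

lemma divs_equiv_mat:
  assumes "equiv_mat Z W" "\<And>i j. divs x (Z $ i $ j)"
  shows "divs x (W $ i $ j)"
proof -
  obtain Q P where "unimod Q" "unimod P" and W: "W = Q ** Z ** P"
    using assms(1) unfolding equiv_mat_def by blast
  moreover from this have "divs x ((Q ** Z) $ i $ j)" for i j
    unfolding matrix_mult_nth3 mult.commute[of "Q $ _ $ _"]
    by (intro divs_add divs_mult assms(2) unimod_integral)
  ultimately show ?thesis
    unfolding W matrix_mult_nth3[of "Q ** Z"] by (intro divs_add divs_mult unimod_integral)
qed

lemma equiv_mat_swap:
  fixes \<tau> :: "3 \<Rightarrow> 3"
  assumes "is_swap \<tau>"
  shows "equiv_mat Z (\<chi> i j. Z $ \<tau> i $ j)" "equiv_mat Z (\<chi> i j. Z $ i $ \<tau> j)"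
proof -
  let ?d = "\<lambda>i j. if j = \<tau> i then 1 else 0"
  let ?Q = "mat3 (?d 1 1) (?d 1 2) (?d 1 3) (?d 2 1) (?d 2 2) (?d 2 3) (?d 3 1) (?d 3 2) (?d 3 3)
      :: 'l ^ 3 ^ 3"
  have d: "(?d i j, ?d i j) \<in> G" for i j by (simp add: zero_mem one_mem)
  have Q: "unimod ?Q"
    by (rule unimod_mat3[OF d d d d d d d d d]) (use assms[unfolded is_swap_def] in \<open>elim disjE;
        simp add: det_3\<close>)
  have "(\<chi> i j. Z $ \<tau> i $ j) = ?Q ** Z"
    using assms[unfolded is_swap_def] by (elim disjE) (simp_all add: vec_eq_iff forall_3
        matrix_mult_nth3)
  then show "equiv_mat Z (\<chi> i j. Z $ \<tau> i $ j)" using equiv_mat_left[OF Q] by simp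
  have "(\<chi> i j. Z $ i $ \<tau> j) = Z ** ?Q"
    using assms[unfolded is_swap_def] by (elim disjE) (simp_all add: vec_eq_iff forall_3
        matrix_mult_nth3)
  then show "equiv_mat Z (\<chi> i j. Z $ i $ \<tau> j)" using equiv_mat_right[OF Q] by simp
qed

lemma pivot_to_11: "\<exists>W. equiv_mat Z W \<and> (\<forall>i j. divs (W $ 1 $ 1) (W $ i $ j))"
proof -
  have "\<exists>s\<in>UNIV. \<forall>t\<in>UNIV. divs (Z $ fst s $ snd s) (Z $ fst t $ snd t)"
    by (rule exists_divs_least) simp_all
  then obtain s where s: "\<And>t. divs (Z $ fst s $ snd s) (Z $ fst t $ snd t)" by blast
  obtain \<tau> where \<tau>: "\<tau> 1 = fst s" and t: "is_swap \<tau>" using swap_1_to by blast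
  obtain \<sigma> where \<sigma>: "\<sigma> 1 = snd s" and u: "is_swap \<sigma>" using swap_1_to by blast
  have "equiv_mat Z (\<chi> i j. Z $ \<tau> i $ \<sigma> j)"
    using equiv_mat_trans[OF equiv_mat_swap(1)[OF t, of Z] equiv_mat_swap(2)[OF u]] by simp
  moreover have "divs (Z $ fst s $ snd s) (Z $ p $ q)" for p q using s[of "(p, q)"] by simp
  ultimately show ?thesis
    by (intro exI[of _ "\<chi> i j. Z $ \<tau> i $ \<sigma> j"]) (simp add: \<tau> \<sigma>)
qed

lemma clear_row_col_1:
  assumes "\<And>i j. divs (W $ 1 $ 1) (W $ i $ j)"
  shows "\<exists>e f g h. equiv_mat W (mat3 (W $ 1 $ 1) 0 0 0 e f 0 g h)"
proof -
  let ?x = "W $ 1 $ 1"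
  obtain b2 b3 c2 c3 where b: "W $ 1 $ 2 = ?x * b2" "W $ 1 $ 3 = ?x * b3" "W $ 2 $ 1 = ?x * c2" "W
      $ 3 $ 1 = ?x * c3"
    and int: "integral_elt b2" "integral_elt b3" "integral_elt c2" "integral_elt c3"
    using assms unfolding divs_def by meson
  then obtain b2' b3' c2' c3' where G: "(b2, b2') \<in> G" "(b3, b3') \<in> G" "(c2, c2') \<in> G" "(c3, c3')
      \<in> G"
    unfolding integral_elt_def by blast
  let ?L = "mat3 1 0 0 (- c2) 1 0 (- c3) 0 1" and ?R = "mat3 1 (- b2) (- b3) 0 1 0 0 0 1"
  have "unimod ?L" "unimod ?R"
    by (rule unimod_mat3[OF one_mem zero_mem zero_mem uminus_mem[OF G(3)] one_mem zero_mem
        uminus_mem[OF G(4)] zero_mem one_mem]; simp add: det_3)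
      (rule unimod_mat3[OF one_mem uminus_mem[OF G(1)] uminus_mem[OF G(2)] zero_mem one_mem
          zero_mem zero_mem zero_mem one_mem]; simp add: det_3)
  then have "equiv_mat W (?L ** W ** ?R)" unfolding equiv_mat_def by blast
  moreover have "?L ** W ** ?R = mat3 ?x 0 0 0 ((?L ** W ** ?R) $ 2 $ 2) ((?L ** W ** ?R) $ 2 $ 3)
      0 ((?L ** W ** ?R) $ 3 $ 2) ((?L ** W ** ?R) $ 3 $ 3)"
    by (simp add: vec_eq_iff forall_3 matrix_mult_nth3 b)
  ultimately show ?thesis by metis
qed

lemma pivot_to_22:
  "\<exists>e' f' g' h'. equiv_mat (mat3 x 0 0 0 e f 0 g h) (mat3 x 0 0 0 e' f' 0 g' h') \<and>
    divs e' f' \<and> divs e' g' \<and> divs e' h'"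
proof -
  let ?Z = "mat3 x 0 0 0 e f 0 g h" and ?S = "{2, 3} \<times> {2, 3} :: (3 \<times> 3) set"
  have "\<exists>s\<in>?S. \<forall>t\<in>?S. divs (?Z $ fst s $ snd s) (?Z $ fst t $ snd t)"
    by (rule exists_divs_least) simp_all
  then obtain s where s: "s \<in> ?S" "\<And>t. t \<in> ?S \<Longrightarrow> divs (?Z $ fst s $ snd s) (?Z $ fst t $ snd t)"
    by blast
  have ne: "fst s \<noteq> 1" "snd s \<noteq> 1" using s(1) by auto
  obtain \<tau> where \<tau>: "\<tau> 2 = fst s" "\<tau> 1 = 1" "\<tau> 3 \<noteq> 1" and t: "is_swap \<tau>"
    using swap_2_to[OF ne(1)] by blast
  obtain \<sigma> where \<sigma>: "\<sigma> 2 = snd s" "\<sigma> 1 = 1" "\<sigma> 3 \<noteq> 1" and u: "is_swap \<sigma>"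
    using swap_2_to[OF ne(2)] by blast
  define W where "W = (\<chi> i j. ?Z $ \<tau> i $ \<sigma> j)"
  have "equiv_mat ?Z W"
    using equiv_mat_trans[OF equiv_mat_swap(1)[OF t, of ?Z] equiv_mat_swap(2)[OF u]] by (simp add:
        W_def)
  moreover have zero: "?Z $ 1 $ q = 0" "?Z $ q $ 1 = 0" if "q \<noteq> 1" for q
    using exhaust_3[of q] that by auto
  have "W = mat3 x 0 0 0 (W $ 2 $ 2) (W $ 2 $ 3) 0 (W $ 3 $ 2) (W $ 3 $ 3)"
    using \<tau> \<sigma> ne by (simp add: vec_eq_iff forall_3 W_def zero)
  moreover have "\<tau> 3 \<in> {2, 3}" "\<sigma> 3 \<in> {2, 3}"
    using \<tau>(3) \<sigma>(3) exhaust_3 by blast+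
  then have "divs (W $ 2 $ 2) (W $ 2 $ 3)" "divs (W $ 2 $ 2) (W $ 3 $ 2)" "divs (W $ 2 $ 2) (W $ 3
      $ 3)"
    using s(1) s(2)[of "(fst s, \<sigma> 3)"] s(2)[of "(\<tau> 3, snd s)"] s(2)[of "(\<tau> 3, \<sigma> 3)"]
    by (auto simp: W_def \<tau>(1) \<sigma>(1))
  ultimately show ?thesis by metis
qed

lemma clear_row_col_2:
  assumes "divs e f" "divs e g" "divs e h"
  shows "\<exists>h'. equiv_mat (mat3 x 0 0 0 e f 0 g h) (mat3 x 0 0 0 e 0 0 0 h') \<and> divs e h'"
proof -
  obtain b where "f = e * b" "integral_elt b" using assms(1) unfolding divs_def by blast
  moreover obtain c where "g = e * c" "integral_elt c" using assms(2) unfolding divs_def by blast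
  moreover obtain d where "h = e * d" "integral_elt d" using assms(3) unfolding divs_def by blast
  ultimately have b: "f = e * b" "g = e * c" "h = e * d" "integral_elt b" "integral_elt c"
      "integral_elt d"
    by blast+
  then obtain b' c' where G: "(b, b') \<in> G" "(c, c') \<in> G"
    unfolding integral_elt_def by blast
  let ?L = "mat3 1 0 0 0 1 0 0 (- c) 1" and ?R = "mat3 1 0 0 0 1 (- b) 0 0 1"
  let ?W = "mat3 x 0 0 0 e f 0 g h"
  have "unimod ?L" "unimod ?R"
    by (rule unimod_mat3[OF one_mem zero_mem zero_mem zero_mem one_mem zero_mem zero_mem
        uminus_mem[OF G(2)] one_mem]; simp add: det_3)
      (rule unimod_mat3[OF one_mem zero_mem zero_mem zero_mem one_mem uminus_mem[OF G(1)] zero_mem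
          zero_mem one_mem]; simp add: det_3)
  then have "equiv_mat ?W (?L ** ?W ** ?R)" unfolding equiv_mat_def by blast
  moreover have "?L ** ?W ** ?R = mat3 x 0 0 0 e 0 0 0 (e * (d + - (b * c)))"
    by (simp add: vec_eq_iff forall_3 matrix_mult_nth3 b algebra_simps)
  moreover have "integral_elt (d + - (b * c))"
    by (intro integral_add integral_mult integral_uminus b)
  then have "divs e (e * (d + - (b * c)))"
    unfolding divs_def by (intro exI[of _ "d + - (b * c)"]) simp
  ultimately show ?thesis by (intro exI[of _ "e * (d + - (b * c))"]) simp
qed

text \<open>Smith normal form over a valuation ring: divisibility is total, so a pivot dividing all
  the finitely many entries exists, and it clears its row and column. The values of \<open>b\<close>
  and \<open>b'\<close> are the gaps between consecutive weights.\<close>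

lemma cartan_decomposition:
  "\<exists>Q P x b b'. unimod Q \<and> unimod P \<and> integral_elt b \<and> integral_elt b' \<and>
    Q ** Z ** P = mat3 x 0 0 0 (x * b) 0 0 0 (x * b * b')"
proof -
  obtain W where W: "equiv_mat Z W" "\<And>i j. divs (W $ 1 $ 1) (W $ i $ j)"
    using pivot_to_11 by blast
  obtain e f g h where 1: "equiv_mat W (mat3 (W $ 1 $ 1) 0 0 0 e f 0 g h)"
    using clear_row_col_1[OF W(2)] by blast
  obtain e' f' g' h' where 2: "equiv_mat (mat3 (W $ 1 $ 1) 0 0 0 e f 0 g h) (mat3 (W $ 1 $ 1) 0 0
      0 e' f' 0 g' h')"
    "divs e' f'" "divs e' g'" "divs e' h'"
    using pivot_to_22 by blast
  obtain h'' where 3: "equiv_mat (mat3 (W $ 1 $ 1) 0 0 0 e' f' 0 g' h') (mat3 (W $ 1 $ 1) 0 0 0 e'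
      0 0 0 h'')"
    "divs e' h''"
    using clear_row_col_2[OF 2(2-4)] by blast
  have "equiv_mat W (mat3 (W $ 1 $ 1) 0 0 0 e' f' 0 g' h')"
    using equiv_mat_trans[OF 1 2(1)] .
  then have "divs (W $ 1 $ 1) (mat3 (W $ 1 $ 1) 0 0 0 e' f' 0 g' h' $ 2 $ 2)"
    by (rule divs_equiv_mat) (rule W(2))
  then obtain b where "integral_elt b" "e' = W $ 1 $ 1 * b" unfolding divs_def by auto
  moreover obtain b' where "integral_elt b'" "h'' = e' * b'" using 3(2) unfolding divs_def by auto
  moreover have "equiv_mat Z (mat3 (W $ 1 $ 1) 0 0 0 e' 0 0 0 h'')"
    using W(1) 1 2(1) 3(1) equiv_mat_trans by blast
  ultimately show ?thesis unfolding equiv_mat_def by metis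
qed

section \<open>Weights and vanishing coefficients\<close>

lemma sum_zero_mem: "(\<And>i. i \<in> A \<Longrightarrow> (f i, 0) \<in> G) \<Longrightarrow> (sum f A, 0) \<in> G"
  using sum_mem[of A f "\<lambda>_. 0"] by simp

lemma mult_zero_mem: "integral_elt x \<Longrightarrow> (y, 0) \<in> G \<Longrightarrow> (x * y, 0) \<in> G"
  unfolding integral_elt_def using mult_mem by fastforce

text \<open>Expanding the cube produces mixed products; the assumption is therefore about all
  triples and not only about cubes.\<close>

lemma cube_zero_mem:
  assumes "\<And>s. integral_elt (u s)" "\<And>s t v. (\<delta> * (c s * c t * c v), 0) \<in> G"
  shows "(\<delta> * (\<Sum>s\<in>X. u s * c s) ^ 3, 0) \<in> G"
proof -
  have "(\<delta> * (u s * c s * (u t * c t) * (u v * c v)), 0) \<in> G" for s t v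
  proof -
    have "\<delta> * (u s * c s * (u t * c t) * (u v * c v)) = (u s * u t * u v) * (\<delta> * (c s * c t * c v))"
      by (simp add: mult_ac)
    then show ?thesis
      by (simp only:) (intro mult_zero_mem integral_mult assms)
  qed
  then show ?thesis
    unfolding power3_eq_cube sum_product sum_distrib_right sum_distrib_left
    by (intro sum_zero_mem)
qed

lemma mat_rel_inv3:
  assumes "mat_rel P P'" "det P' \<noteq> 0"
  shows "mat_rel (inv3 P) (inv3 P')"
proof -
  have "mat_rel (adj3 P) (adj3 P')"
    using assms(1) unfolding mat_rel_def forall_3 adj3_def by (simp add: diff_mem mult_mem)
  then show ?thesis
    using inverse_mem[OF mat_rel_det[OF assms(1)] assms(2)]
    by (simp add: mat_rel_def inv3_def mult_mem)
qed

lemma det_nonzero_of_mat_rel: "mat_rel P P' \<Longrightarrow> det P' \<noteq> 0 \<Longrightarrow> det P \<noteq> 0"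
  using mat_rel_det zero_memD by metis

theorem exists_destabilising_basis:
  fixes a :: "'k tensor" and Z Zi :: "'l ^ 3 ^ 3"
  assumes Z: "Z ** Zi = mat 1"
  defines "c \<equiv> act Z Zi (\<lambda>i j k. \<iota> (a i j k))"
  assumes small: "\<And>s t v. (det Z * (tcoord c s * tcoord c t * tcoord c v), 0) \<in> G"
  obtains P Pi :: "'k ^ 3 ^ 3" where "P ** Pi = mat 1" "Pi ** P = mat 1"
    "fibred_shape (act Pi P a) \<or> degenerate_shape (act Pi P a)"
proof -
  obtain Q P x b b' where Q: "unimod Q" and P: "unimod P" and int: "integral_elt b" "integral_elt
      b'"
    and D: "Q ** Z ** P = mat3 x 0 0 0 (x * b) 0 0 0 (x * b * b')"
    using cartan_decomposition[of Z] by blast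
  obtain P' where P': "mat_rel P P'" "det P' \<noteq> 0" using P unfolding unimod_def by blast
  obtain Q' where Q': "mat_rel Q Q'" "det Q' \<noteq> 0" using Q unfolding unimod_def by blast
  note PPi = inv3[OF det_nonzero_of_mat_rel[OF P']] and QQi = inv3[OF det_nonzero_of_mat_rel[OF Q']]
  \<comment> \<open>The map in the coordinates given by the columns of \<open>P\<close>, still over
    \<open>'l\<close>. Its reduction \<open>a'\<close> lives over \<open>'k\<close> and is the
    tensor whose coefficients are to vanish.\<close>
  define aL where "aL = act (inv3 P) P (\<lambda>i j k. \<iota> (a i j k))"
  define a' where "a' = act (inv3 P') P' a"
  have rel: "(aL i j k, a' i j k) \<in> G" for i j k
    using P'(1) mat_rel_inv3[OF P'] unfolding aL_def a'_def act_def mat_rel_def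
    by (intro sum_mem mult_mem const_mem) auto
  define D where "D = Q ** Z ** P"
  define Di where "Di = inv3 P ** Zi ** inv3 Q"
  define d where "d i = D $ i $ i" for i
  have "D ** Di = Q ** (Z ** (P ** inv3 P) ** Zi) ** inv3 Q"
    by (simp add: D_def Di_def matrix_mul_assoc)
  then have "D ** Di = mat 1" by (simp add: PPi QQi Z)
  then have DDi: "(D ** Di) $ i $ j = (if i = j then 1 else 0)" for i j by (simp add: mat_def)
  have D_diag: "D $ i $ j = (if i = j then d i else 0)" for i j
    using exhaust_3[of i] exhaust_3[of j] by (elim disjE) (simp_all add: D_def d_def D)
  have d: "d 1 = x" "d 2 = x * b" "d 3 = x * b * b'"
    by (simp_all add: d_def D_def D)
  have dDi: "d i * Di $ i $ j = (if i = j then 1 else 0)" for i j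
    using DDi[of i j] exhaust_3[of i] by (elim disjE) (simp_all add: matrix_mult_nth3 D_diag)
  have d0: "d i \<noteq> 0" for i using dDi[of i i] by auto
  then have nz: "x \<noteq> 0" "b \<noteq> 0" "b' \<noteq> 0" using d0[of 3] by (auto simp: d)
  have Di: "Di $ i $ j = (if i = j then inverse (d i) else 0)" for i j
    using dDi[of i j] d0[of i] by (auto simp: field_simps split: if_splits)
  have detD: "det D = x * (x * b) * (x * b * b')"
    by (simp add: det_3 D_diag d)
  have "act Q (inv3 Q) c = act (D ** inv3 P) (P ** Di) (\<lambda>i j k. \<iota> (a i j k))"
  proof -
    have "D ** inv3 P = Q ** Z ** (P ** inv3 P)" "P ** Di = (P ** inv3 P) ** Zi ** inv3 Q"
      by (simp_all add: D_def Di_def matrix_mul_assoc)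
    then show ?thesis by (simp add: c_def act_act PPi)
  qed
  \<comment> \<open>\<open>Q\<close> mixes the small coefficients integrally and keeps them small.
    What remains is conjugation by the diagonal matrix \<open>D\<close>, which multiplies each
    coefficient by a single factor.\<close>
  then have "act Q (inv3 Q) c = act D Di aL" by (simp add: aL_def act_act)
  moreover have "act D Di aL i j k = d i / (d j * d k) * aL i j k" for i j k
    using exhaust_3[of i] exhaust_3[of j] exhaust_3[of k]
    by (elim disjE) (simp_all add: act_def sum_3 D_diag Di field_simps)
  ultimately have bt: "act Q (inv3 Q) c i j k = d i / (d j * d k) * aL i j k" for i j k by simp
  have intQ: "integral_elt (Q $ i $ j)" "integral_elt (inv3 Q $ i $ j)" for i j
    using Q'(1) mat_rel_inv3[OF Q'] unfolding integral_elt_def mat_rel_def by blast+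
  have small': "(det Z * (act Q (inv3 Q) c i j k) ^ 3, 0) \<in> G" for i j k
    unfolding act_eq_sum by (intro cube_zero_mem integral_mult intQ small)
  have intQP: "integral_elt (det Q * det P)"
    using mult_mem[OF mat_rel_det[OF Q'(1)] mat_rel_det[OF P'(1)]]
    unfolding integral_elt_def by blast
  have "det D = det Q * det P * det Z"
    by (simp add: D_def det_mul mult_ac)
  then have key: "(det D * (d i / (d j * d k) * aL i j k) ^ 3, 0) \<in> G" for i j k
    using mult_zero_mem[OF intQP small'[of i j k]] by (simp only: bt mult.assoc)
  \<comment> \<open>The product multiplied by \<open>w\<close> is
    \<open>det D * (d i / (d j * d k)) ^ 3\<close>. If its inverse \<open>w\<close> is integral, the
    weight is nonpositive, and \<open>aL i j k ^ 3\<close> itself has value 0.\<close>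
  have vanish: "a' i j k = 0"
    if w: "integral_elt w" "w * (x * (x * b) * (x * b * b') * (d i / (d j * d k)) ^ 3) = 1" for i
        j k w
  proof -
    have "(w * (det D * (d i / (d j * d k) * aL i j k) ^ 3), 0) \<in> G"
      using w(1) key by (rule mult_zero_mem)
    also have "w * (det D * (d i / (d j * d k) * aL i j k) ^ 3) =
        (w * (x * (x * b) * (x * b * b') * (d i / (d j * d k)) ^ 3)) * aL i j k ^ 3"
      unfolding detD power_mult_distrib by (simp only: mult_ac)
    finally have "(aL i j k ^ 3, 0) \<in> G" unfolding w(2) by simp
    then have "a' i j k ^ 3 = 0" using power_mem[OF rel] single_valued by metis
    then show ?thesis by simp
  qed
  note int_intros = integral_mult integral_power int
  \<comment> \<open>Each \<open>w\<close> below is the inverse of the weight factor, from which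
    \<open>x\<close> cancels. For this first group \<open>w\<close> is a monomial in
    \<open>b\<close> and \<open>b'\<close>, so these coefficients vanish in both cases.\<close>
  have v113: "a' 1 1 3 = 0"
    by (rule vanish[where w = "b * b' ^ 2"], intro int_intros, simp add: d nz field_simps
        eval_nat_numeral)
  have v131: "a' 1 3 1 = 0"
    by (rule vanish[where w = "b * b' ^ 2"], intro int_intros, simp add: d nz field_simps
        eval_nat_numeral)
  have v123: "a' 1 2 3 = 0"
    by (rule vanish[where w = "b ^ 4 * b' ^ 2"], intro int_intros, simp add: d nz field_simps
        eval_nat_numeral)
  have v132: "a' 1 3 2 = 0"
    by (rule vanish[where w = "b ^ 4 * b' ^ 2"], intro int_intros, simp add: d nz field_simps
        eval_nat_numeral)
  have v133: "a' 1 3 3 = 0"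
    by (rule vanish[where w = "b ^ 4 * b' ^ 5"], intro int_intros, simp add: d nz field_simps
        eval_nat_numeral)
  have v223: "a' 2 2 3 = 0"
    by (rule vanish[where w = "b * b' ^ 2"], intro int_intros, simp add: d nz field_simps
        eval_nat_numeral)
  have v232: "a' 2 3 2 = 0"
    by (rule vanish[where w = "b * b' ^ 2"], intro int_intros, simp add: d nz field_simps
        eval_nat_numeral)
  have v233: "a' 2 3 3 = 0"
    by (rule vanish[where w = "b * b' ^ 5"], intro int_intros, simp add: d nz field_simps
        eval_nat_numeral)
  have v333: "a' 3 3 3 = 0"
    by (rule vanish[where w = "b * b' ^ 2"], intro int_intros, simp add: d nz field_simps
        eval_nat_numeral)
  \<comment> \<open>\<open>b / b'\<close> is \<open>d 2 ^ 3 / det D\<close>, whose value stands for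
    the normalised middle weight; the cases are its two signs.\<close>
  have "integral_elt (b' / b) \<or> integral_elt (b / b')"
    using mem_or_inverse_mem[of "b' / b"] unfolding integral_elt_def inverse_divide by blast
  then have "fibred_shape a' \<or> degenerate_shape a'"
  proof
    assume e: "integral_elt (b' / b)"
    note int_intros = int_intros e
    have v213: "a' 2 1 3 = 0"
      by (rule vanish[where w = "(b' / b) ^ 2"], intro int_intros, simp add: d nz field_simps
          eval_nat_numeral)
    have v231: "a' 2 3 1 = 0"
      by (rule vanish[where w = "(b' / b) ^ 2"], intro int_intros, simp add: d nz field_simps
          eval_nat_numeral)
    show ?thesis
      unfolding fibred_shape_def forall_3
      by (simp add: v113 v131 v123 v132 v133 v213 v231 v223 v232 v233)
  next
    assume e: "integral_elt (b / b')"
    note int_intros = int_intros e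
    have v112: "a' 1 1 2 = 0"
      by (rule vanish[where w = "b / b'"], intro int_intros, simp add: d nz field_simps
          eval_nat_numeral)
    have v121: "a' 1 2 1 = 0"
      by (rule vanish[where w = "b / b'"], intro int_intros, simp add: d nz field_simps
          eval_nat_numeral)
    have v122: "a' 1 2 2 = 0"
      by (rule vanish[where w = "b ^ 3 * (b / b')"], intro int_intros, simp add: d nz field_simps
          eval_nat_numeral)
    have v222: "a' 2 2 2 = 0"
      by (rule vanish[where w = "b / b'"], intro int_intros, simp add: d nz field_simps
          eval_nat_numeral)
    have v323: "a' 3 2 3 = 0"
      by (rule vanish[where w = "b / b'"], intro int_intros, simp add: d nz field_simps
          eval_nat_numeral)
    have v332: "a' 3 3 2 = 0"
      by (rule vanish[where w = "b / b'"], intro int_intros, simp add: d nz field_simps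
          eval_nat_numeral)
    show ?thesis
      unfolding degenerate_shape_def forall_3
      by (simp add: v112 v121 v122 v113 v131 v123 v132 v133 v222 v223 v232 v233 v323 v332 v333)
  qed
  then show ?thesis
    using that[of P' "inv3 P'"] inv3[OF P'(2)] by (simp add: a'_def)
qed

end

section \<open>Normal forms of unstable maps\<close>

lemma lookup_0_hom: "comm_ring_hom (\<lambda>p :: ('x, 'k::comm_ring_1) mpoly. Poly_Mapping.lookup p 0)"
  unfolding lookup_0_eq_insertion by (intro comm_ring_hom_insertion comm_ring_hom_id)

lemma to_fract_generic_conj:
  fixes a :: "'k::field tensor"
  defines "Z \<equiv> map_matrix to_fract (Zm :: (nat, 'k) mpoly ^ 3 ^ 3)"
  shows "to_fract (generic_conj a i j k) = (det Z)\<^sup>2 * act Z (inv3 Z) (\<lambda>i j k. to_fract (Const (a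
      i j k))) i j k"
proof -
  have hom: "comm_ring_hom (to_fract :: (nat, 'k) mpoly \<Rightarrow> _)"
    by unfold_locales
  have "det Z \<noteq> 0"
    unfolding Z_def det_map_matrix[OF hom] using det_Zm_nonzero by simp
  then have adj: "adj3 Z = map_matrix ((*) (det Z)) (inv3 Z)"
    by (simp add: inv3_def vec_eq_iff)
  have "to_fract (generic_conj a i j k) = act Z (adj3 Z) (\<lambda>i j k. to_fract (Const (a i j k))) i j k"
    unfolding generic_conj_def act_hom[OF hom] adj3_hom[OF hom] Z_def ..
  then show ?thesis
    unfolding adj act_scale .
qed

theorem unstable_destabilising_basis:
  fixes F :: "(3, 'k::{alg_closed_field, field_char_0}) mpoly ^ 3"
  assumes F: "F \<in> form_tuples 2" and unstable: "unstable 2 F"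
  obtains P Pi :: "'k ^ 3 ^ 3" where "P ** Pi = mat 1" "Pi ** P = mat 1"
    "fibred_shape (act Pi P (coeffs3 F)) \<or> degenerate_shape (act Pi P (coeffs3 F))"
proof -
  define \<iota> :: "'k \<Rightarrow> (nat, 'k) mpoly fract" where "\<iota> c = to_fract (Const c)" for c
  let ?a = "coeffs3 F" and ?\<delta> = "to_fract (\<Delta> :: (nat, 'k) mpoly)"
  define y where "y t = to_fract (triple (generic_conj ?a) t) / ?\<delta> ^ 5" for t
  \<comment> \<open>The algebra generated over the constants by the pairs \<open>(y t, 0)\<close>: a
    place that contains it gives every \<open>y t\<close> the value 0. It avoids
    \<open>(0, 1)\<close> because no relation between the \<open>y t\<close> has constant term
    1.\<close>
  define A where "A = range (\<lambda>P :: (idx \<times> idx \<times> idx, 'k) mpoly. (insertion \<iota> y P,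
      Poly_Mapping.lookup P 0))"
  have tf: "comm_ring_hom (to_fract :: (nat, 'k) mpoly \<Rightarrow> _)"
    by unfold_locales
  have \<iota>: "comm_ring_hom \<iota>"
    by unfold_locales (simp_all add: \<iota>_def Const_add Const_mult)
  interpret \<iota>: comm_ring_hom \<iota> by (rule \<iota>)
  interpret ins: comm_ring_hom "insertion \<iota> y" by (rule comm_ring_hom_insertion[OF \<iota>])
  interpret l0: comm_ring_hom "\<lambda>p :: (idx \<times> idx \<times> idx, 'k) mpoly. Poly_Mapping.lookup p 0"
    by (rule lookup_0_hom)
  have memA: "(insertion \<iota> y P, Poly_Mapping.lookup P 0) \<in> A" for P
    unfolding A_def by blast
  have sub: "subalgebra_pairs \<iota> A"
  proof unfold_locales
    show "(\<iota> c, c) \<in> A" for c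
      using memA[of "Const c"] by (simp add: Const_def[of c] insertion_single)
  next
    fix x a z b assume "(x, a) \<in> A" "(z, b) \<in> A"
    then obtain P Q where "x = insertion \<iota> y P" "a = Poly_Mapping.lookup P 0"
      "z = insertion \<iota> y Q" "b = Poly_Mapping.lookup Q 0"
      unfolding A_def by blast
    then show "(x + z, a + b) \<in> A" "(x * z, a * b) \<in> A"
      using memA[of "P + Q"] memA[of "P * Q"]
      by (simp_all add: ins.hom_add ins.hom_mult l0.hom_add l0.hom_mult)
  qed
  have "(0, 1) \<notin> A"
  proof
    assume "(0, 1) \<in> A"
    then obtain P where P: "insertion \<iota> y P = 0" "Poly_Mapping.lookup P 0 = 1"
      unfolding A_def by force
    then have "insertion (\<lambda>c. to_fract (Const c)) (\<lambda>t. to_fract (triple (generic_conj ?a) t) / ?\<delta>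
        ^ 5) P = 0"
      unfolding \<iota>_def[abs_def] y_def[abs_def] by simp
    then show False using unstable_no_relation[OF F unstable] P(2) by force
  qed
  then obtain G where AG: "A \<subseteq> G" and "maximal_pairs \<iota> G"
    using maximal_pairs_exists[OF sub] by blast
  then interpret maximal_pairs \<iota> G by simp
  define Z where "Z = map_matrix to_fract (Zm :: (nat, 'k) mpoly ^ 3 ^ 3)"
  have detZ: "det Z = ?\<delta>" unfolding Z_def by (rule det_map_matrix[OF tf])
  then have \<delta>: "?\<delta> \<noteq> 0" "det Z \<noteq> 0" using det_Zm_nonzero by simp_all
  let ?c = "act Z (inv3 Z) (\<lambda>i j k. \<iota> (?a i j k))"
  have generic_conj: "to_fract (tcoord (generic_conj ?a) s) = ?\<delta>\<^sup>2 * tcoord ?c s" for s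
  proof -
    obtain i j k where "s = (i, j, k)" by (rule prod_cases3)
    then show ?thesis using to_fract_generic_conj[of ?a i j k] by (simp add: \<iota>_def
        Z_def[symmetric] detZ)
  qed
  have small: "(det Z * (tcoord ?c s * tcoord ?c t * tcoord ?c v), 0) \<in> G" for s t v
  proof -
    have "y (s, t, v) = det Z * (tcoord ?c s * tcoord ?c t * tcoord ?c v)"
      using \<delta> by (simp add: y_def generic_conj detZ to_fract_hom.hom_mult field_simps
          eval_nat_numeral)
    moreover have "(y (s, t, v), 0) \<in> A"
      using memA[of "Var (s, t, v)"] by (simp add: lookup_0_eq_insertion)
    ultimately show ?thesis using AG by auto
  qed
  obtain P Pi :: "'k ^ 3 ^ 3" where "P ** Pi = mat 1" "Pi ** P = mat 1"
    "fibred_shape (act Pi P ?a) \<or> degenerate_shape (act Pi P ?a)"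
    by (rule exists_destabilising_basis[OF inv3(1)[OF \<delta>(2)] small])
  then show ?thesis by (rule that)
qed

lemma insertion_insertion:
  assumes "comm_ring_hom c"
  shows "insertion c x (insertion Const f p) = insertion c (\<lambda>i. insertion c x (f i)) (p :: ('x,
      'k::comm_ring_1) mpoly)"
proof -
  interpret c: comm_ring_hom c by fact
  interpret i1: comm_ring_hom "insertion c x" by (rule comm_ring_hom_insertion) fact
  interpret i2: comm_ring_hom "insertion Const f" by (intro comm_ring_hom_insertion
      comm_ring_hom_Const)
  interpret i3: comm_ring_hom "insertion c (\<lambda>i. insertion c x (f i))" by (rule
      comm_ring_hom_insertion) fact
  show ?thesis
    by (induction p rule: mpoly_induct)
      (simp_all add: i1.hom_add i1.hom_mult i2.hom_add i2.hom_mult i3.hom_add i3.hom_mult)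
qed

lemma insertion_Const_Var: "insertion Const Var p = (p :: ('x, 'k::comm_ring_1) mpoly)"
proof -
  interpret comm_ring_hom "insertion Const Var :: ('x, 'k) mpoly \<Rightarrow> _"
    by (intro comm_ring_hom_insertion comm_ring_hom_Const)
  show ?thesis by (induction p rule: mpoly_induct) (simp_all add: hom_add hom_mult)
qed

lemma comp_tuple_nth: "(H \<circ>\<^sub>t F) $ i = insertion Const (\<lambda>j. F $ j) (H $ i)"
  by (simp add: comp_tuple_def)

lemma matrix_tuple_nth: "matrix_tuple A $ i = (\<Sum>j\<in>UNIV. Const (A $ i $ j) * Var j)"
  by (simp add: matrix_tuple_def)

lemma matrix_tuple_subst:
  fixes A B :: "'k::comm_ring_1 ^ 3 ^ 3"
  assumes "A ** B = mat 1"
  shows "insertion Const (\<lambda>j. matrix_tuple B $ j) (matrix_tuple A $ i) = Var i"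
proof -
  interpret C: comm_ring_hom "Const :: 'k \<Rightarrow> (3, 'k) mpoly" by (rule comm_ring_hom_Const)
  have "(\<Sum>j\<in>UNIV. Const (A $ i $ j) * matrix_tuple B $ j) = (\<Sum>j\<in>UNIV. Const ((A ** B) $ i $ j) *
      Var j)"
    by (simp add: matrix_tuple_nth matrix_mult_nth3 sum_3 Const_add Const_mult algebra_simps)
  also have "\<dots> = Var i"
    unfolding assms using exhaust_3[of i] by (elim disjE) (simp_all add: mat_def sum_3)
  finally show ?thesis
    by (simp add: insertion_matrix_tuple comm_ring_hom_Const)
qed

text \<open>The values of the composite are the values of \<open>H\<close> on the image of
  \<open>F\<close>. If the composite is 0, then \<open>H\<close> vanishes there, and dominance gives
  \<open>H = 0\<close>.\<close>

lemma comp_nonzero: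
  fixes F :: "('n::finite, 'k::comm_ring_1) mpoly ^ 'm::finite"
  assumes dom: "dominant F" and H: "homogeneous e H" "H \<noteq> 0"
  shows "insertion Const (\<lambda>j. F $ j) H \<noteq> 0"
proof
  assume 0: "insertion Const (\<lambda>j. F $ j) H = 0"
  have "insertion (\<lambda>a. a) (\<lambda>i. eval_tuple F x $ i) H = 0" for x
    using insertion_insertion[OF comm_ring_hom_id, of "\<lambda>j. x $ j" "\<lambda>j. F $ j" H]
    by (simp add: 0 eval_tuple_def insertion_altdef[of _ _ 0])
  then have "H = 0" using dom H(1) unfolding dominant_def by blast
  then show False using H(2) by simp
qed

text \<open>\<open>y\<close> are the linear forms of the new coordinates and \<open>h\<close> the
  components of \<open>F\<close> in them, both written in the original variables. The shape of
  \<open>a'\<close> can thus be used without replacing \<open>F\<close> by a conjugate.\<close>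

context
  fixes F :: "(3, 'k::field_char_0) mpoly ^ 3" and P Pi :: "'k ^ 3 ^ 3" and a' :: "'k tensor"
    and y h :: "3 \<Rightarrow> (3, 'k) mpoly"
  assumes F: "F \<in> form_tuples 2" and PPi: "P ** Pi = mat 1" "Pi ** P = mat 1"
    and a': "a' = act Pi P (coeffs3 F)"
    and y: "\<And>i. y i = matrix_tuple Pi $ i"
    and h: "\<And>i. h i = insertion Const (\<lambda>j. F $ j) (y i)"
begin

text \<open>Conjugation by \<open>Pi\<close> yields \<open>h i\<close> with \<open>P\<close>
  substituted for the variables; substituting \<open>y\<close> afterwards undoes this.\<close>

lemma new_coordinates: "h i = (\<Sum>j\<in>UNIV. \<Sum>k\<in>UNIV. Const (a' i j k) * (y j * y k))"
proof -
  have inv: "matrix_inv Pi = P" by (rule matrix_inv_eqI) (rule PPi)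
  have "quad_map a' $ i = conj_action Pi F $ i"
    using conj_action_quad_map[of Pi "coeffs3 F"] by (simp add: a' inv quad_map_coeffs3[OF F])
  also have "\<dots> = insertion Const (\<lambda>j. matrix_tuple P $ j) (h i)"
    by (simp add: conj_action_def comp_tuple_nth inv h y)
  finally have "insertion Const y (quad_map a' $ i) = insertion Const (\<lambda>i. insertion Const y
      (matrix_tuple P $ i)) (h i)"
    by (simp add: insertion_insertion comm_ring_hom_Const)
  also have "(\<lambda>i. insertion Const y (matrix_tuple P $ i)) = Var"
    using matrix_tuple_subst[OF PPi(1)] by (simp add: y[abs_def])
  finally show ?thesis
    by (simp add: insertion_quad_map comm_ring_hom_Const insertion_Const_Var)
qed

lemma old_coordinates: "F $ i = (\<Sum>p\<in>UNIV. Const (P $ i $ p) * h p)"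
proof -
  interpret comm_ring_hom "insertion Const x :: (3, 'k) mpoly \<Rightarrow> (3, 'k) mpoly" for x
    by (intro comm_ring_hom_insertion comm_ring_hom_Const)
  have "F $ i = insertion Const (\<lambda>j. F $ j) (insertion Const y (matrix_tuple P $ i))"
    using matrix_tuple_subst[OF PPi(1), of i] by (simp add: y[abs_def])
  also have "insertion Const y (matrix_tuple P $ i) = (\<Sum>p\<in>UNIV. Const (P $ i $ p) * y p)"
    by (simp add: insertion_matrix_tuple comm_ring_hom_Const)
  finally show ?thesis by (simp add: hom_sum hom_mult h)
qed

lemma homogeneous_y: "homogeneous 1 (y i)"
  unfolding y matrix_tuple_nth by (intro homogeneous_sum homogeneous_Const_mult homogeneous_Var)

lemma homogeneous_h: "homogeneous 2 (h i)"
proof -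
  have "homogeneous 2 (y j * y k)" for j k
    using homogeneous_mult[OF homogeneous_y homogeneous_y] by (simp add: numeral_2_eq_2)
  then show ?thesis
    unfolding new_coordinates by (intro homogeneous_sum homogeneous_Const_mult)
qed

lemma y_independent:
  assumes "Const a * y 1 + Const b * y 2 = 0"
  shows "a = 0 \<and> b = 0"
proof -
  let ?s = "insertion Const (\<lambda>j. matrix_tuple P $ j) :: (3, 'k) mpoly \<Rightarrow> (3, 'k) mpoly"
  interpret comm_ring_hom ?s
    by (intro comm_ring_hom_insertion comm_ring_hom_Const)
  have "?s (Const a * y 1 + Const b * y 2) = Const a * Var 1 + Const b * Var 2"
    by (simp add: hom_add hom_mult y matrix_tuple_subst[OF PPi(2)])
  then have "Const a * Var 1 + Const b * Var 2 = (0 :: (3, 'k) mpoly)"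
    using assms by simp
  then have l: "Poly_Mapping.lookup (Const a * Var 1 + Const b * Var 2 :: (3, 'k) mpoly)
      (Poly_Mapping.single i 1) = 0" for i
    by simp
  have ne: "Poly_Mapping.single (1::3) (Suc 0) \<noteq> Poly_Mapping.single 2 (Suc 0)"
    by (auto dest!: arg_cong[of _ _ "\<lambda>m. Poly_Mapping.lookup m 1"] simp: lookup_single)
  show ?thesis
    using l[of 1] l[of 2] ne ne[symmetric]
    by (simp add: Const_def Var_def mult_single lookup_add lookup_single when_def)
qed

text \<open>\<open>h 1\<close> and \<open>h 2\<close> are quadratic forms in \<open>y 1\<close> and
  \<open>y 2\<close> alone, so the projection \<open>[y 1 : y 2]\<close> carries \<open>F\<close> to
  the map \<open>H\<close> given by these forms. Dominance ensures that the composite is a nonzero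
  tuple, as \<open>same_ratmap\<close> demands.\<close>

lemma factors_of_fibred_shape:
  assumes shape: "fibred_shape a'" and dom: "dominant F"
  shows "factors_through_linear_projection F"
proof -
  define emb :: "2 \<Rightarrow> 3" where "emb i = (if i = 1 then 1 else 2)" for i
  define \<pi> :: "(3, 'k) mpoly ^ 2" where "\<pi> = (\<chi> i. y (emb i))"
  define H :: "(2, 'k) mpoly ^ 2"
    where "H = (\<chi> i. \<Sum>j\<in>UNIV. \<Sum>k\<in>UNIV. Const (a' (emb i) (emb j) (emb k)) * (Var j * Var k))"
  interpret ins: comm_ring_hom "insertion Const x :: (2, 'k) mpoly \<Rightarrow> (3, 'k) mpoly" for x
    by (intro comm_ring_hom_insertion comm_ring_hom_Const)
  have emb: "emb 1 = 1" "emb 2 = 2" by (simp_all add: emb_def)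
  have H\<pi>: "(H \<circ>\<^sub>t \<pi>) $ i = h (emb i)" for i
  proof -
    have "(H \<circ>\<^sub>t \<pi>) $ i = (\<Sum>j\<in>UNIV. \<Sum>k\<in>UNIV. Const (a' (emb i) (emb j) (emb k)) * (y (emb j) * y
        (emb k)))"
      by (simp add: comp_tuple_nth H_def \<pi>_def ins.hom_sum ins.hom_mult)
    also have "\<dots> = h (emb i)"
      using shape unfolding new_coordinates sum_2 sum_3 emb fibred_shape_def
      by (cases "i = 1") (simp_all add: emb_def)
    finally show ?thesis .
  qed
  moreover have "(\<pi> \<circ>\<^sub>t F) $ i = h (emb i)" for i
    unfolding comp_tuple_nth \<pi>_def vec_lambda_beta h ..
  ultimately have eq: "\<pi> \<circ>\<^sub>t F = H \<circ>\<^sub>t \<pi>"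
    by (simp add: vec_eq_iff)
  have "y 1 \<noteq> 0"
    using y_independent[of 1 0] by auto
  then have "h 1 \<noteq> 0"
    unfolding h using comp_nonzero[OF dom homogeneous_y] by blast
  then have nz: "\<pi> \<circ>\<^sub>t F \<noteq> 0"
    using H\<pi>[of 1] eq by (auto simp: emb)
  have "H \<noteq> 0"
  proof
    assume "H = 0"
    then have "H \<circ>\<^sub>t \<pi> = 0" by (simp add: vec_eq_iff comp_tuple_nth)
    with nz eq show False by simp
  qed
  moreover have "homogeneous 2 (H $ i)" for i
  proof -
    have "homogeneous 2 (Var j * Var k :: (2, 'k) mpoly)" for j k :: 2
      using homogeneous_mult[OF homogeneous_Var homogeneous_Var] by (simp add: numeral_2_eq_2)
    then show ?thesis
      unfolding H_def vec_lambda_beta by (intro homogeneous_sum homogeneous_Const_mult)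
  qed
  ultimately have "ratmap_rep 2 H" by (simp add: ratmap_rep_def)
  moreover have "same_ratmap (\<pi> \<circ>\<^sub>t F) (H \<circ>\<^sub>t \<pi>)"
    using nz unfolding eq[symmetric] same_ratmap_def by (simp add: mult.commute)
  moreover have "linear_projection \<pi>"
    unfolding linear_projection_def using y_independent homogeneous_y
    by (simp add: \<pi>_def emb)
  ultimately show ?thesis
    unfolding factors_through_linear_projection_def by blast
qed

text \<open>\<open>h 1\<close> is a multiple of \<open>y 1 ^ 2\<close>, and \<open>y 1\<close>
  divides \<open>h 2\<close>. In the new coordinates each component of the second iterate is a sum
  of multiples of \<open>h 1\<close> and of \<open>h 2 ^ 2\<close>, so \<open>y 1 ^ 2\<close> splits
  off and the degree drops from 4 to 2.\<close>

lemma square_divides_of_degenerate_shape: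
  assumes shape: "degenerate_shape a'"
  shows "\<exists>W :: (3, 'k) mpoly ^ 3. (\<forall>i. homogeneous 2 (W $ i)) \<and> (\<forall>i. (F \<circ>\<^sub>t F) $ i = (y 1)\<^sup>2 * W $
      i)"
proof -
  interpret ins: comm_ring_hom "insertion Const x :: (3, 'k) mpoly \<Rightarrow> (3, 'k) mpoly" for x
    by (intro comm_ring_hom_insertion comm_ring_hom_Const)
  define lin where "lin p v = Const (a' p 1 1) * v 1 + Const (a' p 1 2 + a' p 2 1) * v 2
    + Const (a' p 1 3 + a' p 3 1) * v 3" for p and v :: "3 \<Rightarrow> (3, 'k) mpoly"
  let ?c = "Const (a' 1 1 1) :: (3, 'k) mpoly"
  have zero: "a' 1 1 2 = 0" "a' 1 2 1 = 0" "a' 1 1 3 = 0" "a' 1 3 1 = 0" "a' 1 2 2 = 0" "a' 1 2 3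
      = 0"
    "a' 1 3 2 = 0" "a' 1 3 3 = 0" "a' 2 2 2 = 0" "a' 2 2 3 = 0" "a' 2 3 2 = 0" "a' 2 3 3 = 0"
    "a' 3 2 3 = 0" "a' 3 3 2 = 0" "a' 3 3 3 = 0"
    using shape by (simp_all add: degenerate_shape_def)
  define q where "q p v = (\<Sum>j\<in>UNIV. \<Sum>k\<in>UNIV. Const (a' p j k) * (v j * v k))"
    for p and v :: "3 \<Rightarrow> (3, 'k) mpoly"
  have q1: "q 1 v = ?c * (v 1)\<^sup>2" and q2: "q 2 v = v 1 * lin 2 v"
    and q3: "q 3 v = v 1 * lin 3 v + Const (a' 3 2 2) * (v 2)\<^sup>2" for v
    by (simp_all add: q_def sum_3 zero lin_def Const_add power2_eq_square algebra_simps)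
  have h': "h p = q p y" for p unfolding q_def by (rule new_coordinates)
  have hh: "insertion Const (\<lambda>j. F $ j) (h p) = q p h" for p
    by (simp add: h' q_def ins.hom_sum ins.hom_mult flip: h)
  \<comment> \<open>The three quotients by \<open>(y 1)\<^sup>2\<close>, in the new
    coordinates.\<close>
  define w :: "3 \<Rightarrow> (3, 'k) mpoly" where "w p = (if p = 1 then ?c * (?c * h 1) else if p = 2 then
      ?c * lin 2 h
    else ?c * lin 3 h + Const (a' 3 2 2) * (lin 2 y)\<^sup>2)" for p
  have "q 1 h = (y 1)\<^sup>2 * w 1"
    unfolding q1 w_def h'[of 1] by (simp add: power2_eq_square algebra_simps)
  moreover have "q 2 h = (y 1)\<^sup>2 * w 2"
    unfolding q2 h'[of 1] q1 by (simp add: w_def algebra_simps)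
  moreover have "q 3 h = (y 1)\<^sup>2 * w 3"
    unfolding q3 h'[of 1] h'[of 2] q1 q2 by (simp add: w_def power_mult_distrib algebra_simps)
  ultimately have qw: "q p h = (y 1)\<^sup>2 * w p" for p
    using exhaust_3[of p] by auto
  define W :: "(3, 'k) mpoly ^ 3" where "W = (\<chi> i. \<Sum>p\<in>UNIV. Const (P $ i $ p) * w p)"
  have "(F \<circ>\<^sub>t F) $ i = (y 1)\<^sup>2 * W $ i" for i
    unfolding comp_tuple_nth old_coordinates[of i]
    by (simp add: ins.hom_sum ins.hom_mult hh qw W_def sum_distrib_left mult.left_commute)
  moreover have "homogeneous 2 (W $ i)" for i
  proof -
    have "homogeneous 1 (lin p y)" for p
      unfolding lin_def by (intro homogeneous_add homogeneous_Const_mult homogeneous_y)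
    then have "homogeneous 2 ((lin p y)\<^sup>2)" for p
      using homogeneous_power[of 1 "lin p y" 2] by simp
    moreover have "homogeneous 2 (lin p h)" for p
      unfolding lin_def by (intro homogeneous_add homogeneous_Const_mult homogeneous_h)
    ultimately have "homogeneous 2 (w p)" for p
      unfolding w_def by (auto intro!: homogeneous_add homogeneous_Const_mult homogeneous_h)
    then show ?thesis
      unfolding W_def vec_lambda_beta by (intro homogeneous_sum homogeneous_Const_mult)
  qed
  ultimately show ?thesis by blast
qed

end

section \<open>The degree of a rational map\<close>

text \<open>Over a domain both the lowest and the highest exponent are additive. They agree for the
  product, hence for each factor.\<close>

lemma monom_mult_eq_monomD:
  fixes p q :: "'a::idom poly"
  assumes "p * q = monom c n" "c \<noteq> 0"
  shows "\<exists>a i. p = monom a i"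
proof -
  have nz: "p \<noteq> 0" "q \<noteq> 0" using assms by auto
  define lo where "lo p = (LEAST i. coeff p i \<noteq> 0)" for p :: "'a poly"
  have lo: "coeff p (lo p) \<noteq> 0" "\<And>i. i < lo p \<Longrightarrow> coeff p i = 0" if p0: "p \<noteq> 0" for p
  proof -
    obtain i where "coeff p i \<noteq> 0" using p0 by (metis leading_coeff_0_iff)
    then show "coeff p (lo p) \<noteq> 0" unfolding lo_def by (rule LeastI)
    show "coeff p i = 0" if "i < lo p" for i
      using not_less_Least[of i "\<lambda>i. coeff p i \<noteq> 0"] that by (simp add: lo_def)
  qed
  have "coeff (p * q) (lo p + lo q) = (\<Sum>i\<le>lo p + lo q. if i = lo p then coeff p (lo p) * coeff q
      (lo q) else 0)"
    unfolding coeff_mult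
  proof (rule sum.cong[OF refl])
    fix i assume i: "i \<in> {..lo p + lo q}"
    consider "i < lo p" | "i = lo p" | "lo p + lo q - i < lo q" using i by fastforce
    then show "coeff p i * coeff q (lo p + lo q - i) = (if i = lo p then coeff p (lo p) * coeff q
        (lo q) else 0)"
      using lo(2)[OF nz(1)] lo(2)[OF nz(2)] by cases auto
  qed
  then have "coeff (monom c n) (lo p + lo q) \<noteq> 0"
    using lo(1)[OF nz(1)] lo(1)[OF nz(2)] assms(1) by simp
  then have low: "lo p + lo q = n" by (auto split: if_splits)
  have high: "degree p + degree q = n"
    using degree_mult_eq[OF nz] assms by (simp add: degree_monom_eq)
  have "lo p \<le> degree p" "lo q \<le> degree q"
    using lo(1)[OF nz(1)] lo(1)[OF nz(2)] by (auto intro: le_degree)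
  then have "lo p = degree p" using low high by linarith
  then have "p = monom (lead_coeff p) (degree p)"
    using lo(2)[OF nz(1)] by (intro poly_eqI) (auto simp: coeff_eq_0 nat_neq_iff)
  then show ?thesis by blast
qed

text \<open>The substitution \<open>x\<^sub>i \<mapsto> t x\<^sub>i\<close>: a polynomial is a form of degree \<open>d\<close> exactly if its image is
  \<open>t\<^sup>d\<close> times the polynomial.\<close>

definition grading :: "('x, 'k::comm_ring_1) mpoly \<Rightarrow> ('x, 'k) mpoly poly"
  where "grading = insertion (\<lambda>c. [:Const c:]) (\<lambda>i. monom (Var i) 1)"

lemma comm_ring_hom_grading: "comm_ring_hom (grading :: ('x, 'k::comm_ring_1) mpoly \<Rightarrow> _)"
proof -
  have "comm_ring_hom (\<lambda>c::'k. [:Const c :: ('x, 'k) mpoly:])"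
    by unfold_locales (simp_all add: Const_add Const_mult)
  then show ?thesis unfolding grading_def by (rule comm_ring_hom_insertion)
qed

lemma mon_eval_monom_Var: "mon_eval (\<lambda>i. monom (Var i) 1) m = monom (mon_eval Var m :: ('x,
    'k::comm_ring_1) mpoly) (monom_deg m)"
proof -
  have "(\<Prod>i\<in>S. monom (Var i :: ('x, 'k) mpoly) 1 ^ f i) = monom (\<Prod>i\<in>S. Var i ^ f i) (\<Sum>i\<in>S. f i)"
      for S f
    by (induction S rule: infinite_finite_induct) (simp_all add: monom_power mult_monom)
  then show ?thesis by (simp add: mon_eval_def monom_deg_def)
qed

lemma grading_single: "grading (Poly_Mapping.single m c) = monom (Poly_Mapping.single m c)
    (monom_deg m)"
proof -
  have "grading (Poly_Mapping.single m c) = [:Const c:] * mon_eval (\<lambda>i. monom (Var i) 1) m"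
    unfolding grading_def by (rule insertion_single) simp
  also have "\<dots> = monom (Const c * mon_eval Var m) (monom_deg m)"
    unfolding mon_eval_monom_Var by (simp add: smult_monom)
  finally show ?thesis unfolding single_eq_Const_mult[of m c] .
qed

lemma grading_altdef:
  "grading p = (\<Sum>m\<in>Poly_Mapping.keys p. monom (Poly_Mapping.single m (Poly_Mapping.lookup p m))
      (monom_deg m))"
proof -
  interpret comm_ring_hom "grading :: ('a, 'b) mpoly \<Rightarrow> _" by (rule comm_ring_hom_grading)
  have "grading (\<Sum>m\<in>Poly_Mapping.keys p. Poly_Mapping.single m (Poly_Mapping.lookup p m)) =
      (\<Sum>m\<in>Poly_Mapping.keys p. monom (Poly_Mapping.single m (Poly_Mapping.lookup p m)) (monom_deg
          m))"
    by (simp add: hom_sum grading_single)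
  then show ?thesis by (simp only: poly_mapping_eq_sum_single)
qed

lemma grading_homogeneous: "homogeneous d p \<Longrightarrow> grading p = monom p d"
proof -
  assume "homogeneous d p"
  then have "grading p = (\<Sum>m\<in>Poly_Mapping.keys p. monom (Poly_Mapping.single m
      (Poly_Mapping.lookup p m)) d)"
    unfolding grading_altdef by (intro sum.cong) (auto simp: homogeneous_def)
  also have "\<dots> = monom (\<Sum>m\<in>Poly_Mapping.keys p. Poly_Mapping.single m (Poly_Mapping.lookup p m)) d"
    by (intro poly_eqI) (simp add: coeff_sum)
  finally show ?thesis by (simp only: poly_mapping_eq_sum_single)
qed

lemma homogeneous_of_grading:
  fixes p :: "('x, 'k::comm_ring_1) mpoly"
  assumes "grading p = monom a d"
  shows "homogeneous d p"
  unfolding homogeneous_def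
proof
  fix m assume m: "m \<in> Poly_Mapping.keys p"
  let ?e = "monom_deg m"
  have coeff: "coeff (grading p) ?e = (\<Sum>n\<in>Poly_Mapping.keys p. if monom_deg n = ?e then
      Poly_Mapping.single n (Poly_Mapping.lookup p n) else 0)"
    unfolding grading_altdef by (simp add: coeff_sum)
  have "Poly_Mapping.lookup (coeff (grading p) ?e) m =
      (\<Sum>n\<in>Poly_Mapping.keys p. if n = m then Poly_Mapping.lookup p m else 0)"
    unfolding coeff lookup_sum by (rule sum.cong) (simp_all add: lookup_single when_def)
  also have "\<dots> = Poly_Mapping.lookup p m" using m by simp
  also have "\<dots> \<noteq> 0" using m by (simp add: in_keys_iff)
  finally show "?e = d" unfolding assms by (auto split: if_splits)
qed

text \<open>\<open>grading\<close> is multiplicative, so the images of \<open>p\<close> and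
  \<open>q\<close> multiply to a monomial in the auxiliary variable and are themselves
  monomials.\<close>

lemma homogeneous_factor:
  fixes p q :: "('x::linorder, 'k::idom) mpoly"
  assumes "homogeneous d (p * q)" "p * q \<noteq> 0"
  shows "\<exists>e. homogeneous e p"
proof -
  interpret comm_ring_hom "grading :: ('x, 'k) mpoly \<Rightarrow> _" by (rule comm_ring_hom_grading)
  have "grading p * grading q = monom (p * q) d"
    using grading_homogeneous[OF assms(1)] by (simp add: hom_mult)
  then show ?thesis
    using monom_mult_eq_monomD assms(2) homogeneous_of_grading by blast
qed

lemma homogeneous_degree_unique: "homogeneous d p \<Longrightarrow> homogeneous e p \<Longrightarrow> p \<noteq> 0 \<Longrightarrow> d = e"
  unfolding homogeneous_def by (metis ex_in_conv keys_eq_empty)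


lemma homogeneous_0_eq_Const: "homogeneous 0 p \<Longrightarrow> p = Const (Poly_Mapping.lookup p 0)"
  by (intro poly_mapping_eqI)
    (auto simp: homogeneous_def monom_deg_0_iff Const_def lookup_single when_def in_keys_iff)

text \<open>The primes of \<open>x\<close> are cancelled one at a time: a prime dividing every
  \<open>z j\<close> would be a unit, so it misses some \<open>z j\<close> and must divide
  \<open>y\<close>.\<close>

lemma ufd_dvd_of_dvd_mult:
  fixes x y :: "'a::ufd" and z :: "'b \<Rightarrow> 'a"
  assumes x: "x \<noteq> 0" and dvd: "\<And>j. x dvd y * z j" and coprime: "\<And>p. (\<And>j. p dvd z j) \<Longrightarrow> p dvd 1"
  shows "x dvd y"
proof (cases "x dvd 1")
  case True
  then show ?thesis using dvd_trans one_dvd by blast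
next
  case False
  have "\<forall>f\<in>#F. prime_elem f \<Longrightarrow> (\<And>j. prod_mset F dvd y * z j) \<Longrightarrow> prod_mset F dvd y" for F
  proof (induction F arbitrary: y)
    case (add p F)
    have p: "prime_elem p" using add.prems by simp
    then have "\<not> p dvd 1" "p \<noteq> 0" by (auto simp: prime_elem_def)
    then obtain j where j: "\<not> p dvd z j" using coprime by blast
    have "p dvd y * z j"
      using dvd_mult_left[of p "prod_mset F"] add.prems(2)[of j] by simp
    then have "p dvd y" using prime_elem_dvd_multD[OF p] j by blast
    then obtain y' where y': "y = p * y'" by (rule dvdE)
    have dvd': "prod_mset F dvd y' * z j" for j
    proof -
      have "p * prod_mset F dvd p * (y' * z j)"
        using add.prems(2)[of j] unfolding y' mult.assoc prod_mset.add_mset .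
      then show ?thesis using \<open>p \<noteq> 0\<close> unfolding dvd_mult_cancel_left by blast
    qed
    have "\<forall>f\<in>#F. prime_elem f" using add.prems(1) by simp
    then have "prod_mset F dvd y'" using dvd' by (rule add.IH)
    then show ?case unfolding y' prod_mset.add_mset by (rule mult_dvd_mono[OF dvd_refl])
  qed simp
  moreover obtain F where "mset_factors F x"
    using mset_factors_exist x False by blast
  ultimately show ?thesis
    using dvd by (auto simp: mset_factors_def)
qed

lemma comm_ring_hom_comp:
  assumes "comm_ring_hom f" "comm_ring_hom g"
  shows "comm_ring_hom (\<lambda>x. f (g x))"
proof -
  interpret f: comm_ring_hom f by fact
  interpret g: comm_ring_hom g by fact
  show ?thesis by unfold_locales (simp_all add: f.hom_add f.hom_mult g.hom_add g.hom_mult)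
qed

lemma comm_ring_hom_poly_map_poly:
  assumes "comm_ring_hom h"
  shows "comm_ring_hom (\<lambda>p. poly (map_poly h p) v)"
proof -
  interpret h: comm_ring_hom h by fact
  interpret map_poly_comm_ring_hom h ..
  show ?thesis by unfold_locales (simp_all add: hom_distribs)
qed

lemma comm_ring_hom_pconst: "comm_ring_hom (\<lambda>c::'a::comm_ring_1. [:c:])"
  by unfold_locales simp_all

lemma poly_hom_eqI:
  fixes f g :: "'a::comm_ring_1 poly \<Rightarrow> 'b::comm_ring_1"
  assumes "comm_ring_hom f" "comm_ring_hom g" "\<And>c. f [:c:] = g [:c:]" "f [:0, 1:] = g [:0, 1:]"
  shows "f p = g p"
proof -
  interpret f: comm_ring_hom f by fact
  interpret g: comm_ring_hom g by fact
  show ?thesis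
  proof (induction p)
    case (pCons a p)
    have "pCons a p = [:a:] + [:0, 1:] * p" by simp
    then show ?case
      using pCons.IH assms(3,4) by (metis f.hom_add f.hom_mult g.hom_add g.hom_mult)
  qed simp
qed

text \<open>Iterated univariate polynomials over a field form a \<open>ufd\<close>; this isomorphism
  carries the consequence back. \<open>Var 1\<close> is innermost, and the inverse consists of three
  nested evaluations.\<close>

definition to_poly3 :: "(3, 'k::field) mpoly \<Rightarrow> 'k poly poly poly"
  where "to_poly3 = insertion (\<lambda>c. [:[:[:c:]:]:])
    (\<lambda>i. if i = 1 then [:[:[:0, 1:]:]:] else if i = 2 then [:[:0, 1:]:] else [:0, 1:])"

definition of_poly1 :: "'k::field poly \<Rightarrow> (3, 'k) mpoly"
  where "of_poly1 p = poly (map_poly Const p) (Var 1)"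

definition of_poly2 :: "'k::field poly poly \<Rightarrow> (3, 'k) mpoly"
  where "of_poly2 p = poly (map_poly of_poly1 p) (Var 2)"

definition of_poly3 :: "'k::field poly poly poly \<Rightarrow> (3, 'k) mpoly"
  where "of_poly3 p = poly (map_poly of_poly2 p) (Var 3)"

lemma comm_ring_hom_of_poly:
  "comm_ring_hom of_poly1" "comm_ring_hom of_poly2" "comm_ring_hom of_poly3"
proof -
  show 1: "comm_ring_hom of_poly1"
    unfolding of_poly1_def[abs_def] by (intro comm_ring_hom_poly_map_poly comm_ring_hom_Const)
  show 2: "comm_ring_hom of_poly2"
    unfolding of_poly2_def[abs_def] by (intro comm_ring_hom_poly_map_poly 1)
  show "comm_ring_hom of_poly3"
    unfolding of_poly3_def[abs_def] by (intro comm_ring_hom_poly_map_poly 2)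
qed

lemma const3_hom: "comm_ring_hom (\<lambda>c::'k::field. [:[:[:c:]:]:])"
  by unfold_locales simp_all

lemma comm_ring_hom_to_poly3: "comm_ring_hom (to_poly3 :: (3, 'k::field) mpoly \<Rightarrow> _)"
  unfolding to_poly3_def by (intro comm_ring_hom_insertion const3_hom)

lemma to_poly3_Const [simp]: "to_poly3 (Const c) = [:[:[:c:]:]:]"
  and to_poly3_Var [simp]: "to_poly3 (Var 1) = [:[:pCons 0 1:]:]" "to_poly3 (Var 2) = [:pCons 0 1:]"
    "to_poly3 (Var 3) = pCons 0 1"
  by (simp_all add: to_poly3_def)

interpretation of_poly1: comm_ring_hom of_poly1 by (rule comm_ring_hom_of_poly)
interpretation of_poly2: comm_ring_hom of_poly2 by (rule comm_ring_hom_of_poly)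
interpretation of_poly3: comm_ring_hom of_poly3 by (rule comm_ring_hom_of_poly)

lemma of_poly_pCons [simp]:
  "of_poly1 (pCons c r) = Const c + Var 1 * of_poly1 r"
  "of_poly2 (pCons r q) = of_poly1 r + Var 2 * of_poly2 q"
  "of_poly3 (pCons q p) = of_poly2 q + Var 3 * of_poly3 p"
proof -
  interpret C: comm_ring_hom "Const :: 'a \<Rightarrow> (3, 'a) mpoly" by (rule comm_ring_hom_Const)
  show "of_poly1 (pCons c r) = Const c + Var 1 * of_poly1 r"
    unfolding of_poly1_def C.map_poly_pCons_hom by simp
  show "of_poly2 (pCons r q) = of_poly1 r + Var 2 * of_poly2 q"
    unfolding of_poly2_def of_poly1.map_poly_pCons_hom by simp
  show "of_poly3 (pCons q p) = of_poly2 q + Var 3 * of_poly3 p"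
    unfolding of_poly3_def of_poly2.map_poly_pCons_hom by simp
qed

lemma of_poly3_to_poly3: "of_poly3 (to_poly3 p) = p"
proof -
  interpret comm_ring_hom "\<lambda>p :: (3, 'a) mpoly. of_poly3 (to_poly3 p)"
    by (rule comm_ring_hom_comp[OF comm_ring_hom_of_poly(3) comm_ring_hom_to_poly3])
  show ?thesis
  proof (induction p rule: mpoly_induct)
    case (Var i)
    show ?case using exhaust_3[of i] by (elim disjE) simp_all
  qed (simp_all add: hom_add hom_mult)
qed

lemma to_poly3_of_poly3: "to_poly3 (of_poly3 p) = p"
proof -
  note hom = comm_ring_hom_comp[OF comm_ring_hom_to_poly3]
  have 1: "to_poly3 (of_poly1 r) = [:[:r:]:]" for r :: "'a poly"
    by (rule poly_hom_eqI[of "\<lambda>r. to_poly3 (of_poly1 r)" "\<lambda>r. [:[:r:]:]",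
          OF hom[OF comm_ring_hom_of_poly(1)] comm_ring_hom_comp[OF comm_ring_hom_pconst
              comm_ring_hom_pconst]])
      simp_all
  have 2: "to_poly3 (of_poly2 q) = [:q:]" for q :: "'a poly poly"
    by (rule poly_hom_eqI[of "\<lambda>q. to_poly3 (of_poly2 q)" "\<lambda>q. [:q:]",
          OF hom[OF comm_ring_hom_of_poly(2)] comm_ring_hom_pconst])
      (simp_all add: 1)
  show ?thesis
    by (rule poly_hom_eqI[of "\<lambda>p. to_poly3 (of_poly3 p)" "\<lambda>p. p",
          OF hom[OF comm_ring_hom_of_poly(3)] comm_ring_hom_id])
      (simp_all add: 2)
qed

lemma mpoly3_dvd_of_dvd_mult:
  fixes x y :: "(3, 'k::field) mpoly" and z :: "'b \<Rightarrow> (3, 'k) mpoly"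
  assumes x: "x \<noteq> 0" and dvd: "\<And>j. x dvd y * z j" and coprime: "\<And>p. (\<And>j. p dvd z j) \<Longrightarrow> p dvd 1"
  shows "x dvd y"
proof -
  interpret t: comm_ring_hom "to_poly3 :: (3, 'k) mpoly \<Rightarrow> _" by (rule comm_ring_hom_to_poly3)
  have "to_poly3 x dvd to_poly3 y"
  proof (rule ufd_dvd_of_dvd_mult[where z = "\<lambda>j. to_poly3 (z j)"])
    show "to_poly3 x \<noteq> 0" using x of_poly3_to_poly3[of x] by auto
    show "to_poly3 x dvd to_poly3 y * to_poly3 (z j)" for j
      using t.hom_dvd[OF dvd[of j]] by (simp add: t.hom_mult)
    fix p assume p: "\<And>j. p dvd to_poly3 (z j)"
    have "of_poly3 p dvd z j" for j
      using of_poly3.hom_dvd[OF p[of j]] by (simp add: of_poly3_to_poly3)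
    then have "of_poly3 p dvd 1" by (rule coprime)
    then show "p dvd 1" using t.hom_dvd[of "of_poly3 p" 1] by (simp add: to_poly3_of_poly3)
  qed
  then show ?thesis using of_poly3.hom_dvd[of "to_poly3 x" "to_poly3 y"] by (simp add:
      of_poly3_to_poly3)
qed

section \<open>Reduced representatives: uniqueness and existence\<close>

lemma homogeneous_dvd_degree_le:
  fixes p q :: "('x::linorder, 'k::idom) mpoly"
  assumes "homogeneous d p" "homogeneous e q" "q \<noteq> 0" "p dvd q"
  shows "d \<le> e"
proof -
  obtain r where r: "q = p * r" using assms(4) by (rule dvdE)
  then have "r * p = q" by (simp only: mult.commute)
  then obtain f where "homogeneous f r"
    using homogeneous_factor[of e r p] assms(2,3) by blast
  with assms(1) have "homogeneous (d + f) q" unfolding r by (rule homogeneous_mult)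
  then have "d + f = e" using assms(2,3) by (rule homogeneous_degree_unique)
  then show ?thesis by simp
qed

text \<open>Cross-multiplication shows that \<open>G $ i\<close> divides
  \<open>H $ i * G $ j\<close> for all \<open>j\<close>. The entries of \<open>G\<close> have no
  common factor, so \<open>G $ i\<close> divides \<open>H $ i\<close>.\<close>

lemma reduced_rep_degree_le:
  fixes G H :: "(3, 'k::field) mpoly ^ 'm::finite"
  assumes G: "reduced_rep d G" and H: "reduced_rep e H" and eq: "\<And>i j. G $ i * H $ j = G $ j * H $
      i"
  shows "d \<le> e"
proof -
  obtain i where i: "G $ i \<noteq> 0"
    using G by (auto simp: reduced_rep_def ratmap_rep_def vec_eq_iff)
  have Hi: "H $ i \<noteq> 0"
  proof
    assume "H $ i = 0"
    then have "G $ i * H $ j = 0" for j by (simp add: eq[of i j])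
    then show False using i H by (auto simp: reduced_rep_def ratmap_rep_def vec_eq_iff)
  qed
  have "G $ i dvd H $ i * G $ j" for j
    using eq[of i j] by (metis dvd_triv_left mult.commute)
  then have "G $ i dvd H $ i"
    by (rule mpoly3_dvd_of_dvd_mult[where z = "\<lambda>j. G $ j", OF i]) (use G in \<open>auto simp:
        reduced_rep_def\<close>)
  moreover have "homogeneous d (G $ i)" "homogeneous e (H $ i)"
    using G H by (simp_all add: reduced_rep_def ratmap_rep_def)
  ultimately show ?thesis
    using homogeneous_dvd_degree_le Hi by blast
qed

lemma same_ratmap_trans:
  fixes F G H :: "('x::{finite, linorder}, 'k::idom) mpoly ^ 'm::finite"
  assumes "same_ratmap G F" "same_ratmap H F"
  shows "G $ i * H $ j = G $ j * H $ i"
proof -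
  obtain k where k: "F $ k \<noteq> 0"
    using assms by (auto simp: same_ratmap_def vec_eq_iff)
  have GF: "G $ i * F $ k = G $ k * F $ i" and HF: "H $ i * F $ k = H $ k * F $ i" for i
    using assms by (auto simp: same_ratmap_def)
  have "(G $ i * H $ j) * (F $ k * F $ k) = (G $ i * F $ k) * (H $ j * F $ k)"
    by (simp only: mult_ac)
  also have "\<dots> = (G $ j * F $ k) * (H $ i * F $ k)"
    unfolding GF HF by (simp only: mult_ac)
  also have "\<dots> = (G $ j * H $ i) * (F $ k * F $ k)"
    by (simp only: mult_ac)
  finally show ?thesis using k by simp
qed

lemma ratmap_degree_eq:
  fixes F G :: "(3, 'k::field) mpoly ^ 'm::finite"
  assumes "reduced_rep d G" "same_ratmap G F"
  shows "ratmap_degree F = d"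
  unfolding ratmap_degree_def
proof (rule the_equality)
  show "\<exists>G. reduced_rep d G \<and> same_ratmap G F" using assms by blast
  fix e assume "\<exists>G. reduced_rep e G \<and> same_ratmap G F"
  then obtain H where H: "reduced_rep e H" "same_ratmap H F" by blast
  show "e = d"
    using reduced_rep_degree_le[OF assms(1) H(1) same_ratmap_trans[OF assms(2) H(2)]]
      reduced_rep_degree_le[OF H(1) assms(1) same_ratmap_trans[OF H(2) assms(2)]] by simp
qed

text \<open>A common factor divides a nonzero form and is therefore a form itself; dividing by it
  leaves forms of smaller degree.\<close>

lemma exists_reduced_rep:
  fixes W :: "('x::{finite, linorder}, 'k::field) mpoly ^ 'm::finite"
  assumes "ratmap_rep d W"
  shows "\<exists>G e. e \<le> d \<and> reduced_rep e G \<and> same_ratmap G W"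
  using assms
proof (induction d arbitrary: W rule: less_induct)
  case (less d)
  show ?case
  proof (cases "\<forall>p. (\<forall>i. p dvd W $ i) \<longrightarrow> p dvd 1")
    case True
    then show ?thesis
      using less.prems by (intro exI[of _ W] exI[of _ d]) (auto simp: reduced_rep_def
          ratmap_rep_def same_ratmap_def mult.commute)
  next
    case False
    then obtain p where p: "\<And>i. p dvd W $ i" "\<not> p dvd 1" by blast
    then have "\<forall>i. \<exists>v. W $ i = p * v" unfolding dvd_def by blast
    then obtain v where v: "\<And>i. W $ i = p * v i" by metis
    obtain k where k: "W $ k \<noteq> 0"
      using less.prems by (auto simp: ratmap_rep_def vec_eq_iff)
    have hom: "homogeneous d (W $ i)" for i using less.prems by (simp add: ratmap_rep_def)
    obtain e where e: "homogeneous e p"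
      using homogeneous_factor[of d p "v k"] hom[of k] k by (auto simp: v)
    have p0: "p \<noteq> 0" using k v by auto
    \<comment> \<open>A nonzero form of degree 0 is a unit of the field, whereas \<open>p\<close> is
      not a unit. Hence the degree really drops and the induction applies.\<close>
    have e0: "e \<noteq> 0"
    proof
      assume "e = 0"
      then obtain c where c: "p = Const c" using e homogeneous_0_eq_Const by blast
      then have "p * Const (inverse c) = 1" using p0 by (simp flip: Const_mult)
      then show False using p(2) by (metis dvd_triv_left)
    qed
    have v_hom: "homogeneous (d - e) (v i)" for i
    proof (cases "v i = 0")
      case False
      have "v i * p = W $ i" by (simp only: v mult.commute)
      moreover have "v i * p \<noteq> 0" using False p0 by simp
      ultimately obtain f where f: "homogeneous f (v i)"
        using homogeneous_factor[of d "v i" p] hom[of i] by auto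
      have "homogeneous (e + f) (W $ i)" unfolding v by (rule homogeneous_mult[OF e f])
      then have "e + f = d" using homogeneous_degree_unique[OF _ hom[of i]] False p0 by (simp add:
          v)
      then show ?thesis using f by auto
    qed simp
    define V where "V = (\<chi> i. v i)"
    have "V \<noteq> 0" using k v by (auto simp: V_def vec_eq_iff)
    then have "ratmap_rep (d - e) V" by (simp add: ratmap_rep_def V_def v_hom)
    moreover have "e \<le> d"
      using homogeneous_dvd_degree_le[OF e hom k p(1)] .
    ultimately obtain G f where G: "f \<le> d - e" "reduced_rep f G" "same_ratmap G V"
      using less.IH[of "d - e" V] e0 by auto
    have "W \<noteq> 0" using less.prems by (simp add: ratmap_rep_def)
    then have "same_ratmap G W"
      using G(3) by (simp add: same_ratmap_def V_def v mult.left_commute)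
    then show ?thesis using G(1,2) by (meson diff_le_self le_trans)
  qed
qed

theorem theorem4p1:
  fixes F :: "(3, 'k::{alg_closed_field, field_char_0}) mpoly ^ 3"
  assumes degree_2: "reduced_rep 2 F"
    and dominant: "dominant F"
    and unstable: "unstable 2 F"
  shows "factors_through_linear_projection F \<or>
    (ratmap_degree (F \<circ>\<^sub>t F) \<le> 2 \<and> \<not> algebraically_stable F)"
proof -
  have F: "F \<in> form_tuples 2" "F \<noteq> 0"
    using degree_2 by (auto simp: form_tuples_def reduced_rep_def ratmap_rep_def)
  obtain P Pi :: "'k ^ 3 ^ 3" where PPi: "P ** Pi = mat 1" "Pi ** P = mat 1"
    and shape: "fibred_shape (act Pi P (coeffs3 F)) \<or> degenerate_shape (act Pi P (coeffs3 F))"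
    by (rule unstable_destabilising_basis[OF F(1) unstable])
  define y where "y i = matrix_tuple Pi $ i" for i
  note basis = F(1) PPi refl y_def refl
  from shape show ?thesis
  proof
    assume "fibred_shape (act Pi P (coeffs3 F))"
    then show ?thesis
      using factors_of_fibred_shape[OF basis _ dominant] by blast
  next
    assume "degenerate_shape (act Pi P (coeffs3 F))"
    then obtain W :: "(3, 'k) mpoly ^ 3" where W: "\<And>i. homogeneous 2 (W $ i)"
      "\<And>i. (F \<circ>\<^sub>t F) $ i = (y 1)\<^sup>2 * W $ i"
      using square_divides_of_degenerate_shape[OF basis] by blast
    obtain i where i: "F $ i \<noteq> 0" using F(2) by (auto simp: vec_eq_iff)
    have "homogeneous 2 (F $ i)" using F(1) by (simp add: form_tuples_def)
    \<comment> \<open>Dominance makes the second iterate a rational map at all.\<close>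
    then have "(F \<circ>\<^sub>t F) $ i \<noteq> 0"
      using comp_nonzero[OF dominant _ i] by (simp add: comp_tuple_nth)
    then have nz: "F \<circ>\<^sub>t F \<noteq> 0" "W \<noteq> 0"
      using W(2)[of i] by (metis zero_index, metis mult_zero_right zero_index)
    then have "ratmap_rep 2 W" using W(1) by (simp add: ratmap_rep_def)
    then obtain G e where G: "e \<le> 2" "reduced_rep e G" "same_ratmap G W"
      using exists_reduced_rep by blast
    have "same_ratmap G (F \<circ>\<^sub>t F)"
      using G(3) nz by (simp add: same_ratmap_def W(2) mult.left_commute)
    then have FF: "ratmap_degree (F \<circ>\<^sub>t F) = e"
      by (rule ratmap_degree_eq[OF G(2)])
    have "ratmap_degree F = 2"
      by (rule ratmap_degree_eq[OF degree_2]) (simp add: same_ratmap_def F(2) mult.commute)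
    moreover have "iterate_tuple 2 F = F \<circ>\<^sub>t F"
      by (simp add: numeral_2_eq_2 vec_eq_iff comp_tuple_nth insertion_Const_Var)
    \<comment> \<open>The second iterate is the witness: its degree is at most 2, whereas stability
      would require \<open>2 ^ 2\<close>.\<close>
    ultimately have "\<not> algebraically_stable F"
      unfolding algebraically_stable_def using FF G(1) by (auto intro!: exI[of _ 2])
    then show ?thesis using FF G(1) by simp
  qed
qed

end
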